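(* Let $k \geq 3$, let $K$ be a $k$-partite $k$-graph on $b$ vertices such that $\gcd(\mathcal{S}(K)) = 1$ and $\gcd(K) > 1$, and let $p$ be the smallest prime factor of $\gcd(K)$. Then for any $\alpha > 0$ there exists $n_0$ such that if $G$ is a $k$-graph on $n \geq n_0$ vertices for which $b$ divides $n$ and $$\delta(G) \geq \max\left\{\sigma(K) n + \alpha n, \frac{n}{p} + \alpha n\right\},$$ then $G$ contains a perfect $K$-packing.
   Context: A $k$-graph ($k$-uniform hypergraph) consists of a finite vertex set and a set of edges, each edge being a set of exactly $k$ vertices. The minimum codegree $\delta(G)$ of a $k$-graph $G$ is the minimum, over all sets $S$ of $k-1$ vertices of $G$, of the number of edges of $G$ containing $S$. A $K$-packing in $G$ is a collection of vertex-disjoint copies of $K$ in $G$ (copies as not necessarily induced subgraphs); it is perfect if it covers every vertex of $G$. A $k$-partite realisation of a $k$-graph $K$ with at least one edge is a partition of $V(K)$ into vertex classes $U_1,\dots,U_k$ such that $|e \cap U_j| = 1$ for every edge $e$ of $K$ and every $1 \leq j \leq k$; $K$ is $k$-partite if it has at least one edge and admits a $k$-partite realisation. For a $k$-partite $k$-graph $K$ define $$\mathcal{S}(K) := \bigcup_\chi \{|U_1|, \dots, |U_k|\}, \qquad \mathcal{D}(K) := \bigcup_\chi \{\,||U_i| - |U_j|| : i,j \in \{1,\dots,k\}\},$$ where each union is over all $k$-partite realisations $\chi$ of $K$ into vertex classes $U_1,\dots,U_k$. Then $\gcd(K)$ is the greatest common divisor of the set $\mathcal{D}(K)$ (undefined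 if $\mathcal{D}(K)=\{0\}$), $\gcd(\mathcal{S}(K))$ is the greatest common divisor of the set $\mathcal{S}(K)$, and $\sigma(K) := \min \mathcal{S}(K) / |V(K)|$. *)

theory Defs
  imports Complex_Main "HOL-Library.Disjoint_Sets" "HOL-Computational_Algebra.Primes"
begin

record 'a hypergraph =
  verts :: "'a set"
  edges :: "'a set set"

definition kgraph :: "nat \<Rightarrow> 'a hypergraph \<Rightarrow> bool" where
  "kgraph k G \<longleftrightarrow> finite (verts G) \<and> (\<forall>e\<in>edges G. e \<subseteq> verts G \<and> card e = k)"

definition min_codegree :: "nat \<Rightarrow> 'a hypergraph \<Rightarrow> nat" where
  "min_codegree k G =
     Min ((\<lambda>S. card {e \<in> edges G. S \<subseteq> e}) ` {S. S \<subseteq> verts G \<and> card S = k - 1})"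

definition copy_in :: "'a hypergraph \<Rightarrow> 'b hypergraph \<Rightarrow> 'b hypergraph \<Rightarrow> bool" where
  "copy_in K G H \<longleftrightarrow>
     verts H \<subseteq> verts G \<and> edges H \<subseteq> edges G \<and>
     (\<exists>f. bij_betw f (verts K) (verts H) \<and> edges H = (\<lambda>e. f ` e) ` edges K)"

definition packing :: "'a hypergraph \<Rightarrow> 'b hypergraph \<Rightarrow> 'b hypergraph set \<Rightarrow> bool" where
  "packing K G P \<longleftrightarrow>
     (\<forall>H\<in>P. copy_in K G H) \<and> pairwise (\<lambda>H H'. disjnt (verts H) (verts H')) P"

definition perfect_packing :: "'a hypergraph \<Rightarrow> 'b hypergraph \<Rightarrow> 'b hypergraph set \<Rightarrow> bool" where
  "perfect_packing K G P \<longleftrightarrow> packing K G P \<and> (\<Union>H\<in>P. verts H) = verts G"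

text \<open>
  Vertex classes are the values of \<open>U\<close> on \<open>{1..k}\<close>; values elsewhere are irrelevant.
  The classes need not be required nonempty: this follows from the last
  condition as soon as \<open>K\<close> has an edge.
\<close>

definition realisation :: "nat \<Rightarrow> 'a hypergraph \<Rightarrow> (nat \<Rightarrow> 'a set) \<Rightarrow> bool" where
  "realisation k K U \<longleftrightarrow>
     (\<Union>j\<in>{1..k}. U j) = verts K \<and> disjoint_family_on U {1..k} \<and>
     (\<forall>e\<in>edges K. \<forall>j\<in>{1..k}. card (e \<inter> U j) = 1)"

definition kpartite :: "nat \<Rightarrow> 'a hypergraph \<Rightarrow> bool" where
  "kpartite k K \<longleftrightarrow> kgraph k K \<and> edges K \<noteq> {} \<and> (\<exists>U. realisation k K U)"

definition class_sizes :: "nat \<Rightarrow> 'a hypergraph \<Rightarrow> nat set" where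
  "class_sizes k K = (\<Union>U\<in>{U. realisation k K U}. {card (U j) | j. j \<in> {1..k}})"

definition class_diffs :: "nat \<Rightarrow> 'a hypergraph \<Rightarrow> nat set" where
  "class_diffs k K =
     (\<Union>U\<in>{U. realisation k K U}.
        {nat \<bar>int (card (U i)) - int (card (U j))\<bar> | i j. i \<in> {1..k} \<and> j \<in> {1..k}})"

text \<open>
  If \<open>class_diffs k K = {0}\<close>, where the gcd is conventionally undefined, the value
  below is \<open>0\<close>; in particular a value greater than \<open>1\<close> implies that it is defined.
\<close>

definition gcd_hypergraph :: "nat \<Rightarrow> 'a hypergraph \<Rightarrow> nat" where
  "gcd_hypergraph k K = Gcd (class_diffs k K)"

definition sigma :: "nat \<Rightarrow> 'a hypergraph \<Rightarrow> real" where
  "sigma k K = real (Min (class_sizes k K)) / real (card (verts K))"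

end

theory Submission
  imports Defs "HOL-Library.FuncSet"
begin

text \<open>
  The proof is an absorption argument.
  Write \<open>N(S)\<close> for the set of vertices \<open>v\<close> such that \<open>insert v S\<close> is an edge, where \<open>S\<close>
  has \<open>k - 1\<close> elements.

  Almost perfect packings come from the condition \<open>\<delta>(G) \<ge> (\<sigma>(K) + \<alpha>) n\<close>. Copies of \<open>K\<close> are
  removed greedily from the set \<open>L\<close> of uncovered vertices, and every step has to preserve
  \<open>card (N(S) \<inter> L) \<ge> (\<sigma>(K) + \<alpha>/2) (card L)\<close> for all \<open>S\<close>. The potential
  \<open>\<Sum>\<^sub>S exp (- \<mu> n (card (N(S) \<inter> L)) / (card L))\<close> controls all these ratios at once. To first order,
  the change of the potential caused by a copy is governed by the total weight of its vertices,
  where \<open>v\<close> gets the weight of all the \<open>S\<close> with \<open>v \<in> N(S)\<close>. So it suffices that for every weight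
  function on \<open>L\<close> there is a copy whose weight is at most about the average weight of \<open>card (verts K)\<close>
  vertices (lemma \<open>light_copy\<close>): place the smallest vertex class among cheap common
  neighbours and all the other classes among the very cheapest vertices. This gives \<open>almost_tiling\<close>.

  Absorption comes from the condition \<open>\<delta>(G) \<ge> (1/p + \<alpha>) n\<close> and \<open>gcd(S(K)) = 1\<close>. A random tuple of
  constant length \<open>s\<close> induces a \<open>k\<close>-graph \<open>H\<close> in which every \<open>(k-1)\<close>-set still has more than \<open>s/p\<close>
  neighbours (\<open>most_samples_good\<close>). Copies of \<open>K\<close> in blow-ups of \<open>H\<close> correspond to homomorphisms
  \<open>K \<rightarrow> H\<close>, and the vectors of their fibre sizes generate a lattice. By \<open>hom_lattice_contains_all\<close>
  this lattice contains every integer vector whose entry sum is divisible by \<open>card (verts K)\<close>.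
  The reason is as follows. In the quotient group the differences of unit vectors are killed by
  \<open>gcd(K)\<close>; since \<open>gcd(S(K)) = 1\<close>, the differences along any edge add up to the same value. Since
  every \<open>k - 1\<close> vertices lie in an edge, the set of differences is then closed under addition; being
  finite, it is a subgroup. The codegree condition
  leaves fewer than \<open>p\<close> differences, whereas every nontrivial subgroup has at least \<open>p\<close> elements,
  as \<open>p\<close> is the smallest prime factor of \<open>gcd(K)\<close>. So all unit vectors are congruent.

  Written out as homomorphisms, membership in the lattice says that some set of bounded size can be
  tiled both with and without any prescribed \<open>card (verts K)\<close> further vertices. The supersaturation
  lemma \<open>blowup_count\<close> shows that a positive proportion of all tuples of vertices are such absorbers
  (\<open>many_absorbers\<close>). A second greedy selection with a potential function then picks linearly many disjoint
  absorbers serving every set of \<open>card (verts K)\<close> vertices (\<open>absorbing_family\<close>). Setting these aside,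
  packing almost all the rest, and absorbing what is left over proves the theorem.
\<close>

section \<open>Counting blow-ups\<close>

text \<open>
  The graph of a power lies above its tangent at \<open>\<mu>\<close>; summed over a finite set this is Jensen's
  inequality.
\<close>

lemma power_ge_tangent:
  fixes x \<mu> :: real
  assumes "x \<ge> 0" "\<mu> \<ge> 0"
  shows "x ^ Suc t \<ge> \<mu> ^ Suc t + real (Suc t) * \<mu> ^ t * (x - \<mu>)"
proof (induction t)
  case 0
  show ?case by simp
next
  case (Suc t)
  have "x * (\<mu> ^ Suc t + real (Suc t) * \<mu> ^ t * (x - \<mu>)) \<le> x * x ^ Suc t"
    using Suc assms by (intro mult_left_mono) auto
  moreover have "x * (\<mu> ^ Suc t + real (Suc t) * \<mu> ^ t * (x - \<mu>))
      = \<mu> ^ Suc (Suc t) + real (Suc (Suc t)) * \<mu> ^ Suc t * (x - \<mu>)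
        + real (Suc t) * \<mu> ^ t * (x - \<mu>)\<^sup>2"
    by (simp add: algebra_simps power2_eq_square)
  moreover have "real (Suc t) * \<mu> ^ t * (x - \<mu>)\<^sup>2 \<ge> 0"
    using assms by simp
  ultimately show ?case by simp
qed

lemma jensen_power:
  fixes f :: "'i \<Rightarrow> real"
  assumes "finite A" "\<And>x. x \<in> A \<Longrightarrow> f x \<ge> 0" "\<mu> \<ge> 0" "real (card A) * \<mu> \<le> (\<Sum>x\<in>A. f x)"
  shows "real (card A) * \<mu> ^ T \<le> (\<Sum>x\<in>A. f x ^ T)"
proof (cases T)
  case 0
  then show ?thesis by simp
next
  case (Suc t)
  have "real (card A) * \<mu> ^ Suc t
      \<le> real (card A) * \<mu> ^ Suc t + real (Suc t) * \<mu> ^ t * ((\<Sum>x\<in>A. f x) - real (card A) * \<mu>)"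
    using assms by simp
  also have "\<dots> = (\<Sum>x\<in>A. \<mu> ^ Suc t + real (Suc t) * \<mu> ^ t * (f x - \<mu>))"
    by (simp add: sum.distrib sum_distrib_left[symmetric] sum_subtractf)
  also have "\<dots> \<le> (\<Sum>x\<in>A. f x ^ Suc t)"
    using assms by (intro sum_mono power_ge_tangent) auto
  finally show ?thesis using Suc by simp
qed

lemma card_real_le_inj:
  assumes "inj_on h A" "h ` A \<subseteq> B" "finite B"
  shows "real (card A) \<le> real (card B)"
  using card_inj_on_le[OF assms] by simp

lemma sum_card_swap:
  assumes "finite W" "finite Z"
  shows "(\<Sum>w\<in>W. card {z\<in>Z. R w z}) = (\<Sum>z\<in>Z. card {w\<in>W. R w z})"
  using sum.swap_restrict[OF assms, of "\<lambda>_ _. 1 :: nat" R] by simp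

text \<open>
  Supersaturation in the style of Erdos: if the set \<open>F\<close> of \<open>I\<close>-tuples has density \<open>d\<close>, then a
  random assignment of vertices to the index set \<open>J\<close>, whose elements are copies of coordinates by way
  of \<open>c\<close>, has all its transversals in \<open>F\<close> with probability at least \<open>d ^ (M ^ card I)\<close>.
  The coordinates are blown up one at a time, each at the cost of one application of Jensen's
  inequality. Coordinates without copies are covered too, which is why transversals are required to
  extend to elements of \<open>F\<close> rather than to be elements of \<open>F\<close>.
\<close>

lemma blowup_count:
  fixes V :: "'v set" and c :: "'j \<Rightarrow> 'i"
  assumes "finite I" "finite J" "c ` J \<subseteq> I" "card J \<le> M" "M \<ge> 1" "finite V" "V \<noteq> {}"
    and "F \<subseteq> (I \<rightarrow>\<^sub>E V)" "0 \<le> d" "d * real (card V) ^ card I \<le> real (card F)"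
  shows "d ^ (M ^ card I) * real (card V) ^ card J \<le>
     real (card {Y \<in> J \<rightarrow>\<^sub>E V. \<forall>X\<subseteq>J. inj_on c X \<longrightarrow> (\<exists>z\<in>F. \<forall>j\<in>X. z (c j) = Y j)})"
  using assms
proof (induction I arbitrary: J F d rule: finite_induct)
  case empty
  then have J: "J = {}" by auto
  show ?case
  proof (cases "F = {}")
    case True
    with empty show ?thesis by simp
  next
    case False
    with empty have "F = {\<lambda>_. undefined}" by auto
    then have "{Y \<in> J \<rightarrow>\<^sub>E V. \<forall>X\<subseteq>J. inj_on c X \<longrightarrow> (\<exists>z\<in>F. \<forall>j\<in>X. z (c j) = Y j)} = {\<lambda>_. undefined}"
      using J by auto
    with empty J \<open>F = _\<close> show ?thesis by simp
  qed
next
  case (insert i I)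
  define n where "n = real (card V)"
  have n: "n > 0" using insert.prems unfolding n_def by (simp add: card_gt_0_iff)
  define Ji where "Ji = {j\<in>J. c j = i}"
  define J' where "J' = J - Ji"
  define W where "W = (Ji \<rightarrow>\<^sub>E V)"
  define Z where "Z = (I \<rightarrow>\<^sub>E V)"
  define Fw where "Fw w = {z \<in> Z. (\<exists>v\<in>V. z(i:=v) \<in> F) \<and> (\<forall>j\<in>Ji. z(i:=w j) \<in> F)}" for w
  define dg where "dg z = card {v\<in>V. z(i:=v) \<in> F}" for z
  have fin: "finite Ji" "finite J'" "finite W" "finite Z" "finite V" "finite J"
    using insert unfolding Ji_def J'_def W_def Z_def by (auto intro!: finite_PiE)
  have cJ: "card J = card Ji + card J'"
    unfolding J'_def Ji_def using fin by (subst card_Un_disjoint[symmetric]) (auto intro!: arg_cong[where f=card])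
  have cJi: "card Ji \<le> M" using cJ insert.prems by simp
  have cW: "real (card W) = n ^ card Ji" and cZ: "real (card Z) = n ^ card I"
    using fin insert by (simp_all add: W_def Z_def card_PiE n_def)
  have dgn: "real (dg z) \<le> n" for z unfolding dg_def n_def using fin by (auto intro!: card_mono)
  have cF: "real (card F) = (\<Sum>z\<in>Z. real (dg z))"
  proof -
    have "bij_betw (\<lambda>(z,v). z(i:=v)) (SIGMA z:Z. {v\<in>V. z(i:=v) \<in> F}) F"
      unfolding bij_betw_def
    proof
      show "inj_on (\<lambda>(z,v). z(i:=v)) (SIGMA z:Z. {v\<in>V. z(i:=v) \<in> F})"
      proof (rule inj_onI, clarsimp)
        fix z v z' v' assume *: "z \<in> Z" "z' \<in> Z" "z(i := v) = z'(i := v')"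
        have "z i = undefined" "z' i = undefined" using * insert unfolding Z_def by auto
        with * show "z = z' \<and> v = v'" by (metis fun_upd_idem_iff fun_upd_same fun_upd_upd)
      qed
      show "(\<lambda>(z,v). z(i:=v)) ` (SIGMA z:Z. {v\<in>V. z(i:=v) \<in> F}) = F"
      proof (intro equalityI subsetI)
        fix f assume f: "f \<in> F"
        then have f': "f \<in> insert i I \<rightarrow>\<^sub>E V" using insert by auto
        have "f(i:=undefined) \<in> Z" unfolding Z_def using f' insert.hyps by (auto simp: PiE_iff extensional_def)
        moreover have "f i \<in> V" using f' by auto
        ultimately show "f \<in> (\<lambda>(z,v). z(i:=v)) ` (SIGMA z:Z. {v\<in>V. z(i:=v) \<in> F})"
          using f by (intro image_eqI[of _ _ "(f(i:=undefined), f i)"]) auto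
      qed auto
    qed
    from bij_betw_same_card[OF this] have "card F = card (SIGMA z:Z. {v\<in>V. z(i:=v) \<in> F})" by simp
    also have "\<dots> = (\<Sum>z\<in>Z. dg z)" using fin by (subst card_SigmaI) (auto simp: dg_def)
    finally show ?thesis by simp
  qed
  \<comment> \<open>The number of extensions \<open>dg z\<close> has mean at least \<open>d n\<close>; a tuple \<open>w\<close> of copies of \<open>i\<close> fits \<open>z\<close> with probability at least \<open>(dg z / n) ^ M\<close>.\<close>
  have "real (card Z) * d ^ M \<le> (\<Sum>z\<in>Z. (real (dg z) / n) ^ M)"
  proof (rule jensen_power)
    have "d * n ^ Suc (card I) \<le> (\<Sum>z\<in>Z. real (dg z))" using insert cF n_def by simp
    then show "real (card Z) * d \<le> (\<Sum>z\<in>Z. real (dg z) / n)"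
      using n by (simp add: sum_divide_distrib[symmetric] cZ field_simps)
  qed (use fin n insert in auto)
  also have "n ^ card Ji * (\<Sum>z\<in>Z. (real (dg z) / n) ^ M) \<le> (\<Sum>w\<in>W. real (card (Fw w)))"
  proof -
    have "(\<Sum>w\<in>W. card {z\<in>Z. z \<in> Fw w}) = (\<Sum>z\<in>Z. card {w\<in>W. z \<in> Fw w})"
      by (rule sum_card_swap) (use fin in auto)
    moreover have "{z\<in>Z. z \<in> Fw w} = Fw w" for w by (auto simp: Fw_def)
    ultimately have eq: "(\<Sum>w\<in>W. real (card (Fw w))) = (\<Sum>z\<in>Z. real (card {w\<in>W. z \<in> Fw w}))"
      by (metis (no_types, lifting) of_nat_sum sum.cong)
    show ?thesis unfolding eq sum_distrib_left
    proof (rule sum_mono)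
      fix z assume z: "z \<in> Z"
      show "n ^ card Ji * (real (dg z) / n) ^ M \<le> real (card {w\<in>W. z \<in> Fw w})"
      proof (cases "dg z = 0")
        case True
        then show ?thesis using insert.prems by (simp add: power_0_left)
      next
        case False
        then obtain v where v: "v \<in> V" "z(i:=v) \<in> F" unfolding dg_def by (metis (mono_tags, lifting) card.empty empty_Collect_eq)
        have "{w\<in>W. z \<in> Fw w} = (Ji \<rightarrow>\<^sub>E {v\<in>V. z(i:=v) \<in> F})"
          unfolding W_def Fw_def using z v by (auto simp: PiE_iff extensional_def)
        then have "real (card {w\<in>W. z \<in> Fw w}) = real (dg z) ^ card Ji"
          using fin by (simp add: card_PiE dg_def)
        moreover have "(real (dg z) / n) ^ M \<le> (real (dg z) / n) ^ card Ji"
          using cJi dgn n by (intro power_decreasing) auto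
        ultimately show ?thesis using n by (simp add: power_divide field_simps)
      qed
    qed
  qed
  finally have avg: "n ^ card Ji * (n ^ card I * d ^ M) \<le> (\<Sum>w\<in>W. real (card (Fw w)))"
    using n cZ by (simp add: mult_left_mono)
  let ?G = "\<lambda>w. {Y \<in> J' \<rightarrow>\<^sub>E V. \<forall>X\<subseteq>J'. inj_on c X \<longrightarrow> (\<exists>z\<in>Fw w. \<forall>j\<in>X. z (c j) = Y j)}"
  let ?T = "{Y \<in> J \<rightarrow>\<^sub>E V. \<forall>X\<subseteq>J. inj_on c X \<longrightarrow> (\<exists>z\<in>F. \<forall>j\<in>X. z (c j) = Y j)}"
  define dw where "dw w = real (card (Fw w)) / n ^ card I" for w
  have IH: "dw w ^ (M ^ card I) * n ^ card J' \<le> real (card (?G w))" for w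
    unfolding n_def
  proof (rule insert.IH)
    show "c ` J' \<subseteq> I" using insert.prems by (auto simp: J'_def Ji_def)
    show "card J' \<le> M" using cJ insert.prems by simp
    show "Fw w \<subseteq> I \<rightarrow>\<^sub>E V" by (auto simp: Fw_def Z_def)
    show "dw w * real (card V) ^ card I \<le> real (card (Fw w))"
      using n by (simp add: dw_def n_def)
  qed (use fin insert.prems n in \<open>auto simp: dw_def\<close>)
  \<comment> \<open>A second use of Jensen averages the bounds for the remaining coordinates over the choices \<open>w\<close>.\<close>
  have "real (card W) * (d ^ M) ^ (M ^ card I) \<le> (\<Sum>w\<in>W. dw w ^ (M ^ card I))"
  proof (rule jensen_power)
    show "real (card W) * d ^ M \<le> (\<Sum>w\<in>W. dw w)"
      using avg n unfolding dw_def sum_divide_distrib[symmetric] cW by (simp add: field_simps)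
  qed (use fin n insert.prems in \<open>auto simp: dw_def\<close>)
  then have "real (card W) * (d ^ M) ^ (M ^ card I) * n ^ card J' \<le> (\<Sum>w\<in>W. dw w ^ (M ^ card I)) * n ^ card J'"
    using n by (simp add: mult_right_mono)
  also have "\<dots> \<le> (\<Sum>w\<in>W. real (card (?G w)))"
    unfolding sum_distrib_right using IH by (intro sum_mono) auto
  also have "\<dots> = real (card (SIGMA w:W. ?G w))"
    using fin by (subst card_SigmaI) (auto intro!: finite_subset[OF _ finite_PiE[of J' "\<lambda>_. V"]])
  also have "\<dots> \<le> real (card ?T)"
  proof (rule card_real_le_inj)
    let ?h = "\<lambda>(w,Y) j. if j \<in> Ji then w j else Y j"
    show "inj_on ?h (SIGMA w:W. ?G w)"
    proof (rule inj_onI, clarify)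
      fix w Y w' Y' assume *: "w \<in> W" "w' \<in> W" "Y \<in> J' \<rightarrow>\<^sub>E V" "Y' \<in> J' \<rightarrow>\<^sub>E V"
        and eq: "(\<lambda>j. if j \<in> Ji then w j else Y j) = (\<lambda>j. if j \<in> Ji then w' j else Y' j)"
      have e: "(if j \<in> Ji then w j else Y j) = (if j \<in> Ji then w' j else Y' j)" for j
        using fun_cong[OF eq] by simp
      have "w = w'"
      proof (rule PiE_ext)
        show "w \<in> Ji \<rightarrow>\<^sub>E V" "w' \<in> Ji \<rightarrow>\<^sub>E V" using * by (auto simp: W_def)
      qed (use e in metis)
      moreover have "Y = Y'"
      proof (rule PiE_ext[OF *(3,4)])
        fix j assume "j \<in> J'" then show "Y j = Y' j" using e[of j] by (auto simp: J'_def)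
      qed
      ultimately show "w = w' \<and> Y = Y'" by simp
    qed
    show "?h ` (SIGMA w:W. ?G w) \<subseteq> ?T"
    proof (rule image_subsetI, clarify)
      fix w Y assume w: "w \<in> W" and Y: "Y \<in> J' \<rightarrow>\<^sub>E V"
        and prp: "\<forall>X\<subseteq>J'. inj_on c X \<longrightarrow> (\<exists>z\<in>Fw w. \<forall>j\<in>X. z (c j) = Y j)"
      let ?Y = "\<lambda>j. if j \<in> Ji then w j else Y j"
      have "?Y \<in> J \<rightarrow>\<^sub>E V" using w Y unfolding W_def J'_def Ji_def by (auto simp: PiE_iff extensional_def)
      moreover have "\<exists>z\<in>F. \<forall>j\<in>X. z (c j) = ?Y j" if X: "X \<subseteq> J" "inj_on c X" for X
      proof -
        have "X \<inter> J' \<subseteq> J'" "inj_on c (X \<inter> J')" using X by (auto intro: inj_on_subset)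
        then obtain z where z: "z \<in> Fw w" "\<forall>j\<in>X\<inter>J'. z (c j) = Y j" using prp by blast
        show ?thesis
        proof (cases "X \<inter> Ji = {}")
          case True
          obtain v where v: "z(i:=v) \<in> F" using z by (auto simp: Fw_def)
          show ?thesis
          proof (intro bexI[OF _ v] ballI)
            fix j assume j: "j \<in> X"
            then have "j \<in> X \<inter> J'" "j \<notin> Ji" "c j \<noteq> i" using True X by (auto simp: J'_def Ji_def)
            then show "(z(i:=v)) (c j) = ?Y j" using z by simp
          qed
        next
          case False
          then obtain j0 where j0: "j0 \<in> X" "j0 \<in> Ji" by auto
          have v: "z(i:=w j0) \<in> F" using z j0 by (auto simp: Fw_def)
          show ?thesis
          proof (intro bexI[OF _ v] ballI)
            fix j assume j: "j \<in> X"
            show "(z(i:=w j0)) (c j) = ?Y j"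
            proof (cases "j \<in> Ji")
              case True
              then have "j = j0" using X j j0 by (auto simp: Ji_def inj_on_def)
              then show ?thesis using True by (simp add: Ji_def)
            next
              case False
              then have "j \<in> X \<inter> J'" "c j \<noteq> i" using j X by (auto simp: J'_def Ji_def)
              then show ?thesis using z False by simp
            qed
          qed
        qed
      qed
      ultimately show "?Y \<in> J \<rightarrow>\<^sub>E V \<and> (\<forall>X\<subseteq>J. inj_on c X \<longrightarrow> (\<exists>z\<in>F. \<forall>j\<in>X. z (c j) = ?Y j))"
        by blast
    qed
    show "finite ?T" using fin by (auto intro!: finite_subset[OF _ finite_PiE[of J "\<lambda>_. V"]])
  qed
  finally have "real (card W) * (d ^ M) ^ (M ^ card I) * n ^ card J' \<le> real (card ?T)" .
  moreover have "d ^ (M ^ card (insert i I)) * n ^ card J = real (card W) * (d ^ M) ^ (M ^ card I) * n ^ card J'"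
    using insert.hyps by (simp add: cW cJ power_add power_mult[symmetric])
  ultimately show ?case unfolding n_def by simp
qed

lemma card_PiE_coincide:
  fixes V :: "'v set"
  assumes "finite J" "finite V" "i \<in> J" "j \<in> J" "i \<noteq> j"
  shows "card {Y \<in> J \<rightarrow>\<^sub>E V. Y i = Y j} \<le> card V ^ (card J - 1)"
proof -
  have "card {Y \<in> J \<rightarrow>\<^sub>E V. Y i = Y j} \<le> card (J - {j} \<rightarrow>\<^sub>E V)"
  proof (rule card_inj_on_le[where f="\<lambda>Y. Y(j:=undefined)"])
    show "inj_on (\<lambda>Y. Y(j := undefined)) {Y \<in> J \<rightarrow>\<^sub>E V. Y i = Y j}"
    proof (rule inj_onI, rule ext)
      fix Y Y' x assume *: "Y \<in> {Y \<in> J \<rightarrow>\<^sub>E V. Y i = Y j}" "Y' \<in> {Y \<in> J \<rightarrow>\<^sub>E V. Y i = Y j}"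
        and eq: "Y(j := undefined) = Y'(j := undefined)"
      have "Y x = Y' x" if "x \<noteq> j" for x using fun_cong[OF eq, of x] that by simp
      then show "Y x = Y' x" using * assms(5) by (cases "x = j") auto
    qed
  qed (use assms in \<open>auto simp: PiE_iff extensional_def intro!: finite_PiE split: if_splits\<close>)
  then show ?thesis using assms by (simp add: card_PiE)
qed

lemma card_PiE_value_in:
  fixes V :: "'v set"
  assumes "finite J" "finite V" "i \<in> J" "Q \<subseteq> V"
  shows "card {Y \<in> J \<rightarrow>\<^sub>E V. Y i \<in> Q} \<le> card Q * card V ^ (card J - 1)"
proof -
  have "card {Y \<in> J \<rightarrow>\<^sub>E V. Y i \<in> Q} \<le> card (Q \<times> (J - {i} \<rightarrow>\<^sub>E V))"
  proof (rule card_inj_on_le[where f="\<lambda>Y. (Y i, Y(i:=undefined))"])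
    show "inj_on (\<lambda>Y. (Y i, Y(i := undefined))) {Y \<in> J \<rightarrow>\<^sub>E V. Y i \<in> Q}"
      by (rule inj_onI) (metis fun_upd_triv fun_upd_upd prod.inject)
  qed (use assms in \<open>auto simp: PiE_iff extensional_def intro!: finite_PiE finite_cartesian_product finite_subset[of Q V] split: if_splits\<close>)
  then show ?thesis using assms by (simp add: card_PiE card_cartesian_product)
qed

lemma card_PiE_not_inj:
  fixes V :: "'v set"
  assumes "finite J" "finite V"
  shows "card {Y \<in> J \<rightarrow>\<^sub>E V. \<not> inj_on Y J} \<le> card J ^ 2 * card V ^ (card J - 1)"
proof -
  let ?P = "{(i,j). i \<in> J \<and> j \<in> J \<and> i \<noteq> j}"
  have P: "?P \<subseteq> J \<times> J" by auto
  have finP: "finite ?P" using finite_subset[OF P] assms by auto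
  have "{Y \<in> J \<rightarrow>\<^sub>E V. \<not> inj_on Y J} \<subseteq> (\<Union>(i,j)\<in>?P. {Y \<in> J \<rightarrow>\<^sub>E V. Y i = Y j})"
    by (auto simp: inj_on_def)
  moreover have fin: "finite (\<Union>(i,j)\<in>?P. {Y \<in> J \<rightarrow>\<^sub>E V. Y i = Y j})"
    using assms by (auto intro!: finite_subset[OF _ finite_PiE[of J "\<lambda>_. V"]])
  ultimately have "card {Y \<in> J \<rightarrow>\<^sub>E V. \<not> inj_on Y J} \<le> card (\<Union>(i,j)\<in>?P. {Y \<in> J \<rightarrow>\<^sub>E V. Y i = Y j})"
    by (rule card_mono[rotated])
  also have "\<dots> \<le> (\<Sum>(i,j)\<in>?P. card {Y \<in> J \<rightarrow>\<^sub>E V. Y i = Y j})"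
    using card_UN_le[OF finP, of "\<lambda>(i,j). {Y \<in> J \<rightarrow>\<^sub>E V. Y i = Y j}"] by (simp add: case_prod_beta)
  also have "\<dots> \<le> (\<Sum>(i,j)\<in>?P. card V ^ (card J - 1))"
    using card_PiE_coincide[OF assms] by (intro sum_mono) auto
  also have "\<dots> = card ?P * card V ^ (card J - 1)" by (simp add: case_prod_beta)
  also have "card ?P \<le> card (J \<times> J)" using P assms by (intro card_mono) auto
  finally show ?thesis by (simp add: card_cartesian_product power2_eq_square)
qed

lemma card_PiE_meets:
  fixes V :: "'v set"
  assumes "finite J" "finite V" "Q \<subseteq> V"
  shows "card {Y \<in> J \<rightarrow>\<^sub>E V. Y ` J \<inter> Q \<noteq> {}} \<le> card J * card Q * card V ^ (card J - 1)"
proof -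
  have "{Y \<in> J \<rightarrow>\<^sub>E V. Y ` J \<inter> Q \<noteq> {}} \<subseteq> (\<Union>i\<in>J. {Y \<in> J \<rightarrow>\<^sub>E V. Y i \<in> Q})" by auto
  moreover have fin: "finite (\<Union>i\<in>J. {Y \<in> J \<rightarrow>\<^sub>E V. Y i \<in> Q})"
    using assms by (auto intro!: finite_subset[OF _ finite_PiE[of J "\<lambda>_. V"]])
  ultimately have "card {Y \<in> J \<rightarrow>\<^sub>E V. Y ` J \<inter> Q \<noteq> {}} \<le> card (\<Union>i\<in>J. {Y \<in> J \<rightarrow>\<^sub>E V. Y i \<in> Q})"
    by (rule card_mono[rotated])
  also have "\<dots> \<le> (\<Sum>i\<in>J. card {Y \<in> J \<rightarrow>\<^sub>E V. Y i \<in> Q})" by (rule card_UN_le[OF assms(1)])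
  also have "\<dots> \<le> (\<Sum>i\<in>J. card Q * card V ^ (card J - 1))"
    using card_PiE_value_in[OF assms(1,2) _ assms(3)] by (intro sum_mono) auto
  finally show ?thesis by simp
qed

section \<open>Copies, tilings and realisations\<close>

text \<open>
  The target is given only by its edge set, so that the same notion serves all vertex subsets at once.
\<close>

definition embeds :: "'a hypergraph \<Rightarrow> 'b set set \<Rightarrow> ('a \<Rightarrow> 'b) \<Rightarrow> bool" where
  "embeds K E f \<longleftrightarrow> inj_on f (verts K) \<and> (\<forall>e\<in>edges K. f ` e \<in> E)"

text \<open>
  Perfect packings of the sub-hypergraph induced on a vertex set, in a form suited to induction; see
  \<open>tileable_imp_perfect_packing\<close>.
\<close>

inductive tileable :: "'a hypergraph \<Rightarrow> 'b set set \<Rightarrow> 'b set \<Rightarrow> bool" for K E where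
  tileable_empty: "tileable K E {}"
| tileable_add: "tileable K E X \<Longrightarrow> embeds K E f \<Longrightarrow> f ` verts K \<inter> X = {} \<Longrightarrow>
    tileable K E (f ` verts K \<union> X)"

lemma tileable_Un:
  "tileable K E X \<Longrightarrow> tileable K E Y \<Longrightarrow> X \<inter> Y = {} \<Longrightarrow> tileable K E (X \<union> Y)"
proof (induction X rule: tileable.induct)
  case (tileable_add X f)
  have "tileable K E (f ` verts K \<union> (X \<union> Y))"
    using tileable_add by (intro tileable.tileable_add) auto
  then show ?case by (simp add: Un_assoc)
qed simp

lemma tileable_embeds: "embeds K E f \<Longrightarrow> tileable K E (f ` verts K)"
  using tileable_add[OF tileable_empty, of K E f] by simp

lemma tileable_UN:
  assumes "finite I" "\<And>i. i \<in> I \<Longrightarrow> tileable K E (X i)"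
    "\<And>i j. i \<in> I \<Longrightarrow> j \<in> I \<Longrightarrow> i \<noteq> j \<Longrightarrow> X i \<inter> X j = {}"
  shows "tileable K E (\<Union>i\<in>I. X i)"
  using assms
proof (induction I rule: finite_induct)
  case (insert i I)
  have "tileable K E (X i \<union> (\<Union>i\<in>I. X i))"
  proof (rule tileable_Un)
    show "X i \<inter> (\<Union>i\<in>I. X i) = {}" using insert.prems(2)[of i] insert.hyps by blast
  qed (use insert in auto)
  then show ?case by simp
qed (simp add: tileable_empty)

lemma tileable_card_dvd:
  assumes "tileable K E X" "finite X"
  shows "card (verts K) dvd card X"
  using assms
proof (induction rule: tileable.induct)
  case (tileable_add X f)
  then have "card (f ` verts K \<union> X) = card (verts K) + card X"
    by (subst card_Un_disjoint) (auto simp: embeds_def card_image)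
  then show ?case using tileable_add by simp
qed simp

lemma tileable_imp_perfect_packing:
  assumes "tileable K (edges G) (verts G)"
  shows "\<exists>P. perfect_packing K G P"
proof -
  have "\<exists>P. packing K G P \<and> (\<Union>H\<in>P. verts H) = X" if "tileable K (edges G) X" "X \<subseteq> verts G" for X
    using that
  proof (induction rule: tileable.induct)
    case tileable_empty
    show ?case by (intro exI[of _ "{}"]) (simp add: packing_def)
  next
    case (tileable_add X f)
    then obtain P where P: "packing K G P" "(\<Union>H\<in>P. verts H) = X" by auto
    define H where "H = \<lparr>verts = f ` verts K, edges = (\<lambda>e. f ` e) ` edges K\<rparr>"
    have "copy_in K G H"
      using tileable_add unfolding copy_in_def H_def embeds_def
      by (auto intro!: exI[of _ f] simp: bij_betw_def)
    moreover have "disjnt (verts H) (verts H')" if "H' \<in> P" for H'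
      using that P tileable_add by (auto simp: H_def disjnt_def)
    ultimately have "packing K G (insert H P)"
      using P unfolding packing_def by (auto simp: pairwise_insert disjnt_sym)
    moreover have "(\<Union>H\<in>insert H P. verts H) = f ` verts K \<union> X" using P by (simp add: H_def)
    ultimately show ?case by blast
  qed
  from this[OF assms] show ?thesis unfolding perfect_packing_def by simp
qed

text \<open>
  Turns a realisation into a homomorphism to a single edge \<open>{1..k}\<close>, which can be composed with other maps.
\<close>

lemma realisation_class_map:
  assumes "realisation k K U" "kgraph k K"
  obtains c where "c ` verts K \<subseteq> {1..k}" "\<And>j. j \<in> {1..k} \<Longrightarrow> {x\<in>verts K. c x = j} = U j"
    "\<And>e. e \<in> edges K \<Longrightarrow> bij_betw c e {1..k}"
proof -
  have U: "(\<Union>j\<in>{1..k}. U j) = verts K" and dis: "disjoint_family_on U {1..k}"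
    and one: "\<And>e j. e\<in>edges K \<Longrightarrow> j\<in>{1..k} \<Longrightarrow> card (e \<inter> U j) = 1"
    using assms unfolding realisation_def by auto
  have "\<forall>x\<in>verts K. \<exists>j. j \<in> {1..k} \<and> x \<in> U j" unfolding U[symmetric] by blast
  then obtain c where c: "\<And>x. x \<in> verts K \<Longrightarrow> c x \<in> {1..k} \<and> x \<in> U (c x)" by metis
  have cl: "{x\<in>verts K. c x = j} = U j" if j: "j \<in> {1..k}" for j
  proof -
    have "c x = j" if "x \<in> U j" for x
    proof (rule ccontr)
      have x: "x \<in> verts K" using that j U by auto
      assume "c x \<noteq> j"
      then show False using disjoint_family_onD[OF dis, of "c x" j] c[OF x] that j by auto
    qed
    then show ?thesis using c j U by auto
  qed
  have bij: "bij_betw c e {1..k}" if e: "e \<in> edges K" for e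
  proof -
    have ev: "e \<subseteq> verts K" "card e = k" "finite e"
      using assms(2) e unfolding kgraph_def by (auto intro: finite_subset)
    have "c ` e = {1..k}"
    proof
      show "c ` e \<subseteq> {1..k}" using ev c by auto
      show "{1..k} \<subseteq> c ` e"
      proof
        fix j assume j: "j \<in> {1..k}"
        then obtain x where "x \<in> e" "x \<in> U j" using one[OF e j] by (metis Int_iff card_1_singletonE insertI1)
        then show "j \<in> c ` e" using cl[OF j] by auto
      qed
    qed
    then show ?thesis unfolding bij_betw_def using ev by (simp add: eq_card_imp_inj_on)
  qed
  show thesis by (rule that[of c]) (use c cl bij in auto)
qed

section \<open>Light copies and almost perfect tilings\<close>

text \<open>
  The codegree condition in the form in which it passes to subsets: relative to the number of vertices.
\<close>

abbreviation codegrees_ge :: "nat \<Rightarrow> 'b set set \<Rightarrow> 'b set \<Rightarrow> real \<Rightarrow> bool" where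
  "codegrees_ge k E V \<theta> \<equiv>
     \<forall>S\<subseteq>V. card S = k - 1 \<longrightarrow> \<theta> * real (card V) \<le> real (card {v\<in>V. insert v S \<in> E})"

lemma lowest_elements:
  fixes y :: "'v \<Rightarrow> real"
  assumes "finite L" "\<And>v. v \<in> L \<Longrightarrow> y v \<ge> 0" "m \<le> card L"
  obtains W t where "W \<subseteq> L" "card W = m" "t \<ge> 0" "\<And>v. v \<in> W \<Longrightarrow> y v \<le> t" "\<And>v. v \<in> L - W \<Longrightarrow> t \<le> y v"
proof -
  have "\<exists>W t. W \<subseteq> L \<and> card W = m \<and> t \<ge> 0 \<and> (\<forall>v\<in>W. y v \<le> t) \<and> (\<forall>v\<in>L-W. t \<le> y v)"
    using assms(3)
  proof (induction m)
    case 0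
    then show ?case using assms by (intro exI[of _ "{}"] exI[of _ 0]) auto
  next
    case (Suc m)
    then obtain W t where W: "W \<subseteq> L" "card W = m" "t \<ge> 0" "\<forall>v\<in>W. y v \<le> t" "\<forall>v\<in>L-W. t \<le> y v" by auto
    have fin: "finite (L - W)" "finite W" using assms W by (auto intro: finite_subset)
    have "L - W \<noteq> {}" using Suc.prems W by (metis Diff_eq_empty_iff card_mono fin(2) not_less_eq_eq)
    then obtain u where u: "u \<in> L - W" "\<forall>v\<in>L-W. y u \<le> y v"
      using ex_min_if_finite[of "y ` (L-W)"] fin by (metis (no_types, lifting) arg_min_if_finite(1) arg_min_least)
    have "insert u W \<subseteq> L" "card (insert u W) = Suc m" using u W fin by auto
    moreover have "\<forall>v\<in>insert u W. y v \<le> y u" using u W by (metis insertE order.trans order_refl)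
    moreover have "y u \<ge> 0" using u assms by auto
    moreover have "\<forall>v\<in>L-insert u W. y u \<le> y v" using u by auto
    ultimately show ?case by blast
  qed
  then show thesis using that by blast
qed

lemma card_subsets_le_power:
  assumes "finite A"
  shows "card {S. S \<subseteq> A \<and> card S = m} \<le> card A ^ m"
  using n_subsets[OF assms, of m] by (cases "m \<le> card A") (auto simp: binomial_le_pow binomial_eq_0)

lemma many_injective_tuples:
  assumes "finite J" "finite W" "2 * card J ^ 2 \<le> card W"
  shows "real (card W) ^ card J \<le> 2 * real (card {u \<in> J \<rightarrow>\<^sub>E W. inj_on u J})"
proof (cases "J = {}")
  case True
  have "{u \<in> J \<rightarrow>\<^sub>E W. inj_on u J} = {\<lambda>_. undefined}" using True by auto
  then show ?thesis using True by simp
next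
  case False
  have fin: "finite (J \<rightarrow>\<^sub>E W)" using assms by (simp add: finite_PiE)
  have "card (J \<rightarrow>\<^sub>E W) = card {u \<in> J \<rightarrow>\<^sub>E W. inj_on u J} + card {u \<in> J \<rightarrow>\<^sub>E W. \<not> inj_on u J}"
    using fin by (subst card_Un_disjoint[symmetric]) (auto intro!: arg_cong[where f=card])
  moreover have "2 * card {u \<in> J \<rightarrow>\<^sub>E W. \<not> inj_on u J} \<le> card W ^ card J"
  proof -
    have "2 * card {u \<in> J \<rightarrow>\<^sub>E W. \<not> inj_on u J} \<le> (2 * card J ^ 2) * card W ^ (card J - 1)"
      using card_PiE_not_inj[OF assms(1,2)] by simp
    also have "\<dots> \<le> card W * card W ^ (card J - 1)" using assms by (intro mult_right_mono) auto
    also have "\<dots> = card W ^ card J" using False assms power_Suc[of "card W" "card J - 1"] by (simp add: card_gt_0_iff)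
    finally show ?thesis .
  qed
  moreover have "card (J \<rightarrow>\<^sub>E W) = card W ^ card J" using assms by (simp add: card_PiE)
  ultimately have "card W ^ card J \<le> 2 * card {u \<in> J \<rightarrow>\<^sub>E W. inj_on u J}" by linarith
  then show ?thesis by (metis of_nat_le_iff of_nat_mult of_nat_numeral of_nat_power)
qed

text \<open>
  The arithmetic behind \<open>light_copy\<close>: \<open>MW\<close> and \<open>MZ\<close> bound the weights in the sets \<open>W\<close> of the \<open>w\<close>
  cheapest and \<open>Z\<close> of the \<open>(1 - \<sigma>) n\<close> cheapest vertices, and \<open>Y\<close> is the total weight.
\<close>

lemma light_cost:
  fixes n w \<sigma> MZ MW Y b \<delta> \<delta>' :: real
  assumes "\<sigma> * n * MZ + ((1 - \<sigma>) * n - 1 - w) * MW \<le> Y" "(n - w) * MW \<le> Y" "MW \<ge> 0"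
    "1 + w \<le> 2 * \<delta>' * n" "w \<le> n / 2" "n > 0" "b \<ge> 0" "8 * \<delta>' \<le> \<delta>" "\<delta>' > 0"
  shows "b * (\<sigma> * MZ + (1 - \<sigma>) * MW) \<le> (1 + \<delta>) * (b / n) * Y"
proof -
  have a: "n / 2 * MW \<le> Y"
  proof -
    have "n / 2 * MW \<le> (n - w) * MW" using assms by (intro mult_right_mono) auto
    then show ?thesis using assms by linarith
  qed
  have Y0: "Y \<ge> 0"
  proof -
    have "0 \<le> n / 2 * MW" using assms by simp
    then show ?thesis using a by linarith
  qed
  have b: "(1 + w) * MW \<le> 2 * \<delta>' * n * MW" using assms by (intro mult_right_mono) auto
  have c: "2 * \<delta>' * n * MW \<le> 4 * \<delta>' * Y"
    using mult_left_mono[OF a, of "4 * \<delta>'"] assms by (simp add: algebra_simps)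
  have d: "4 * \<delta>' * Y \<le> \<delta> * Y" using assms Y0 by (intro mult_right_mono) auto
  have "n * (\<sigma> * MZ + (1 - \<sigma>) * MW) \<le> (1 + \<delta>) * Y"
    using assms(1) b c d by (simp add: algebra_simps)
  then have "b * (n * (\<sigma> * MZ + (1 - \<sigma>) * MW)) \<le> b * ((1 + \<delta>) * Y)" using assms by (intro mult_left_mono) auto
  then show ?thesis using assms by (simp add: field_simps)
qed

text \<open>
  Let \<open>W\<close> consist of a small proportion of cheapest vertices and \<open>Z\<close> of the proportion \<open>1 - \<sigma>\<close> of
  cheapest vertices. Every \<open>(k-1)\<close>-subset of \<open>W\<close> has linearly many neighbours in \<open>Z\<close>, so there are many
  edges with one vertex in \<open>Z\<close> and the others in \<open>W\<close>, and supersaturation yields a copy of \<open>K\<close> with the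
  class \<open>U j0\<close> in \<open>Z\<close> and all other classes in \<open>W\<close>. Such a copy is cheap: each vertex outside \<open>Z\<close>, a
  proportion \<open>\<sigma>\<close> of all, costs at least as much as any vertex of \<open>Z\<close>, and nearly every vertex of \<open>Z\<close>
  costs at least as much as any vertex of \<open>W\<close>.
\<close>

lemma light_copy:
  fixes K :: "'a hypergraph" and \<alpha> \<delta> \<sigma> :: real
  assumes real: "realisation k K U" and kg: "kgraph k K" and j0: "j0 \<in> {1..k}" and k: "k \<ge> 2"
    and b: "b = card (verts K)" "b > 0" and \<sigma>: "\<sigma> = real (card (U j0)) / real b"
    and \<alpha>: "\<alpha> > 0" and \<delta>: "\<delta> > 0"
  shows "\<exists>n0. \<forall>(E :: 'b set set) L y. finite L \<and> card L \<ge> n0 \<and>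
      codegrees_ge k E L (\<sigma> + \<alpha>) \<and>
      (\<forall>v\<in>L. y v \<ge> 0) \<longrightarrow>
      (\<exists>f. embeds K E f \<and> f ` verts K \<subseteq> L \<and>
         (\<Sum>x\<in>verts K. y (f x)) \<le> (1 + \<delta>) * (real b / real (card L)) * (\<Sum>v\<in>L. y v))"
proof -
  obtain c where c: "c ` verts K \<subseteq> {1..k}" and cU: "\<And>j. j \<in> {1..k} \<Longrightarrow> {x\<in>verts K. c x = j} = U j"
    and cbij: "\<And>e. e \<in> edges K \<Longrightarrow> bij_betw c e {1..k}"
    using realisation_class_map[OF real kg] by metis
  have finK: "finite (verts K)" and eK: "\<And>e. e \<in> edges K \<Longrightarrow> e \<subseteq> verts K" using kg by (auto simp: kgraph_def)
  have UK: "U j0 \<subseteq> verts K" using cU[OF j0] by auto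
  have \<sigma>01: "0 \<le> \<sigma>" "\<sigma> \<le> 1" using b \<sigma> card_mono[OF finK UK] by auto
  define \<delta>' where "\<delta>' = min (\<delta> / 8) (1 / 4)"
  have \<delta>': "\<delta>' > 0" "8 * \<delta>' \<le> \<delta>" "\<delta>' \<le> 1/4" using \<delta> by (auto simp: \<delta>'_def)
  define d where "d = \<delta>' ^ (k - 1) * \<alpha> / 4"
  have d: "d > 0" using \<delta>' \<alpha> by (simp add: d_def)
  define D where "D = d ^ (b ^ k)"
  have D: "D > 0" using d by (simp add: D_def)
  define n0 where "n0 = nat \<lceil>Max {4, 2 / \<delta>', 2 / \<alpha>, 2 * real (k-1) ^ 2 / \<delta>', (real b ^ 2 + 1) / D}\<rceil>"
  show ?thesis
  proof (intro exI[of _ n0] allI impI, elim conjE)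
    fix E :: "'b set set" and L :: "'b set" and y :: "'b \<Rightarrow> real"
    assume L: "finite L" "n0 \<le> card L"
      and deg: "codegrees_ge k E L (\<sigma> + \<alpha>)"
      and y: "\<forall>v\<in>L. 0 \<le> y v"
    define n where "n = real (card L)"
    have "Max {4, 2 / \<delta>', 2 / \<alpha>, 2 * real (k-1) ^ 2 / \<delta>', (real b ^ 2 + 1) / D} \<le> n"
      using L unfolding n_def n0_def by linarith
    then have n: "n \<ge> 4" "n \<ge> 2 / \<delta>'" "n \<ge> 2 / \<alpha>" "n \<ge> 2 * real (k-1) ^ 2 / \<delta>'" "n \<ge> (real b ^ 2 + 1) / D"
      by auto
    then have n': "2 \<le> \<delta>' * n" "2 \<le> \<alpha> * n" "2 * real (k-1) ^ 2 \<le> \<delta>' * n" "real b ^ 2 + 1 \<le> D * n"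
      using \<delta>' \<alpha> D by (auto simp: field_simps)
    have \<delta>n: "\<delta>' * n \<le> n / 4" using \<delta>' n by simp
    define w where "w = nat \<lceil>\<delta>' * n\<rceil>"
    define zz where "zz = nat \<lfloor>(1 - \<sigma>) * n\<rfloor>"
    have w: "\<delta>' * n \<le> real w" "real w \<le> \<delta>' * n + 1" unfolding w_def using n' by linarith+
    have "(1 - \<sigma>) * n \<ge> 0" using \<sigma>01 n by simp
    then have zz: "real zz \<le> (1 - \<sigma>) * n" "(1 - \<sigma>) * n - 1 \<le> real zz" unfolding zz_def by linarith+
    have w2: "1 + real w \<le> 2 * \<delta>' * n" "real w \<le> n / 2" using w n' n \<delta>n by linarith+
    have "real w \<le> real (card L)" using w2 n unfolding n_def[symmetric] by linarith
    then have wL: "w \<le> card L" by simp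
    have "(1 - \<sigma>) * n \<le> n" using \<sigma>01 n by (simp add: algebra_simps)
    then have zL: "zz \<le> card L" using zz unfolding n_def by linarith
    obtain W MW where W: "W \<subseteq> L" "card W = w" "MW \<ge> 0" "\<And>v. v \<in> W \<Longrightarrow> y v \<le> MW" "\<And>v. v \<in> L - W \<Longrightarrow> MW \<le> y v"
      using lowest_elements[OF L(1), of y w] y wL by metis
    obtain Z MZ where Z: "Z \<subseteq> L" "card Z = zz" "MZ \<ge> 0" "\<And>v. v \<in> Z \<Longrightarrow> y v \<le> MZ" "\<And>v. v \<in> L - Z \<Longrightarrow> MZ \<le> y v"
      using lowest_elements[OF L(1), of y zz] y zL by metis
    have finWZ: "finite W" "finite Z" using W Z L by (auto intro: finite_subset)
    define J1 where "J1 = {1..k} - {j0}"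
    have J1: "card J1 = k - 1" "finite J1" "insert j0 J1 = {1..k}" "j0 \<notin> J1" using j0 by (auto simp: J1_def)
    define Dj where "Dj = {u \<in> J1 \<rightarrow>\<^sub>E W. inj_on u J1}"
    define F where "F = {z \<in> {1..k} \<rightarrow>\<^sub>E L. z j0 \<in> Z \<and> (\<forall>j\<in>J1. z j \<in> W) \<and> z ` {1..k} \<in> E}"
    have finF: "finite F" unfolding F_def using L by (auto intro!: finite_subset[OF _ finite_PiE[of "{1..k}" "\<lambda>_. L"]])
    have finD: "finite Dj" unfolding Dj_def using finWZ J1 by (auto intro!: finite_subset[OF _ finite_PiE[of J1 "\<lambda>_. W"]])
    have "2 * card J1 ^ 2 \<le> card W"
    proof -
      have "2 * real (k-1) ^ 2 \<le> real w" using n' w by linarith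
      then have "real (2 * (k-1)^2) \<le> real w" by simp
      then show ?thesis using W(2) J1(1) by (simp only: of_nat_le_iff)
    qed
    from many_injective_tuples[OF J1(2) finWZ(1) this]
    have Dj: "real w ^ (k - 1) \<le> 2 * real (card Dj)" unfolding Dj_def using W J1 by simp
    let ?N = "\<lambda>u. {v\<in>Z. insert v (u ` J1) \<in> E}"
    have N: "\<alpha> * n / 2 \<le> real (card (?N u))" if u: "u \<in> Dj" for u
    proof -
      have S: "u ` J1 \<subseteq> L" "card (u ` J1) = k - 1" using u W J1 unfolding Dj_def by (auto simp: card_image)
      then have "(\<sigma> + \<alpha>) * n \<le> real (card {v\<in>L. insert v (u ` J1) \<in> E})" using deg unfolding n_def by blast
      also have "{v\<in>L. insert v (u ` J1) \<in> E} \<subseteq> ?N u \<union> (L - Z)" by auto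
      then have "card {v\<in>L. insert v (u ` J1) \<in> E} \<le> card (?N u \<union> (L - Z))"
        using finWZ L by (intro card_mono) auto
      also have "\<dots> \<le> card (?N u) + card (L - Z)" by (rule card_Un_le)
      also have "card (L - Z) = card L - zz" using Z finWZ by (simp add: card_Diff_subset)
      finally have "(\<sigma> + \<alpha>) * n \<le> real (card (?N u)) + (n - real zz)" using zL by (simp add: n_def of_nat_diff)
      then show ?thesis using zz n' by (simp add: algebra_simps)
    qed
    have "d * n ^ k \<le> real (card F)"
    proof -
      have "d * n ^ k = (\<delta>' * n) ^ (k - 1) * (\<alpha> * n) / 4"
      proof -
        have "n ^ k = n * n ^ (k - 1)" using k by (metis Suc_diff_1 gr0I not_numeral_le_zero power_Suc)
        then show ?thesis by (simp add: d_def power_mult_distrib)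
      qed
      also have "\<dots> \<le> real w ^ (k - 1) * (\<alpha> * n) / 4"
        using w \<delta>' n \<alpha> by (intro divide_right_mono mult_right_mono power_mono) auto
      also have "\<dots> \<le> (2 * real (card Dj)) * (\<alpha> * n) / 4"
        using Dj n \<alpha> by (intro divide_right_mono mult_right_mono) auto
      also have "\<dots> = (\<Sum>u\<in>Dj. \<alpha> * n / 2)" by simp
      also have "\<dots> \<le> (\<Sum>u\<in>Dj. real (card (?N u)))" using N by (intro sum_mono)
      also have "\<dots> = real (card (SIGMA u:Dj. ?N u))" using finD finWZ by (subst card_SigmaI) auto
      also have "\<dots> \<le> real (card F)"
      proof (rule card_real_le_inj)
        show "inj_on (\<lambda>(u,v). u(j0:=v)) (SIGMA u:Dj. ?N u)"
        proof (rule inj_onI, clarsimp)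
          fix u v u' v' assume *: "u \<in> Dj" "u' \<in> Dj" "u(j0 := v) = u'(j0 := v')"
          have "u j0 = undefined" "u' j0 = undefined" using * J1 unfolding Dj_def by auto
          with * show "u = u' \<and> v = v'" by (metis fun_upd_idem_iff fun_upd_same fun_upd_upd)
        qed
        show "(\<lambda>(u,v). u(j0:=v)) ` (SIGMA u:Dj. ?N u) \<subseteq> F"
        proof (rule image_subsetI, clarify)
          fix u v assume u: "u \<in> Dj" and v: "v \<in> Z" "insert v (u ` J1) \<in> E"
          have im: "(u(j0:=v)) ` {1..k} = insert v (u ` J1)"
            unfolding J1(3)[symmetric] using J1(4) by (auto simp: image_iff)
          have "u(j0:=v) \<in> {1..k} \<rightarrow>\<^sub>E L" unfolding J1(3)[symmetric]
            using u v W Z J1 by (auto simp: Dj_def PiE_iff extensional_def)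
          then show "u(j0:=v) \<in> F" unfolding F_def mem_Collect_eq im using u v J1(4) by (auto simp: Dj_def)
        qed
      qed (rule finF)
      finally show ?thesis .
    qed
    then have "d * real (card L) ^ card {1..k} \<le> real (card F)" by (simp add: n_def)
    moreover have "L \<noteq> {}" using n unfolding n_def by auto
    ultimately have count: "d ^ (b ^ card {1..k}) * real (card L) ^ card (verts K) \<le>
     real (card {Y \<in> verts K \<rightarrow>\<^sub>E L. \<forall>X\<subseteq>verts K. inj_on c X \<longrightarrow> (\<exists>z\<in>F. \<forall>j\<in>X. z (c j) = Y j)})" (is "_ \<le> real (card ?T)")
      using c finK b d L by (intro blowup_count) (auto simp: F_def)
    have "\<exists>Y\<in>?T. inj_on Y (verts K)"
    proof (rule ccontr)
      assume "\<not> ?thesis"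
      then have "?T \<subseteq> {Y \<in> verts K \<rightarrow>\<^sub>E L. \<not> inj_on Y (verts K)}" by blast
      then have "card ?T \<le> card {Y \<in> verts K \<rightarrow>\<^sub>E L. \<not> inj_on Y (verts K)}"
        using L finK by (intro card_mono) (auto intro!: finite_subset[OF _ finite_PiE[of "verts K" "\<lambda>_. L"]])
      also have "\<dots> \<le> b ^ 2 * card L ^ (b - 1)" using card_PiE_not_inj[OF finK L(1)] b by simp
      finally have "real (card ?T) \<le> real (b ^ 2 * card L ^ (b - 1))" by (simp only: of_nat_le_iff)
      with count have "D * n ^ b \<le> real b ^ 2 * n ^ (b - 1)" unfolding D_def n_def using b by simp
      then have "(D * n) * n ^ (b - 1) \<le> real b ^ 2 * n ^ (b - 1)"
        using b power_Suc[of n "b - 1"] by (simp add: mult.assoc)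
      then have "D * n \<le> real b ^ 2" using n by simp
      then show False using n' by simp
    qed
    then obtain Y where Y: "Y \<in> verts K \<rightarrow>\<^sub>E L" "inj_on Y (verts K)"
      and YF: "\<And>X. X \<subseteq> verts K \<Longrightarrow> inj_on c X \<Longrightarrow> \<exists>z\<in>F. \<forall>j\<in>X. z (c j) = Y j" by auto
    have "embeds K E Y" unfolding embeds_def
    proof (intro conjI ballI Y)
      fix e assume e: "e \<in> edges K"
      obtain z where z: "z \<in> F" "\<forall>j\<in>e. z (c j) = Y j" using YF[OF eK[OF e]] cbij[OF e] by (auto simp: bij_betw_def)
      have "Y ` e = z ` (c ` e)" using z(2) by (force simp: image_image)
      then show "Y ` e \<in> E" using z cbij[OF e] by (simp add: bij_betw_def F_def)
    qed
    moreover have "Y ` verts K \<subseteq> L" using Y by auto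
    moreover have "(\<Sum>x\<in>verts K. y (Y x)) \<le> (1 + \<delta>) * (real b / n) * (\<Sum>v\<in>L. y v)"
    proof -
      have Yx: "(x \<in> U j0 \<longrightarrow> Y x \<in> Z) \<and> (x \<notin> U j0 \<longrightarrow> Y x \<in> W)" if x: "x \<in> verts K" for x
      proof -
        obtain z where z: "z \<in> F" "z (c x) = Y x" using YF[of "{x}"] x by auto
        have "c x = j0 \<longleftrightarrow> x \<in> U j0" using cU[OF j0] x by auto
        moreover have "c x \<in> {1..k}" using c x by auto
        moreover have "z (c x) \<in> W" if "c x \<noteq> j0"
        proof -
          have "c x \<in> J1" using that \<open>c x \<in> {1..k}\<close> by (simp add: J1_def)
          then show ?thesis using z(1) by (simp add: F_def)
        qed
        moreover have "z j0 \<in> Z" using z(1) by (simp add: F_def)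
        ultimately show ?thesis using z(2) by metis
      qed
      have "(\<Sum>x\<in>verts K. y (Y x)) = (\<Sum>x\<in>U j0. y (Y x)) + (\<Sum>x\<in>verts K - U j0. y (Y x))"
        using finK UK by (metis sum.subset_diff add.commute)
      also have "\<dots> \<le> (\<Sum>x\<in>U j0. MZ) + (\<Sum>x\<in>verts K - U j0. MW)"
        using Yx W Z UK by (intro add_mono sum_mono) auto
      also have "\<dots> = real (card (U j0)) * MZ + (real b - real (card (U j0))) * MW"
        using finK UK b by (simp add: card_Diff_subset finite_subset[OF UK] of_nat_diff card_mono)
      also have "\<dots> = real b * (\<sigma> * MZ + (1 - \<sigma>) * MW)"
        using b by (simp add: \<sigma> field_simps)
      also have "\<dots> \<le> (1 + \<delta>) * (real b / n) * (\<Sum>v\<in>L. y v)"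
      proof (rule light_cost[where w="real w" and \<delta>'=\<delta>'])
        have "(\<Sum>v\<in>L-Z. MZ) + (\<Sum>v\<in>Z-W. MW) \<le> (\<Sum>v\<in>L-Z. y v) + (\<Sum>v\<in>Z-W. y v)"
          using W Z by (intro add_mono sum_mono) auto
        also have "\<dots> \<le> (\<Sum>v\<in>L. y v)"
          using L y Z by (subst sum.union_disjoint[symmetric]) (auto intro!: sum_mono2 intro: finite_subset)
        finally have 1: "real (card (L - Z)) * MZ + real (card (Z - W)) * MW \<le> (\<Sum>v\<in>L. y v)" by simp
        have "real (card (L - Z)) = n - real zz" using Z finWZ zL by (simp add: card_Diff_subset n_def of_nat_diff)
        then have 2: "\<sigma> * n * MZ \<le> real (card (L - Z)) * MZ"
          using zz Z by (intro mult_right_mono) (auto simp: algebra_simps)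
        have "real zz - real w \<le> real (card (Z - W))" using W Z diff_card_le_card_Diff[OF finWZ(1), of Z] by linarith
        then have 3: "((1 - \<sigma>) * n - 1 - real w) * MW \<le> real (card (Z - W)) * MW"
          using zz W by (intro mult_right_mono) auto
        show "\<sigma> * n * MZ + ((1 - \<sigma>) * n - 1 - real w) * MW \<le> (\<Sum>v\<in>L. y v)" using 1 2 3 by linarith
        have "(\<Sum>v\<in>L-W. MW) \<le> (\<Sum>v\<in>L-W. y v)" using W by (intro sum_mono) auto
        also have "\<dots> \<le> (\<Sum>v\<in>L. y v)" using L y by (auto intro!: sum_mono2)
        finally show "(n - real w) * MW \<le> (\<Sum>v\<in>L. y v)"
          using W finWZ wL by (simp add: card_Diff_subset n_def of_nat_diff)
      qed (use W w2 n \<delta>' in auto)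
      finally show ?thesis .
    qed
    ultimately show "\<exists>f. embeds K E f \<and> f ` verts K \<subseteq> L \<and>
         (\<Sum>x\<in>verts K. y (f x)) \<le> (1 + \<delta>) * (real b / real (card L)) * (\<Sum>v\<in>L. y v)"
      unfolding n_def by blast
  qed
qed

lemma eventually_ln_le_linear:
  fixes C \<epsilon> :: real
  assumes "\<epsilon> > 0"
  shows "\<exists>n0. \<forall>n\<ge>n0. C * ln (real n) \<le> \<epsilon> * real n"
proof -
  have "((\<lambda>n. C * (ln (real n) / real n)) \<longlongrightarrow> C * 0) sequentially"
    by (intro tendsto_intros filterlim_compose[OF ln_x_over_x_tendsto_0 filterlim_real_sequentially])
  then have "eventually (\<lambda>n. C * (ln (real n) / real n) < \<epsilon>) sequentially"
    using assms by (intro order_tendstoD(2)) auto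
  then obtain n1 where n1: "\<And>n. n \<ge> n1 \<Longrightarrow> C * (ln (real n) / real n) < \<epsilon>"
    by (auto simp: eventually_sequentially)
  show ?thesis
  proof (intro exI[of _ "Suc n1"] allI impI)
    fix n assume n: "Suc n1 \<le> n"
    then have "C * (ln (real n) / real n) * real n \<le> \<epsilon> * real n"
      using n1[of n] by (intro mult_right_mono) auto
    then show "C * ln (real n) \<le> \<epsilon> * real n" using n by simp
  qed
qed

lemma exp_le_quadratic:
  fixes u :: real
  assumes "\<bar>u\<bar> \<le> 1"
  shows "exp u \<le> 1 + u + u\<^sup>2"
proof (cases "u \<ge> 0")
  case True
  then show ?thesis using exp_bound[of u] assms by simp
next
  case False
  have "1 - u \<le> exp (- u)" using exp_ge_add_one_self[of "-u"] by simp
  then have "(1 - u) * exp u \<le> exp (-u) * exp u" by (intro mult_right_mono) auto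
  then have 1: "(1 - u) * exp u \<le> 1" by (simp add: exp_minus)
  have "u ^ 3 \<le> 0" using False by (simp add: power_le_zero_eq)
  then have "1 \<le> (1 - u) * (1 + u + u\<^sup>2)" by (simp add: algebra_simps power2_eq_square power3_eq_cube)
  with 1 have "(1 - u) * exp u \<le> (1 - u) * (1 + u + u\<^sup>2)" by linarith
  then show ?thesis using False by simp
qed

text \<open>
  The weight of \<open>S\<close> is \<open>exp (- n r)\<close>, where \<open>r = d S / l\<close> is the share of the \<open>l\<close> uncovered vertices that
  are neighbours of \<open>S\<close>. Removing \<open>b\<close> vertices, \<open>X S\<close> of them neighbours, lowers \<open>r\<close> by
  \<open>(X S - b r) / (l - b)\<close>. If the weighted mean of \<open>X S\<close> is at most \<open>(1 + \<delta>)\<close> times that of \<open>b r\<close>, the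
  first-order terms nearly cancel.
\<close>

lemma potential_step:
  fixes d X :: "'s \<Rightarrow> nat" and l b n \<kappa> \<delta> :: real
  assumes fin: "finite \<S>" and l: "l > b" "b > 0"
    and d: "\<And>S. S \<in> \<S> \<Longrightarrow> real (d S) \<le> l" and X: "\<And>S. S \<in> \<S> \<Longrightarrow> real (X S) \<le> b"
    and \<kappa>: "\<kappa> = n / (l - b)" "0 \<le> \<kappa>" "\<kappa> * b \<le> 1" and \<delta>: "\<delta> \<ge> 0"
    and light: "(\<Sum>S\<in>\<S>. exp (- n * (real (d S) / l)) * real (X S))
       \<le> (1 + \<delta>) * (b / l) * (\<Sum>S\<in>\<S>. exp (- n * (real (d S) / l)) * real (d S))"
  shows "(\<Sum>S\<in>\<S>. exp (- n * ((real (d S) - real (X S)) / (l - b))))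
     \<le> (\<Sum>S\<in>\<S>. exp (- n * (real (d S) / l))) * (1 + (\<kappa> * \<delta> * b + (\<kappa> * b)\<^sup>2))"
proof -
  define w where "w S = exp (- n * (real (d S) / l))" for S
  define r where "r S = real (d S) / l" for S
  have r: "0 \<le> r S" "r S \<le> 1" if "S \<in> \<S>" for S using d[OF that] l by (auto simp: r_def)
  have w: "w S \<ge> 0" for S by (simp add: w_def)
  define u where "u S = \<kappa> * (real (X S) - b * r S)" for S
  have ub: "\<bar>u S\<bar> \<le> \<kappa> * b" if "S \<in> \<S>" for S
  proof -
    have "\<bar>real (X S) - b * r S\<bar> \<le> b"
    proof -
      have "0 \<le> b * r S" "b * r S \<le> b" using r[OF that] l by (auto simp: mult_left_le)
      then show ?thesis using X[OF that] by (simp add: abs_le_iff)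
    qed
    then show ?thesis unfolding u_def abs_mult using \<kappa>(2) by (simp add: mult_left_mono)
  qed
  have step: "exp (- n * ((real (d S) - real (X S)) / (l - b))) = w S * exp (u S)" for S
  proof -
    have "- n * ((real (d S) - real (X S)) / (l - b)) = - n * (real (d S) / l) + u S"
      using l by (simp add: u_def r_def \<kappa>(1) field_simps)
    then show ?thesis by (simp only: w_def exp_add)
  qed
  have "(\<Sum>S\<in>\<S>. exp (- n * ((real (d S) - real (X S)) / (l - b)))) = (\<Sum>S\<in>\<S>. w S * exp (u S))"
    by (simp only: step)
  also have "\<dots> \<le> (\<Sum>S\<in>\<S>. w S * (1 + u S + (\<kappa> * b)\<^sup>2))"
  proof (intro sum_mono mult_left_mono w)
    fix S assume S: "S \<in> \<S>"
    have "(u S)\<^sup>2 \<le> (\<kappa> * b)\<^sup>2" using ub[OF S] by (metis abs_ge_zero power2_abs power_mono)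
    then show "exp (u S) \<le> 1 + u S + (\<kappa> * b)\<^sup>2" using exp_le_quadratic[of "u S"] ub[OF S] \<kappa> by linarith
  qed
  also have "\<dots> = (\<Sum>S\<in>\<S>. w S) * (1 + (\<kappa> * b)\<^sup>2) + \<kappa> * ((\<Sum>S\<in>\<S>. w S * real (X S)) - b * (\<Sum>S\<in>\<S>. w S * r S))"
  proof -
    have "w S * (1 + u S + (\<kappa> * b)\<^sup>2) = w S * (1 + (\<kappa> * b)\<^sup>2) + (\<kappa> * (w S * real (X S)) - \<kappa> * b * (w S * r S))" for S
      by (simp add: u_def algebra_simps)
    then show ?thesis
      by (simp only: sum.distrib sum_subtractf sum_distrib_left[symmetric] sum_distrib_right[symmetric])
         (simp add: algebra_simps)
  qed
  also have "(\<Sum>S\<in>\<S>. w S * real (X S)) \<le> (1 + \<delta>) * b * (\<Sum>S\<in>\<S>. w S * r S)"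
  proof -
    have "(b / l) * (\<Sum>S\<in>\<S>. w S * real (d S)) = b * (\<Sum>S\<in>\<S>. w S * r S)"
      by (simp add: r_def sum_divide_distrib[symmetric])
    then show ?thesis using light unfolding w_def[symmetric] by (metis mult.assoc)
  qed
  then have "\<kappa> * ((\<Sum>S\<in>\<S>. w S * real (X S)) - b * (\<Sum>S\<in>\<S>. w S * r S)) \<le> \<kappa> * (\<delta> * b * (\<Sum>S\<in>\<S>. w S * r S))"
    using \<kappa> by (intro mult_left_mono) (auto simp: algebra_simps)
  also have "\<dots> \<le> \<kappa> * (\<delta> * b * (\<Sum>S\<in>\<S>. w S))"
  proof -
    have "(\<Sum>S\<in>\<S>. w S * r S) \<le> (\<Sum>S\<in>\<S>. w S)" using w r by (intro sum_mono) (simp add: mult_left_le)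
    then show ?thesis using \<kappa> \<delta> l by (intro mult_left_mono) auto
  qed
  finally have "(\<Sum>S\<in>\<S>. exp (- n * ((real (d S) - real (X S)) / (l - b))))
     \<le> (\<Sum>S\<in>\<S>. w S) * (1 + (\<kappa> * b)\<^sup>2) + \<kappa> * (\<delta> * b * (\<Sum>S\<in>\<S>. w S))" by linarith
  then show ?thesis unfolding w_def by (simp add: algebra_simps)
qed

text \<open>
  Greedy removal of light copies, with the potential described at the top. The growth factor
  \<open>1 + x\<close> per step is small enough that after at most \<open>card V / b\<close> steps the potential still bounds every
  share of neighbours below by \<open>\<sigma> + \<alpha>/2\<close>.
\<close>

lemma almost_tiling:
  fixes K :: "'a hypergraph" and \<alpha> \<eta> \<sigma> :: real
  assumes real: "realisation k K U" and kg: "kgraph k K" and j0: "j0 \<in> {1..k}" and k: "k \<ge> 2"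
    and b: "b = card (verts K)" "b > 0" and \<sigma>: "\<sigma> = real (card (U j0)) / real b"
    and \<alpha>: "\<alpha> > 0" and \<eta>: "\<eta> > 0"
  shows "\<exists>n0. \<forall>(E :: 'b set set) V. finite V \<and> card V \<ge> n0 \<and>
      codegrees_ge k E V (\<sigma> + \<alpha>) \<longrightarrow>
      (\<exists>L\<subseteq>V. real (card L) \<le> \<eta> * real (card V) \<and> tileable K E (V - L))"
proof -
  define \<delta> where "\<delta> = \<eta> * \<alpha> / 16"
  define \<mu> where "\<mu> = min (\<eta> / (2 * real b)) (\<alpha> * \<eta>\<^sup>2 / (32 * real b))"
  define \<mu>' where "\<mu>' = 2 * \<mu> / \<eta>"
  define x where "x = \<mu>' * \<delta> * real b + (\<mu>' * real b)\<^sup>2"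
  have \<delta>: "\<delta> > 0" using \<eta> \<alpha> by (simp add: \<delta>_def)
  have \<mu>: "\<mu> > 0" "\<mu> \<le> \<eta> / (2 * real b)" "\<mu> \<le> \<alpha> * \<eta>\<^sup>2 / (32 * real b)"
    using \<eta> \<alpha> b unfolding \<mu>_def by auto
  have \<mu>': "\<mu>' > 0" "\<mu>' * real b \<le> 1" using \<mu> \<eta> b by (auto simp: \<mu>'_def field_simps)
  have x0: "x \<ge> 0" using \<mu>' \<delta> by (simp add: x_def)
  \<comment> \<open>Over \<open>n / b\<close> steps the logarithm of the potential grows by at most \<open>\<mu> n \<alpha> / 4\<close>, half of what the slack in the codegrees permits.\<close>
  have xb: "x / real b \<le> \<mu> * \<alpha> / 4"
  proof -
    have 1: "\<mu>' * \<delta> = \<mu> * \<alpha> / 8" using \<eta> by (simp add: \<mu>'_def \<delta>_def)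
    have "\<mu>'\<^sup>2 * real b = 4 * \<mu> * (\<mu> * real b / \<eta>\<^sup>2)" by (simp add: \<mu>'_def power2_eq_square)
    also have "\<dots> \<le> 4 * \<mu> * (\<alpha> / 32)"
      using \<mu> b \<eta> by (intro mult_left_mono) (auto simp: field_simps)
    finally have 2: "\<mu>'\<^sup>2 * real b \<le> \<mu> * \<alpha> / 8" by (simp add: mult.commute)
    have "x / real b = \<mu>' * \<delta> + \<mu>'\<^sup>2 * real b" using b by (simp add: x_def power2_eq_square field_simps)
    with 1 2 show ?thesis by linarith
  qed
  obtain n1 where n1: "\<And>(E :: 'b set set) L y. finite L \<and> card L \<ge> n1 \<and>
      codegrees_ge k E L (\<sigma> + \<alpha>/2) \<and>
      (\<forall>v\<in>L. y v \<ge> 0) \<Longrightarrow>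
      (\<exists>f. embeds K E f \<and> f ` verts K \<subseteq> L \<and>
         (\<Sum>x\<in>verts K. y (f x)) \<le> (1 + \<delta>) * (real b / real (card L)) * (\<Sum>v\<in>L. y v))"
    using light_copy[OF real kg j0 k b \<sigma> _ \<delta>, of "\<alpha>/2", where 'b='b] \<alpha> by auto
  obtain n2 where n2: "\<And>n. n \<ge> n2 \<Longrightarrow> real (k - 1) * ln (real n) \<le> (\<mu> * \<alpha> / 8) * real n"
    using eventually_ln_le_linear[of "\<mu> * \<alpha> / 8" "real (k-1)"] \<mu> \<alpha> by auto
  define n0 where "n0 = Max {1, n2, nat \<lceil>real n1 / \<eta>\<rceil>, nat \<lceil>4 * real b / \<eta>\<rceil>}"
  show ?thesis
  proof (intro exI[of _ n0] allI impI, elim conjE)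
    fix E :: "'b set set" and V :: "'b set"
    assume finV: "finite V" and "n0 \<le> card V"
      and deg: "codegrees_ge k E V (\<sigma> + \<alpha>)"
    define n where "n = real (card V)"
    have "1 \<le> card V" "n2 \<le> card V" "nat \<lceil>real n1 / \<eta>\<rceil> \<le> card V" "nat \<lceil>4 * real b / \<eta>\<rceil> \<le> card V"
      using \<open>n0 \<le> card V\<close> unfolding n0_def by auto
    then have "1 \<le> n" "n2 \<le> card V" "real n1 / \<eta> \<le> n" "4 * real b / \<eta> \<le> n" unfolding n_def by linarith+
    then have n: "1 \<le> n" "n2 \<le> card V" "real n1 \<le> \<eta> * n" "4 * real b \<le> \<eta> * n"
      using \<eta> by (auto simp: field_simps)
    define \<S> where "\<S> = {S. S \<subseteq> V \<and> card S = k - 1}"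
    have fin\<S>: "finite \<S>" unfolding \<S>_def using finV by auto
    define dd where "dd S L = card {v\<in>L. insert v S \<in> E}" for S L
    define \<Phi> where "\<Phi> L = (\<Sum>S\<in>\<S>. exp (- (\<mu> * n) * (real (dd S L) / real (card L))))" for L
    have \<Phi>0: "\<Phi> V \<le> n ^ (k - 1) * exp (- \<mu> * n * (\<sigma> + \<alpha>))"
    proof -
      have "\<Phi> V \<le> (\<Sum>S\<in>\<S>. exp (- \<mu> * n * (\<sigma> + \<alpha>)))" unfolding \<Phi>_def
      proof (rule sum_mono)
        fix S assume S: "S \<in> \<S>"
        then have "(\<sigma> + \<alpha>) \<le> real (dd S V) / real (card V)"
          using deg n unfolding n_def dd_def \<S>_def by (auto simp: pos_le_divide_eq)
        then have "\<mu> * n * (\<sigma> + \<alpha>) \<le> \<mu> * n * (real (dd S V) / real (card V))" using \<mu> n by (intro mult_left_mono) auto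
        then show "exp (- (\<mu> * n) * (real (dd S V) / real (card V))) \<le> exp (- \<mu> * n * (\<sigma> + \<alpha>))" by simp
      qed
      also have "\<dots> = real (card \<S>) * exp (- \<mu> * n * (\<sigma> + \<alpha>))" by simp
      also have "card \<S> \<le> card V ^ (k - 1)" unfolding \<S>_def
        by (rule card_subsets_le_power[OF finV])
      then have "real (card \<S>) \<le> n ^ (k - 1)" unfolding n_def by (metis of_nat_le_iff of_nat_power)
      then have "real (card \<S>) * exp (- \<mu> * n * (\<sigma> + \<alpha>)) \<le> n ^ (k - 1) * exp (- \<mu> * n * (\<sigma> + \<alpha>))" by (intro mult_right_mono) auto
      finally show ?thesis .
    qed
    have main: "\<exists>L\<subseteq>V. tileable K E (V - L) \<and> (real (card L) \<le> \<eta> * n \<or>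
         (card L + i * b = card V \<and> \<Phi> L \<le> \<Phi> V * (1 + x) ^ i))" if "i * b \<le> card V" for i
      using that
    proof (induction i)
      case 0
      show ?case by (intro exI[of _ V]) (simp add: tileable_empty)
    next
      case (Suc i)
      then obtain L where L: "L \<subseteq> V" "tileable K E (V - L)"
        "real (card L) \<le> \<eta> * n \<or> (card L + i * b = card V \<and> \<Phi> L \<le> \<Phi> V * (1 + x) ^ i)" by auto
      show ?case
      proof (cases "real (card L) \<le> \<eta> * n")
        case True
        with L show ?thesis by blast
      next
        case False
        then have Li: "card L + i * b = card V" "\<Phi> L \<le> \<Phi> V * (1 + x) ^ i" using L by auto
        have finL: "finite L" using L finV by (auto intro: finite_subset)
        define l where "l = real (card L)"
        have l: "l > \<eta> * n" using False by (simp add: l_def)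
        then have lb: "l > 4 * real b" "l \<ge> real n1" "l > 0" using n b by linarith+
        have "1 + x \<le> exp x" by (simp add: exp_ge_add_one_self)
        then have "(1 + x) ^ i \<le> exp x ^ i" using x0 by (intro power_mono) auto
        also have "\<dots> = exp (real i * x)" by (simp add: exp_of_nat_mult)
        also have "real i * x \<le> n * (x / real b)"
        proof -
          have "i * b \<le> card V" using Suc.prems by simp
          then have "real i * real b \<le> n" unfolding n_def by (metis of_nat_le_iff of_nat_mult)
          then have "real i * real b * (x / real b) \<le> n * (x / real b)" using x0 b by (intro mult_right_mono) auto
          then show ?thesis using b by simp
        qed
        also have "\<dots> \<le> n * (\<mu> * \<alpha> / 4)" using xb n by (intro mult_left_mono) auto
        finally have pw: "(1 + x) ^ i \<le> exp (n * (\<mu> * \<alpha> / 4))" by simp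
        have "\<Phi> L \<le> (n ^ (k - 1) * exp (- \<mu> * n * (\<sigma> + \<alpha>))) * exp (n * (\<mu> * \<alpha> / 4))"
          using Li \<Phi>0 pw x0 n by (intro order.trans[OF Li(2)] mult_mono) auto
        also have "n ^ (k - 1) = exp (real (k - 1) * ln n)" using n by (simp add: exp_of_nat_mult)
        also have "\<dots> \<le> exp (\<mu> * \<alpha> / 8 * n)" using n2[OF n(2)] unfolding n_def by simp
        finally have \<Phi>L: "\<Phi> L \<le> exp (\<mu> * \<alpha> / 8 * n + - \<mu> * n * (\<sigma> + \<alpha>) + n * (\<mu> * \<alpha> / 4))"
          by (simp only: exp_add mult.assoc) (simp add: mult_ac)
        have degL: "(\<sigma> + \<alpha>/2) * l \<le> real (dd S L)" if S: "S \<in> \<S>" for S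
        proof -
          have "exp (- (\<mu> * n) * (real (dd S L) / l)) \<le> \<Phi> L" unfolding \<Phi>_def l_def
            using S fin\<S> by (intro member_le_sum) auto
          also note \<Phi>L
          finally have "- (\<mu> * n) * (real (dd S L) / l) \<le> \<mu> * \<alpha> / 8 * n + - \<mu> * n * (\<sigma> + \<alpha>) + n * (\<mu> * \<alpha> / 4)" by simp
          then have "(\<mu> * n) * (\<sigma> + \<alpha> * (5/8)) \<le> (\<mu> * n) * (real (dd S L) / l)" by (simp add: algebra_simps)
          then have "\<sigma> + \<alpha> * (5/8) \<le> real (dd S L) / l" by (rule mult_left_le_imp_le) (use \<mu> n in simp)
          then have "\<sigma> + \<alpha> / 2 \<le> real (dd S L) / l" using \<alpha> by simp
          then show ?thesis using lb by (simp add: pos_le_divide_eq)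
        qed
        define w where "w S = exp (- (\<mu> * n) * (real (dd S L) / l))" for S
        \<comment> \<open>With these vertex weights, the weight of a vertex set is the weighted sum of the numbers of neighbours in it.\<close>
        define y where "y v = (\<Sum>S\<in>{S\<in>\<S>. insert v S \<in> E}. w S)" for v
        have y0: "y v \<ge> 0" for v unfolding y_def w_def by (intro sum_nonneg) auto
        have ysum: "(\<Sum>v\<in>A. y v) = (\<Sum>S\<in>\<S>. w S * real (dd S A))" if "finite A" for A
        proof -
          have "(\<Sum>v\<in>A. y v) = (\<Sum>S\<in>\<S>. \<Sum>v\<in>{v\<in>A. insert v S \<in> E}. w S)"
            unfolding y_def by (rule sum.swap_restrict[OF that fin\<S>])
          then show ?thesis by (simp add: dd_def mult.commute)
        qed
        have "finite L \<and> card L \<ge> n1 \<and>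
          codegrees_ge k E L (\<sigma> + \<alpha>/2) \<and>
          (\<forall>v\<in>L. y v \<ge> 0)"
          using finL lb degL y0 L(1) unfolding l_def dd_def \<S>_def by auto
        from n1[OF this] obtain f where f: "embeds K E f" "f ` verts K \<subseteq> L"
          "(\<Sum>x\<in>verts K. y (f x)) \<le> (1 + \<delta>) * (real b / l) * (\<Sum>v\<in>L. y v)" unfolding l_def by auto
        define T where "T = f ` verts K"
        have T: "T \<subseteq> L" "finite T" "card T = b" using f b finL by (auto simp: T_def embeds_def card_image intro: finite_subset)
        define L' where "L' = L - T"
        have cL': "card L' + b = card L" using T finL unfolding L'_def
          by (simp add: card_Diff_subset card_mono le_add_diff_inverse2) (metis card_mono T(1,3) le_add_diff_inverse2)
        then have cL'r: "real (card L') = l - real b" unfolding l_def by linarith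
        have "tileable K E (V - L')"
        proof -
          have "tileable K E (T \<union> (V - L))" unfolding T_def using L f by (intro tileable_add) auto
          moreover have "V - L' = T \<union> (V - L)" using T L unfolding L'_def by auto
          ultimately show ?thesis by simp
        qed
        moreover have "\<Phi> L' \<le> \<Phi> L * (1 + x)"
        proof -
          define \<kappa> where "\<kappa> = (\<mu> * n) / (l - real b)"
          have "l - real b \<ge> \<eta> * n / 2" using lb l n by linarith
          then have "\<kappa> \<le> (\<mu> * n) / (\<eta> * n / 2)" unfolding \<kappa>_def using \<mu> n \<eta> lb b by (intro divide_left_mono mult_pos_pos) auto
          also have "\<dots> = \<mu>'" using n by (simp add: \<mu>'_def)
          finally have \<kappa>: "\<kappa> \<le> \<mu>'" .
          have \<kappa>0: "\<kappa> \<ge> 0" unfolding \<kappa>_def using \<mu> n lb by simp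
          have \<kappa>b: "\<kappa> * real b \<le> \<mu>' * real b" using \<kappa> by (intro mult_right_mono) auto
          have ddX: "real (dd S L') = real (dd S L) - real (dd S T)" for S
          proof -
            have "dd S L' + dd S T = dd S L" unfolding dd_def using T finL
              by (subst card_Un_disjoint[symmetric]) (auto simp: L'_def intro!: arg_cong[where f=card])
            then show ?thesis by linarith
          qed
          have "\<Phi> L' = (\<Sum>S\<in>\<S>. exp (- (\<mu> * n) * ((real (dd S L) - real (dd S T)) / (l - real b))))"
            unfolding \<Phi>_def cL'r ddX ..
          also have "\<dots> \<le> (\<Sum>S\<in>\<S>. exp (- (\<mu> * n) * (real (dd S L) / l))) * (1 + (\<kappa> * \<delta> * real b + (\<kappa> * real b)\<^sup>2))"
          proof (rule potential_step[OF fin\<S> _ _ _ _ \<kappa>_def \<kappa>0])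
            show "real (dd S L) \<le> l" for S unfolding dd_def l_def using finL by (auto intro: card_mono)
            show "real (dd S T) \<le> real b" for S unfolding dd_def using T by (auto intro!: card_mono)
            have "(\<Sum>x\<in>verts K. y (f x)) = (\<Sum>v\<in>T. y v)" unfolding T_def using f by (simp add: embeds_def sum.reindex)
            then show "(\<Sum>S\<in>\<S>. exp (- (\<mu> * n) * (real (dd S L) / l)) * real (dd S T))
              \<le> (1 + \<delta>) * (real b / l) * (\<Sum>S\<in>\<S>. exp (- (\<mu> * n) * (real (dd S L) / l)) * real (dd S L))"
              using f(3) ysum[OF finL] ysum[OF T(2)] unfolding w_def by simp
            show "\<kappa> * real b \<le> 1" using \<kappa>b \<mu>' by linarith
            show "real b < l" using lb by linarith
          qed (use b \<delta> in auto)
          also have "\<dots> \<le> \<Phi> L * (1 + x)"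
          proof -
            have "\<kappa> * \<delta> * real b \<le> \<mu>' * \<delta> * real b" using \<kappa> \<delta> by (intro mult_right_mono) auto
            moreover have "(\<kappa> * real b)\<^sup>2 \<le> (\<mu>' * real b)\<^sup>2" using \<kappa>b \<kappa>0 by (intro power_mono) auto
            ultimately show ?thesis unfolding \<Phi>_def l_def x_def by (intro mult_left_mono add_left_mono add_mono sum_nonneg) auto
          qed
          finally show ?thesis .
        qed
        then have "\<Phi> L' \<le> \<Phi> V * (1 + x) ^ Suc i"
          using mult_right_mono[OF Li(2), of "1 + x"] x0 by (simp add: algebra_simps)
        moreover have "card L' + Suc i * b = card V" using cL' Li by simp
        moreover have "L' \<subseteq> V" using L by (auto simp: L'_def)
        ultimately show ?thesis by blast
      qed
    qed
    obtain L where L: "L \<subseteq> V" "tileable K E (V - L)"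
      "real (card L) \<le> \<eta> * n \<or> card L + (card V div b) * b = card V"
      using main[of "card V div b"] by auto
    have "real (card L) \<le> \<eta> * n"
    proof (rule ccontr)
      assume "\<not> ?thesis"
      then have "card L + (card V div b) * b = card V" "real (card L) > \<eta> * n" using L by auto
      moreover from this have "card L = card V mod b" by (metis add_right_cancel mod_mult_div_eq mult.commute)
      then have "real (card L) \<le> real b" using b by (simp add: less_imp_le)
      ultimately show False using n b by linarith
    qed
    with L show "\<exists>L\<subseteq>V. real (card L) \<le> \<eta> * real (card V) \<and> tileable K E (V - L)" unfolding n_def by blast
  qed
qed

section \<open>The lattice of homomorphisms into a small hypergraph\<close>

text \<open>
  Homomorphisms from \<open>K\<close> to the hypergraph with vertex set \<open>R\<close> and edge set \<open>H\<close>. A copy of \<open>K\<close> in a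
  blow-up of the latter projects to such a map, and uses \<open>fibre K \<kappa> v\<close> vertices from the part of \<open>v\<close>.
\<close>

definition khom :: "'a hypergraph \<Rightarrow> 'c set \<Rightarrow> 'c set set \<Rightarrow> ('a \<Rightarrow> 'c) \<Rightarrow> bool" where
  "khom K R H \<kappa> \<longleftrightarrow> \<kappa> ` verts K \<subseteq> R \<and> (\<forall>e\<in>edges K. \<kappa> ` e \<in> H)"

definition fibre :: "'a hypergraph \<Rightarrow> ('a \<Rightarrow> 'c) \<Rightarrow> 'c \<Rightarrow> nat" where
  "fibre K \<kappa> v = card {x\<in>verts K. \<kappa> x = v}"

abbreviation fibre_sum :: "'a hypergraph \<Rightarrow> ('a \<Rightarrow> 'c) list \<Rightarrow> 'c \<Rightarrow> nat" where
  "fibre_sum K ps v \<equiv> \<Sum>\<kappa>\<leftarrow>ps. fibre K \<kappa> v"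

inductive_set hom_lattice :: "'a hypergraph \<Rightarrow> 'c set \<Rightarrow> 'c set set \<Rightarrow> ('c \<Rightarrow> int) set" for K R H where
  zero: "(\<lambda>_. 0) \<in> hom_lattice K R H"
| add: "f \<in> hom_lattice K R H \<Longrightarrow> khom K R H \<kappa> \<Longrightarrow> (\<lambda>v. f v + int (fibre K \<kappa> v)) \<in> hom_lattice K R H"
| sub: "f \<in> hom_lattice K R H \<Longrightarrow> khom K R H \<kappa> \<Longrightarrow> (\<lambda>v. f v - int (fibre K \<kappa> v)) \<in> hom_lattice K R H"

lemma hom_lattice_plus:
  "f \<in> hom_lattice K R H \<Longrightarrow> h \<in> hom_lattice K R H \<Longrightarrow> (\<lambda>v. f v + h v) \<in> hom_lattice K R H"
proof (induction rule: hom_lattice.induct)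
  case (add f \<kappa>)
  from hom_lattice.add[OF add.IH[OF add.prems] add.hyps(2)] show ?case by (simp add: algebra_simps)
next
  case (sub f \<kappa>)
  from hom_lattice.sub[OF sub.IH[OF sub.prems] sub.hyps(2)] show ?case by (simp add: algebra_simps)
qed simp

lemma hom_lattice_uminus: "f \<in> hom_lattice K R H \<Longrightarrow> (\<lambda>v. - f v) \<in> hom_lattice K R H"
proof (induction rule: hom_lattice.induct)
  case (add f \<kappa>)
  from hom_lattice.sub[OF add.IH add.hyps(2)] show ?case by (simp add: algebra_simps)
next
  case (sub f \<kappa>)
  from hom_lattice.add[OF sub.IH sub.hyps(2)] show ?case by (simp add: algebra_simps)
qed (simp add: hom_lattice.zero)

lemma hom_lattice_minus:
  "f \<in> hom_lattice K R H \<Longrightarrow> h \<in> hom_lattice K R H \<Longrightarrow> (\<lambda>v. f v - h v) \<in> hom_lattice K R H"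
  using hom_lattice_plus[OF _ hom_lattice_uminus, of f K R H h] by simp

lemma hom_lattice_scale: "f \<in> hom_lattice K R H \<Longrightarrow> (\<lambda>v. c * f v) \<in> hom_lattice K R H"
proof -
  assume f: "f \<in> hom_lattice K R H"
  have nat: "(\<lambda>v. int n * f v) \<in> hom_lattice K R H" for n
  proof (induction n)
    case (Suc n)
    from hom_lattice_plus[OF f this] show ?case by (simp add: algebra_simps)
  qed (simp add: hom_lattice.zero)
  show ?thesis
  proof (cases "c \<ge> 0")
    case True
    then show ?thesis using nat[of "nat c"] by simp
  next
    case False
    then show ?thesis using hom_lattice_uminus[OF nat[of "nat (- c)"]] by simp
  qed
qed

lemma hom_lattice_sum:
  "(\<And>i. i \<in> A \<Longrightarrow> F i \<in> hom_lattice K R H) \<Longrightarrow> (\<lambda>v. \<Sum>i\<in>A. F i v) \<in> hom_lattice K R H"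
proof (induction A rule: infinite_finite_induct)
  case (insert i A)
  have "(\<lambda>v. F i v + (\<Sum>i\<in>A. F i v)) \<in> hom_lattice K R H"
    using insert by (intro hom_lattice_plus) auto
  then show ?case using insert by simp
qed (simp_all add: hom_lattice.zero)

lemma hom_lattice_cong: "f \<in> hom_lattice K R H \<Longrightarrow> (\<And>v. f v = h v) \<Longrightarrow> h \<in> hom_lattice K R H"
  using ext[of f h] by simp

text \<open>
  Turns membership in the lattice into a pair of tilings of a blow-up: the copies in \<open>ps\<close> use up what those
  in \<open>ns\<close> use up together with \<open>f\<close>.
\<close>

lemma hom_lattice_lists:
  assumes "f \<in> hom_lattice K R H"
  obtains ps ns where "\<forall>\<kappa>\<in>set ps \<union> set ns. khom K R H \<kappa>"
    "\<And>v. f v = int (fibre_sum K ps v) - int (fibre_sum K ns v)"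
proof -
  have "\<exists>ps ns. (\<forall>\<kappa>\<in>set ps \<union> set ns. khom K R H \<kappa>) \<and>
     (\<forall>v. f v = int (fibre_sum K ps v) - int (fibre_sum K ns v))"
    using assms
  proof (induction rule: hom_lattice.induct)
    case zero
    show ?case by (intro exI[of _ "[]"]) simp
  next
    case (add f \<kappa>)
    then obtain ps ns where "\<forall>\<kappa>\<in>set ps \<union> set ns. khom K R H \<kappa>"
      "\<forall>v. f v = int (fibre_sum K ps v) - int (fibre_sum K ns v)" by auto
    then show ?case using add by (intro exI[of _ "\<kappa> # ps"] exI[of _ ns]) auto
  next
    case (sub f \<kappa>)
    then obtain ps ns where "\<forall>\<kappa>\<in>set ps \<union> set ns. khom K R H \<kappa>"
      "\<forall>v. f v = int (fibre_sum K ps v) - int (fibre_sum K ns v)" by auto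
    then show ?case using sub by (intro exI[of _ ps] exI[of _ "\<kappa> # ns"]) auto
  qed
  then show thesis using that by blast
qed

lemma hom_lattice_Gcd:
  assumes "finite D" "\<And>d. d \<in> D \<Longrightarrow> (\<lambda>v. int d * f v) \<in> hom_lattice K R H"
  shows "(\<lambda>v. int (Gcd D) * f v) \<in> hom_lattice K R H"
  using assms
proof (induction D rule: finite_induct)
  case (insert d D)
  obtain s t where st: "s * int d + t * int (Gcd D) = gcd (int d) (int (Gcd D))" using bezout_int by blast
  have "(\<lambda>v. s * (int d * f v) + t * (int (Gcd D) * f v)) \<in> hom_lattice K R H"
  proof (rule hom_lattice_plus[OF hom_lattice_scale hom_lattice_scale])
    show "(\<lambda>v. int d * f v) \<in> hom_lattice K R H" using insert.prems by simp
    show "(\<lambda>v. int (Gcd D) * f v) \<in> hom_lattice K R H" using insert by simp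
  qed
  then show ?case
  proof (rule hom_lattice_cong)
    fix v
    have "s * (int d * f v) + t * (int (Gcd D) * f v) = (s * int d + t * int (Gcd D)) * f v" by (simp add: algebra_simps)
    also have "\<dots> = int (Gcd (insert d D)) * f v" using st by simp
    finally show "s * (int d * f v) + t * (int (Gcd D) * f v) = int (Gcd (insert d D)) * f v" .
  qed
qed (simp add: hom_lattice.zero)

definition unit_at :: "'c \<Rightarrow> 'c \<Rightarrow> int" where
  "unit_at v x = (if x = v then 1 else 0)"

lemma card_class_le: "realisation k K U \<Longrightarrow> kgraph k K \<Longrightarrow> j \<in> {1..k} \<Longrightarrow> card (U j) \<le> card (verts K)"
  by (rule card_mono) (auto simp: realisation_def kgraph_def)

lemma finite_class_sizes: "kgraph k K \<Longrightarrow> finite (class_sizes k K)"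
  by (rule finite_subset[of _ "{..card (verts K)}"]) (auto simp: class_sizes_def dest: card_class_le)

lemma finite_class_diffs: assumes "kgraph k K" shows "finite (class_diffs k K)"
proof (rule finite_subset)
  show "class_diffs k K \<subseteq> (\<lambda>(x,y). nat \<bar>int x - int y\<bar>) ` (class_sizes k K \<times> class_sizes k K)"
    unfolding class_diffs_def class_sizes_def by fastforce
qed (use assms finite_class_sizes in auto)

lemma sum_class_sizes:
  assumes "realisation k K U" "kgraph k K"
  shows "(\<Sum>j\<in>{1..k}. card (U j)) = card (verts K)"
proof -
  have "U j \<subseteq> verts K" if "j \<in> {1..k}" for j using assms(1) that unfolding realisation_def by blast
  then have "finite (U j)" if "j \<in> {1..k}" for j
    using assms(2) that unfolding kgraph_def by (meson finite_subset)
  then have "card (\<Union>j\<in>{1..k}. U j) = (\<Sum>j\<in>{1..k}. card (U j))"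
    using assms by (intro card_UN_disjoint) (auto simp: realisation_def disjoint_family_on_def)
  then show ?thesis using assms by (simp add: realisation_def)
qed

text \<open>
  Collapsing \<open>K\<close> onto one edge of \<open>H\<close> along a realisation, with any assignment of the classes to the
  vertices of the edge.
\<close>

lemma hom_of_edge:
  assumes "realisation k K U" "kgraph k K" "e \<in> H" "e \<subseteq> R" "bij_betw \<pi> {1..k} e"
  obtains \<kappa> where "khom K R H \<kappa>" "\<And>v. fibre K \<kappa> v = (\<Sum>j\<in>{1..k}. if \<pi> j = v then card (U j) else 0)"
proof -
  obtain c where c: "c ` verts K \<subseteq> {1..k}" and cU: "\<And>j. j \<in> {1..k} \<Longrightarrow> {x\<in>verts K. c x = j} = U j"
    and cbij: "\<And>e. e \<in> edges K \<Longrightarrow> bij_betw c e {1..k}"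
    using realisation_class_map[OF assms(1,2)] by metis
  have finK: "finite (verts K)" using assms by (simp add: kgraph_def)
  have \<pi>: "\<pi> ` {1..k} = e" "inj_on \<pi> {1..k}" using assms(5) by (auto simp: bij_betw_def)
  show thesis
  proof (rule that[of "\<pi> \<circ> c"])
    have "(\<pi> \<circ> c) ` e' \<in> H" if "e' \<in> edges K" for e'
      unfolding image_comp[symmetric] using cbij[OF that] \<pi> assms(3) by (simp only: bij_betw_def)
    moreover have "(\<pi> \<circ> c) ` verts K \<subseteq> R" using c \<pi> assms(4) by auto
    ultimately show "khom K R H (\<pi> \<circ> c)" by (simp add: khom_def)
    fix v
    have "{x \<in> verts K. (\<pi> \<circ> c) x = v} = (\<Union>j\<in>{j\<in>{1..k}. \<pi> j = v}. {x\<in>verts K. c x = j})" using c by auto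
    then have "fibre K (\<pi> \<circ> c) v = card (\<Union>j\<in>{j\<in>{1..k}. \<pi> j = v}. {x\<in>verts K. c x = j})" by (simp add: fibre_def)
    also have "\<dots> = (\<Sum>j\<in>{j\<in>{1..k}. \<pi> j = v}. card {x\<in>verts K. c x = j})"
      using finK by (intro card_UN_disjoint) auto
    also have "\<dots> = (\<Sum>j\<in>{j\<in>{1..k}. \<pi> j = v}. card (U j))" using cU by (intro sum.cong) auto
    also have "\<dots> = (\<Sum>j\<in>{1..k}. if \<pi> j = v then card (U j) else 0)" by (rule sum.inter_filter) simp
    finally show "fibre K (\<pi> \<circ> c) v = (\<Sum>j\<in>{1..k}. if \<pi> j = v then card (U j) else 0)" .
  qed
qed

lemma edge_vector_in_lattice:
  assumes "realisation k K U" "kgraph k K" "e \<in> H" "e \<subseteq> R" "bij_betw \<pi> {1..k} e"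
  shows "(\<lambda>v. \<Sum>j\<in>{1..k}. int (card (U j)) * unit_at (\<pi> j) v) \<in> hom_lattice K R H"
proof -
  obtain \<kappa> where \<kappa>: "khom K R H \<kappa>" "\<And>v. fibre K \<kappa> v = (\<Sum>j\<in>{1..k}. if \<pi> j = v then card (U j) else 0)"
    using hom_of_edge[OF assms] by metis
  from hom_lattice.add[OF hom_lattice.zero \<kappa>(1)] show ?thesis
  proof (rule hom_lattice_cong)
    fix v
    have "0 + int (fibre K \<kappa> v) = (\<Sum>j\<in>{1..k}. int (if \<pi> j = v then card (U j) else 0))" by (simp add: \<kappa>(2))
    also have "\<dots> = (\<Sum>j\<in>{1..k}. int (card (U j)) * unit_at (\<pi> j) v)"
      by (intro sum.cong refl) (auto simp: unit_at_def)
    finally show "0 + int (fibre K \<kappa> v) = (\<Sum>j\<in>{1..k}. int (card (U j)) * unit_at (\<pi> j) v)" .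
  qed
qed

lemma bij_extend_two:
  assumes "bij_betw \<rho> (A - {i,j}) (e - {v,w})" "i \<in> A" "j \<in> A" "i \<noteq> j" "v \<in> e" "w \<in> e" "v \<noteq> w"
  shows "bij_betw (\<rho>(i := v, j := w)) A e"
proof -
  let ?\<pi> = "\<rho>(i := v, j := w)"
  have "bij_betw ?\<pi> (A - {i,j}) (e - {v,w})"
    using assms(1) by (rule bij_betw_cong[THEN iffD1, rotated]) auto
  moreover have "bij_betw ?\<pi> {i,j} {v,w}" using assms by (auto simp: bij_betw_def)
  ultimately have "bij_betw ?\<pi> ((A - {i,j}) \<union> {i,j}) ((e - {v,w}) \<union> {v,w})" by (rule bij_betw_combine) auto
  moreover have "(A - {i,j}) \<union> {i,j} = A" "(e - {v,w}) \<union> {v,w} = e" using assms by auto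
  ultimately show ?thesis by simp
qed

text \<open>
  The difference of the fibre vectors of two collapses onto \<open>e\<close> in which the images \<open>v\<close> and \<open>w\<close> of the
  classes \<open>U i\<close> and \<open>U j\<close> are exchanged.
\<close>

lemma swap_in_lattice:
  assumes real: "realisation k K U" and kg: "kgraph k K" and e: "e \<in> H" "e \<subseteq> R" "finite e" "card e = k"
    and ij: "i \<in> {1..k}" "j \<in> {1..k}" and vw: "v \<in> e" "w \<in> e"
  shows "(\<lambda>x. (int (card (U i)) - int (card (U j))) * (unit_at v x - unit_at w x)) \<in> hom_lattice K R H"
proof (cases "i = j \<or> v = w")
  case True
  then show ?thesis by (auto simp: hom_lattice.zero)
next
  case False
  have "card ({1..k} - {i,j}) = card (e - {v,w})" using False e ij vw by (simp add: card_Diff_subset)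
  then obtain \<tau> where \<tau>: "bij_betw \<tau> ({1..k} - {i,j}) (e - {v,w})"
    using e finite_same_card_bij[of "{1..k} - {i,j}" "e - {v,w}"] by auto
  then have \<tau>': "bij_betw \<tau> ({1..k} - {i,j}) (e - {w,v})" by (simp add: insert_commute)
  define \<pi> where "\<pi> = \<tau>(i := v, j := w)"
  define \<rho> where "\<rho> = \<tau>(i := w, j := v)"
  have \<pi>: "bij_betw \<pi> {1..k} e" "\<pi> i = v" "\<pi> j = w"
    unfolding \<pi>_def using bij_extend_two[OF \<tau>] ij vw False by auto
  have \<rho>: "bij_betw \<rho> {1..k} e" "\<rho> i = w" "\<rho> j = v" "\<And>l. l \<noteq> i \<Longrightarrow> l \<noteq> j \<Longrightarrow> \<rho> l = \<pi> l"
    unfolding \<rho>_def \<pi>_def using bij_extend_two[OF \<tau>'] ij vw False by auto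
  let ?a = "\<lambda>l. int (card (U l))"
  have "(\<lambda>x. (\<Sum>l\<in>{1..k}. ?a l * unit_at (\<pi> l) x) - (\<Sum>l\<in>{1..k}. ?a l * unit_at (\<rho> l) x)) \<in> hom_lattice K R H"
    by (intro hom_lattice_minus edge_vector_in_lattice[OF real kg e(1,2)] \<pi> \<rho>)
  then show ?thesis
  proof (rule hom_lattice_cong)
    fix x
    have "(\<Sum>l\<in>{1..k}. ?a l * unit_at (\<pi> l) x) - (\<Sum>l\<in>{1..k}. ?a l * unit_at (\<rho> l) x)
       = (\<Sum>l\<in>{1..k}. ?a l * unit_at (\<pi> l) x - ?a l * unit_at (\<rho> l) x)" by (simp add: sum_subtractf)
    also have "\<dots> = (\<Sum>l\<in>{i,j}. ?a l * unit_at (\<pi> l) x - ?a l * unit_at (\<rho> l) x)"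
      using ij \<rho> by (intro sum.mono_neutral_right) auto
    also have "\<dots> = (?a i - ?a j) * (unit_at v x - unit_at w x)" using False \<pi> \<rho> by (simp add: algebra_simps)
    finally show "(\<Sum>l\<in>{1..k}. ?a l * unit_at (\<pi> l) x) - (\<Sum>l\<in>{1..k}. ?a l * unit_at (\<rho> l) x) = (?a i - ?a j) * (unit_at v x - unit_at w x)" .
  qed
qed

lemma gcd_swap_in_lattice:
  assumes kg: "kgraph k K" and e: "e \<in> H" "e \<subseteq> R" "finite e" "card e = k" and vw: "v \<in> e" "w \<in> e"
  shows "(\<lambda>x. int (gcd_hypergraph k K) * (unit_at v x - unit_at w x)) \<in> hom_lattice K R H"
  unfolding gcd_hypergraph_def
proof (rule hom_lattice_Gcd[OF finite_class_diffs[OF kg]])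
  fix d assume "d \<in> class_diffs k K"
  then obtain U i j where U: "realisation k K U" "i \<in> {1..k}" "j \<in> {1..k}"
    "d = nat \<bar>int (card (U i)) - int (card (U j))\<bar>" unfolding class_diffs_def by blast
  then have d: "int d = \<bar>int (card (U i)) - int (card (U j))\<bar>" by simp
  show "(\<lambda>x. int d * (unit_at v x - unit_at w x)) \<in> hom_lattice K R H"
  proof (cases "card (U i) \<ge> card (U j)")
    case True
    then have "int d = int (card (U i)) - int (card (U j))" using d by simp
    then show ?thesis using swap_in_lattice[OF U(1) kg e U(2,3) vw] by simp
  next
    case False
    then have "int d = int (card (U j)) - int (card (U i))" using d by simp
    then show ?thesis using swap_in_lattice[OF U(1) kg e U(3,2) vw] by simp
  qed
qed

text \<open>
  A prime dividing both \<open>j\<close> and \<open>g\<close> would be at most \<open>j\<close>, and at least \<open>p\<close> as a prime factor of \<open>g\<close>.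
\<close>

lemma coprime_below_min_prime_factor:
  fixes g :: nat
  assumes "g > 1" "p = Min (prime_factors g)" "0 < j" "j < p"
  shows "coprime j g"
proof (rule ccontr)
  assume "\<not> coprime j g"
  then have "gcd j g \<noteq> 1" by (simp add: coprime_iff_gcd_eq_1)
  then obtain q where q: "prime q" "q dvd gcd j g" using prime_factor_nat by blast
  then have "q \<in> prime_factors g" using assms by (auto simp: prime_factors_dvd)
  then have "p \<le> q" using assms by (simp add: Min_le)
  moreover have "q \<le> j" using q assms by (auto intro: dvd_imp_le)
  ultimately show False using assms by simp
qed

text \<open>
  All computations take place modulo the lattice. With \<open>y v\<close> the difference of the unit vectors at \<open>v\<close> and
  at a fixed \<open>v0\<close>, the argument shows in turn that \<open>gcd(K) y v\<close> vanishes, that the edge sums \<open>D e\<close> of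
  \<open>y\<close> all agree, that the set of values of \<open>y\<close> is closed under addition, and that a nonzero value would
  have \<open>p\<close> distinct multiples. Each value is attained on more than a proportion \<open>1/p\<close> of
  \<open>R\<close>, so the last alternative is impossible.
\<close>

lemma hom_lattice_contains_all:
  fixes K :: "'a hypergraph" and R :: "'c set"
  assumes k: "k \<ge> 3" and kp: "kpartite k K" and S1: "Gcd (class_sizes k K) = 1"
    and g: "gcd_hypergraph k K > 1" and p: "p = Min (prime_factors (gcd_hypergraph k K))"
    and R: "finite R" "p * k \<le> card R"
    and H: "\<And>e. e \<in> H \<Longrightarrow> e \<subseteq> R \<and> card e = k"
    and deg: "\<And>I. I \<subseteq> R \<Longrightarrow> card I = k - 1 \<Longrightarrow> card R < p * card {w\<in>R. insert w I \<in> H}"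
    and h: "\<And>v. v \<notin> R \<Longrightarrow> h v = 0" "int (card (verts K)) dvd (\<Sum>v\<in>R. h v)"
  shows "h \<in> hom_lattice K R H"
proof -
  let ?L = "hom_lattice K R H"
  define g' where "g' = gcd_hypergraph k K"
  define b where "b = card (verts K)"
  have kg: "kgraph k K" using kp by (simp add: kpartite_def)
  obtain U0 where U0: "realisation k K U0" using kp by (auto simp: kpartite_def)
  have p0: "p > 0"
  proof -
    have "finite (prime_factors g')" "prime_factors g' \<noteq> {}"
      using g prime_factor_nat[of g'] by (auto simp: g'_def prime_factors_dvd)
    then have "p \<in> prime_factors g'" using p by (simp add: g'_def Min_in)
    then show ?thesis by (auto simp: prime_gt_0_nat in_prime_factors_iff)
  qed
  have cop: "coprime j g'" if "0 < j" "j < p" for j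
    using coprime_below_min_prime_factor[OF g p that] by (simp add: g'_def)
  have finH: "e \<subseteq> R" "card e = k" "finite e" if "e \<in> H" for e
    using H[OF that] R by (auto intro: finite_subset)
  have ext: "\<exists>w. w \<in> R \<and> insert w I \<in> H" if "I \<subseteq> R" "card I = k - 1" for I
  proof (rule ccontr)
    assume "\<not> ?thesis"
    then have "{w\<in>R. insert w I \<in> H} = {}" by auto
    with deg[OF that] show False by simp
  qed
  have "k \<le> p * k" using p0 by simp
  then have kR: "k \<le> card R" using R by linarith
  have superset: "\<exists>I. A \<subseteq> I \<and> I \<subseteq> R \<and> card I = k - 1" if "A \<subseteq> R" "card A \<le> k - 1" for A
  proof -
    have "finite A" using that R by (auto intro: finite_subset)
    have "k - 1 - card A \<le> card (R - A)" using that kR \<open>finite A\<close> by (simp add: card_Diff_subset)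
    then obtain B where B: "B \<subseteq> R - A" "card B = k - 1 - card A" by (metis obtain_subset_with_card_n)
    have "finite B" using B R by (auto intro: finite_subset)
    then have "card (A \<union> B) = k - 1" using B that \<open>finite A\<close> by (subst card_Un_disjoint) auto
    then show ?thesis using B that by (intro exI[of _ "A \<union> B"]) auto
  qed
  have gvw: "(\<lambda>x. int g' * (unit_at v x - unit_at w x)) \<in> ?L" if vw: "v \<in> R" "w \<in> R" for v w
  proof -
    have "card {v,w} \<le> 2" by (simp add: card_insert_if)
    then have "card {v,w} \<le> k - 1" using k by linarith
    then obtain I where I: "{v,w} \<subseteq> I" "I \<subseteq> R" "card I = k - 1" using superset[of "{v,w}"] vw by auto
    then obtain z where z: "insert z I \<in> H" using ext by blast
    show ?thesis unfolding g'_def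
      using gcd_swap_in_lattice[OF kg z finH(1)[OF z] finH(3)[OF z] finH(2)[OF z]] I by auto
  qed
  obtain v0 where v0: "v0 \<in> R" using kR k by fastforce
  define y where "y v x = unit_at v x - unit_at v0 x" for v x
  have gy: "(\<lambda>x. int g' * y v x) \<in> ?L" if "v \<in> R" for v
    unfolding y_def using gvw[OF that v0] .
  define D where "D e x = (\<Sum>v\<in>e. y v x)" for e x
  \<comment> \<open>The class sizes of a realisation agree modulo \<open>gcd(K)\<close>, so in the fibre vector of an edge all of them can be replaced by one of them.\<close>
  have aD: "(\<lambda>x. int a * D e x + int b * unit_at v0 x) \<in> ?L" if a: "a \<in> class_sizes k K" and e: "e \<in> H" for a e
  proof -
    obtain U i where U: "realisation k K U" and i: "i \<in> {1..k}" and ai: "a = card (U i)"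
      using a unfolding class_sizes_def by auto
    obtain \<pi> where \<pi>: "bij_betw \<pi> {1..k} e"
      using finite_same_card_bij[of "{1..k}" e] finH[OF e] by auto
    have "(\<lambda>x. (int (card (U j)) - int a) * y (\<pi> j) x) \<in> ?L" if j: "j \<in> {1..k}" for j
    proof -
      have "nat \<bar>int (card (U j)) - int a\<bar> \<in> class_diffs k K"
        unfolding class_diffs_def ai using U i j by blast
      then have "g' dvd nat \<bar>int (card (U j)) - int a\<bar>" unfolding g'_def gcd_hypergraph_def by (rule Gcd_dvd)
      then have "int g' dvd (int (card (U j)) - int a)" by (simp flip: int_dvd_int_iff)
      then obtain q where q: "int (card (U j)) - int a = int g' * q" by (auto elim: dvdE)
      have "\<pi> j \<in> R" using \<pi> j finH(1)[OF e] by (auto simp: bij_betw_def)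
      from hom_lattice_scale[OF gy[OF this], of q] show ?thesis
        unfolding q by (rule hom_lattice_cong) (simp add: algebra_simps)
    qed
    then have 1: "(\<lambda>x. \<Sum>j\<in>{1..k}. (int (card (U j)) - int a) * y (\<pi> j) x) \<in> ?L" by (rule hom_lattice_sum)
    have 2: "(\<lambda>x. \<Sum>j\<in>{1..k}. int (card (U j)) * unit_at (\<pi> j) x) \<in> ?L"
      by (rule edge_vector_in_lattice[OF U kg e finH(1)[OF e] \<pi>])
    from hom_lattice_minus[OF 2 1] show ?thesis
    proof (rule hom_lattice_cong)
      fix x
      have "(\<Sum>j\<in>{1..k}. int (card (U j)) * unit_at (\<pi> j) x) - (\<Sum>j\<in>{1..k}. (int (card (U j)) - int a) * y (\<pi> j) x)
         = (\<Sum>j\<in>{1..k}. int a * y (\<pi> j) x + int (card (U j)) * unit_at v0 x)"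
        by (simp add: sum_subtractf[symmetric] y_def algebra_simps)
      also have "\<dots> = int a * (\<Sum>j\<in>{1..k}. y (\<pi> j) x) + int (\<Sum>j\<in>{1..k}. card (U j)) * unit_at v0 x"
        by (simp add: sum.distrib sum_distrib_left sum_distrib_right)
      also have "(\<Sum>j\<in>{1..k}. y (\<pi> j) x) = D e x"
        unfolding D_def using \<pi> by (rule sum.reindex_bij_betw)
      finally show "(\<Sum>j\<in>{1..k}. int (card (U j)) * unit_at (\<pi> j) x) - (\<Sum>j\<in>{1..k}. (int (card (U j)) - int a) * y (\<pi> j) x)
          = int a * D e x + int b * unit_at v0 x"
        by (simp only: sum_class_sizes[OF U kg] b_def)
    qed
  qed
  \<comment> \<open>The edge sums agree after multiplication by any class size, hence by the gcd of the class sizes, which is 1.\<close>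
  have DD: "(\<lambda>x. D e x - D e' x) \<in> ?L" if e: "e \<in> H" "e' \<in> H" for e e'
  proof -
    have "(\<lambda>x. int (Gcd (class_sizes k K)) * (D e x - D e' x)) \<in> ?L"
    proof (rule hom_lattice_Gcd[OF finite_class_sizes[OF kg]])
      fix a assume a: "a \<in> class_sizes k K"
      from hom_lattice_minus[OF aD[OF a e(1)] aD[OF a e(2)]]
      show "(\<lambda>x. int a * (D e x - D e' x)) \<in> ?L" by (rule hom_lattice_cong) (simp add: algebra_simps)
    qed
    then show ?thesis using S1 by simp
  qed
  define C where "C v = {w\<in>R. (\<lambda>x. y w x - y v x) \<in> ?L}" for v
  have finC: "finite (C v)" for v using R by (simp add: C_def)
  \<comment> \<open>Exchanging one vertex of an edge for another neighbour of the rest keeps the edge sum, so all these neighbours are congruent.\<close>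
  have Cp: "card R < p * card (C v)" if v: "v \<in> R" for v
  proof -
    have "card {v} \<le> k - 1" using k by simp
    then obtain I where I: "{v} \<subseteq> I" "I \<subseteq> R" "card I = k - 1" using superset[of "{v}"] v by auto
    then obtain w where w: "w \<in> R" "insert w I \<in> H" using ext by blast
    define e where "e = insert w I"
    have e: "e \<in> H" "v \<in> e" using w I by (auto simp: e_def)
    have J: "e - {v} \<subseteq> R" "card (e - {v}) = k - 1" using finH[OF e(1)] e by auto
    have "{w'\<in>R. insert w' (e - {v}) \<in> H} \<subseteq> C v"
    proof safe
      fix w' assume w': "w' \<in> R" "insert w' (e - {v}) \<in> H"
      have fe: "finite (e - {v})" using finH(3)[OF e(1)] by simp
      have "w' \<notin> e - {v}"
      proof
        assume "w' \<in> e - {v}"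
        then have "insert w' (e - {v}) = e - {v}" by auto
        then show False using finH(2)[OF w'(2)] J k by simp
      qed
      then have "D (insert w' (e - {v})) x = y w' x + D (e - {v}) x" for x
        unfolding D_def using fe by simp
      moreover have "D e x = y v x + D (e - {v}) x" for x
        unfolding D_def using finH(3)[OF e(1)] e(2) by (simp add: sum.remove)
      ultimately have "(\<lambda>x. y w' x - y v x) \<in> ?L" using DD[OF w'(2) e(1)] by (simp add: algebra_simps)
      then show "w' \<in> C v" using w' by (simp add: C_def)
    qed
    then have "card {w'\<in>R. insert w' (e - {v}) \<in> H} \<le> card (C v)" using finC by (intro card_mono)
    then have "p * card {w'\<in>R. insert w' (e - {v}) \<in> H} \<le> p * card (C v)" by simp
    then show ?thesis using deg[OF J] by linarith
  qed
  have Ck: "k < card (C v)" if "v \<in> R" for v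
  proof -
    have "p * k < p * card (C v)" using Cp[OF that] R by linarith
    then show ?thesis using p0 by simp
  qed
  obtain I0 where I0: "I0 \<subseteq> R" "card I0 = k - 1" using superset[of "{}"] by auto
  then obtain e0 where e0: "e0 \<in> H" using ext by blast
  \<comment> \<open>Take an edge consisting of \<open>v\<close>, a vertex congruent to \<open>w\<close>, some \<open>z\<close>, and \<open>k - 3\<close> vertices congruent to \<open>v0\<close>, which contribute nothing; as the classes are large, its vertices can be chosen distinct.\<close>
  have third: "\<exists>z\<in>R. (\<lambda>x. D e0 x - y v x - y w x - y z x) \<in> ?L" if v: "v \<in> R" and w: "w \<in> R" for v w
  proof -
    have "C w - {v} \<noteq> {}"
    proof
      assume "C w - {v} = {}"
      then have "card (C w) \<le> card {v}" by (intro card_mono) auto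
      then show False using Ck[OF w] k by simp
    qed
    then obtain v2 where v2: "v2 \<in> C w" "v2 \<noteq> v" by auto
    have "k - 3 \<le> card (C v0 - {v,v2})"
    proof -
      have "card (C v0) - card {v,v2} \<le> card (C v0 - {v,v2})" by (rule diff_card_le_card_Diff) simp
      then show ?thesis using Ck[OF v0] v2 by (simp add: card_insert_if)
    qed
    then obtain X where X: "X \<subseteq> C v0 - {v,v2}" "card X = k - 3" by (metis obtain_subset_with_card_n)
    have finX: "finite X" using X finC[of v0] by (auto intro: finite_subset)
    define I where "I = insert v (insert v2 X)"
    have I: "I \<subseteq> R" "card I = k - 1" using X v v2 k finX unfolding I_def by (auto simp: C_def card_insert_if)
    then obtain z where z: "z \<in> R" "insert z I \<in> H" using ext by blast
    have "z \<notin> I" using finH(2)[OF z(2)] I k by (metis Suc_diff_1 insert_absorb n_not_Suc_n not_gr_zero not_numeral_le_zero)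
    then have De: "D (insert z I) x = y z x + (y v x + (y v2 x + (\<Sum>u\<in>X. y u x)))" for x
    proof -
      have "v \<notin> X" "v2 \<notin> X" using X by auto
      then show ?thesis using finX v2(2) \<open>z \<notin> I\<close> by (auto simp: D_def I_def)
    qed
    have y0: "y v0 x = 0" for x by (simp add: y_def)
    have sX: "(\<lambda>x. \<Sum>u\<in>X. y u x) \<in> ?L"
    proof (rule hom_lattice_sum)
      fix u assume "u \<in> X"
      then have "(\<lambda>x. y u x - y v0 x) \<in> ?L" using X by (auto simp: C_def)
      then show "y u \<in> ?L" by (simp add: y0)
    qed
    have v2w: "(\<lambda>x. y v2 x - y w x) \<in> ?L" using v2 by (simp add: C_def)
    from hom_lattice_plus[OF hom_lattice_plus[OF DD[OF e0 z(2)] v2w] sX]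
    have "(\<lambda>x. D e0 x - y v x - y w x - y z x) \<in> ?L" by (rule hom_lattice_cong) (simp add: De)
    with z show ?thesis by blast
  qed
  have y0: "y v0 x = 0" for x by (simp add: y_def)
  \<comment> \<open>The map taking \<open>y\<close> to the common edge sum minus \<open>y\<close> preserves the set of values, and composing it with \<open>third\<close> gives sums.\<close>
  have closed: "\<exists>z\<in>R. (\<lambda>x. y z x - (y v x + y w x)) \<in> ?L" if v: "v \<in> R" and w: "w \<in> R" for v w
  proof -
    obtain z where z: "z \<in> R" "(\<lambda>x. D e0 x - y v x - y w x - y z x) \<in> ?L" using third[OF v w] by blast
    obtain z' where z': "z' \<in> R" "(\<lambda>x. D e0 x - y z x - y v0 x - y z' x) \<in> ?L" using third[OF z(1) v0] by blast
    from hom_lattice_minus[OF z(2) z'(2)] have "(\<lambda>x. y z' x - (y v x + y w x)) \<in> ?L"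
      by (rule hom_lattice_cong) (simp add: y0)
    with z' show ?thesis by blast
  qed
  have yL: "y v \<in> ?L" if v: "v \<in> R" for v
  proof (rule ccontr)
    assume nv: "y v \<notin> ?L"
    have "\<exists>z\<in>R. (\<lambda>x. y z x - int j * y v x) \<in> ?L" for j
    proof (induction j)
      case 0
      show ?case using v0 y0 by (intro bexI[of _ v0]) (simp_all add: hom_lattice.zero)
    next
      case (Suc j)
      then obtain z where z: "z \<in> R" "(\<lambda>x. y z x - int j * y v x) \<in> ?L" by blast
      obtain z' where z': "z' \<in> R" "(\<lambda>x. y z' x - (y z x + y v x)) \<in> ?L" using closed[OF z(1) v] by blast
      from hom_lattice_plus[OF z'(2) z(2)] have "(\<lambda>x. y z' x - int (Suc j) * y v x) \<in> ?L"
        by (rule hom_lattice_cong) (simp add: algebra_simps)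
      with z' show ?case by blast
    qed
    then obtain zs where zs: "\<And>j. zs j \<in> R" "\<And>j. (\<lambda>x. y (zs j) x - int j * y v x) \<in> ?L" by metis
    have "C (zs i) \<inter> C (zs j) = {}" if ij: "i < j" "j < p" for i j
    proof (rule ccontr)
      assume "C (zs i) \<inter> C (zs j) \<noteq> {}"
      then obtain w where w: "(\<lambda>x. y w x - y (zs i) x) \<in> ?L" "(\<lambda>x. y w x - y (zs j) x) \<in> ?L" by (auto simp: C_def)
      from hom_lattice_plus[OF hom_lattice_minus[OF w] hom_lattice_minus[OF zs(2)[of i] zs(2)[of j]]]
      have 1: "(\<lambda>x. int (j - i) * y v x) \<in> ?L"
        by (rule hom_lattice_cong) (use ij in \<open>simp add: of_nat_diff algebra_simps\<close>)
      have "(\<lambda>x. int (Gcd {j - i, g'}) * y v x) \<in> ?L"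
      proof (rule hom_lattice_Gcd)
        fix d assume "d \<in> {j - i, g'}"
        then show "(\<lambda>x. int d * y v x) \<in> ?L" using 1 gy[OF v] by auto
      qed simp
      moreover have "Gcd {j - i, g'} = 1" using cop[of "j - i"] ij by (simp add: coprime_iff_gcd_eq_1)
      ultimately show False using nv by simp
    qed
    then have disj: "C (zs i) \<inter> C (zs j) = {}" if "i < p" "j < p" "i \<noteq> j" for i j
      using that by (metis Int_commute linorder_neqE_nat)
    have "(\<Sum>j<p. card (C (zs j))) = card (\<Union>j<p. C (zs j))"
      using disj finC by (intro card_UN_disjoint[symmetric]) auto
    also have "\<dots> \<le> card R" using R by (intro card_mono) (auto simp: C_def)
    finally have le: "(\<Sum>j<p. card (C (zs j))) \<le> card R" .
    have "(\<Sum>j<p. card R) < (\<Sum>j<p. p * card (C (zs j)))" using Cp[OF zs(1)] p0 by (intro sum_strict_mono) auto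
    also have "\<dots> = p * (\<Sum>j<p. card (C (zs j)))" by (simp add: sum_distrib_left)
    also have "\<dots> \<le> p * card R" using le by simp
    finally show False by simp
  qed
  have bu: "(\<lambda>x. int b * unit_at v0 x) \<in> ?L"
  proof -
    obtain a where a: "a \<in> class_sizes k K" using U0 k by (force simp: class_sizes_def)
    have "D e0 \<in> ?L" unfolding D_def[abs_def] using finH(1)[OF e0] yL by (intro hom_lattice_sum) auto
    from hom_lattice_minus[OF aD[OF a e0] hom_lattice_scale[OF this, of "int a"]] show ?thesis
      by (rule hom_lattice_cong) simp
  qed
  obtain m where m: "(\<Sum>v\<in>R. h v) = int b * m" using h(2) unfolding b_def by (auto elim: dvdE)
  have "(\<lambda>x. (\<Sum>v\<in>R. h v * y v x) + m * (int b * unit_at v0 x)) \<in> ?L"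
    using yL by (intro hom_lattice_plus hom_lattice_sum hom_lattice_scale[OF bu] hom_lattice_scale) auto
  then show ?thesis
  proof (rule hom_lattice_cong)
    fix x
    have "(\<Sum>v\<in>R. h v * y v x) + m * (int b * unit_at v0 x) = (\<Sum>v\<in>R. h v * y v x) + (\<Sum>v\<in>R. h v) * unit_at v0 x"
      by (simp add: m)
    also have "\<dots> = (\<Sum>v\<in>R. h v * unit_at v x)" by (simp add: y_def sum_distrib_right sum.distrib[symmetric] algebra_simps)
    also have "\<dots> = (\<Sum>v\<in>R. if v = x then h v else 0)" by (intro sum.cong) (auto simp: unit_at_def)
    also have "\<dots> = h x" using R h(1)[of x] by simp
    finally show "(\<Sum>v\<in>R. h v * y v x) + m * (int b * unit_at v0 x) = h x" .
  qed
qed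

section \<open>Absorbers inside a blow-up of a good sample\<close>

lemma fibre_fun_upd:
  assumes "finite (verts K)" "x0 \<in> verts K"
  shows "int (fibre K (\<kappa>(x0 := q)) v) = int (fibre K \<kappa> v) + unit_at q v - unit_at (\<kappa> x0) v"
proof -
  have split: "int (fibre K \<tau> v) = int (card {x\<in>verts K - {x0}. \<tau> x = v}) + unit_at (\<tau> x0) v" for \<tau>
  proof (cases "\<tau> x0 = v")
    case True
    then have "{x\<in>verts K. \<tau> x = v} = insert x0 {x\<in>verts K - {x0}. \<tau> x = v}" using assms by auto
    then show ?thesis unfolding fibre_def using assms True by (simp add: unit_at_def)
  next
    case False
    then have "{x\<in>verts K. \<tau> x = v} = {x\<in>verts K - {x0}. \<tau> x = v}" by auto
    then show ?thesis unfolding fibre_def using False by (simp add: unit_at_def)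
  qed
  have "{x\<in>verts K - {x0}. (\<kappa>(x0 := q)) x = v} = {x\<in>verts K - {x0}. \<kappa> x = v}" by auto
  then show ?thesis using split[of "\<kappa>(x0 := q)"] split[of \<kappa>] by simp
qed

lemma fibre_outside: "khom K R H \<kappa> \<Longrightarrow> v \<notin> R \<Longrightarrow> fibre K \<kappa> v = 0"
proof -
  assume "khom K R H \<kappa>" "v \<notin> R"
  then have "{x \<in> verts K. \<kappa> x = v} = {}" unfolding khom_def by blast
  then show ?thesis unfolding fibre_def by (simp only: card.empty)
qed

lemma khom_mono: "khom K R H \<kappa> \<Longrightarrow> R \<subseteq> R' \<Longrightarrow> H \<subseteq> H' \<Longrightarrow> khom K R' H' \<kappa>"
  unfolding khom_def by blast

lemma fibre_in_lattice: "khom K R H \<kappa> \<Longrightarrow> (\<lambda>v. int (fibre K \<kappa> v)) \<in> hom_lattice K R H"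
  using hom_lattice.add[OF hom_lattice.zero] by simp

text \<open>
  The indices below \<open>s\<close> stand for sampled vertices and the next \<open>b\<close> indices for the vertices to be
  absorbed. Neighbours are counted among sampled vertices only, because those alone may be blown up.
\<close>

definition good_type :: "nat \<Rightarrow> nat \<Rightarrow> nat \<Rightarrow> nat \<Rightarrow> nat set set \<Rightarrow> bool" where
  "good_type p k s b H \<longleftrightarrow> (\<forall>e\<in>H. e \<subseteq> {..<s+b} \<and> card e = k) \<and>
     (\<forall>I\<subseteq>{..<s+b}. card I = k - 1 \<longrightarrow> s < p * card {w\<in>{..<s}. insert w I \<in> H})"

text \<open>
  Take a set \<open>S\<close> of \<open>k - 1\<close> sampled vertices forming edges with \<open>q\<close> and with a sampled vertex \<open>w\<close>,
  collapse \<open>K\<close> onto the edge through \<open>w\<close>, and then send one vertex of the class lying over \<open>w\<close> to \<open>q\<close>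
  instead.
\<close>

lemma switchable_hom:
  assumes k: "k \<ge> 3" and U: "realisation k K U" and kg: "kgraph k K" and ne: "edges K \<noteq> {}"
    and H: "good_type p k s b H" and ks: "k \<le> s" and q: "q \<in> {s..<s+b}"
  obtains \<kappa> \<kappa>' w where "w < s" "khom K {..<s} H \<kappa>" "khom K {..<s+b} H \<kappa>'"
    "\<And>v. int (fibre K \<kappa>' v) = int (fibre K \<kappa> v) + unit_at q v - unit_at w v"
proof -
  obtain c where c: "c ` verts K \<subseteq> {1..k}" and cU: "\<And>j. j \<in> {1..k} \<Longrightarrow> {x\<in>verts K. c x = j} = U j"
    and cbij: "\<And>e. e \<in> edges K \<Longrightarrow> bij_betw c e {1..k}"
    using realisation_class_map[OF U kg] by metis
  have finK: "finite (verts K)" and eK: "\<And>e. e \<in> edges K \<Longrightarrow> e \<subseteq> verts K" using kg by (auto simp: kgraph_def)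
  have nb: "\<exists>w<s. insert w I \<in> H" if "I \<subseteq> {..<s+b}" "card I = k - 1" for I
  proof -
    have "s < p * card {w\<in>{..<s}. insert w I \<in> H}" using H that unfolding good_type_def by blast
    then have "card {w\<in>{..<s}. insert w I \<in> H} \<noteq> 0" by (metis mult_0_right not_less_zero)
    then show ?thesis by (metis (mono_tags, lifting) card.empty empty_Collect_eq lessThan_iff)
  qed
  have card_H: "card e = k" if "e \<in> H" for e using H that by (auto simp: good_type_def)
  define A where "A = {..<k - 2}"
  have A: "A \<subseteq> {..<s}" "card A = k - 2" "finite A" "q \<notin> A" using ks k q by (auto simp: A_def)
  then have "insert q A \<subseteq> {..<s+b}" "card (insert q A) = k - 1" using q k by auto
  then obtain w' where w': "w' < s" "insert w' (insert q A) \<in> H" using nb by blast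
  define S where "S = insert w' A"
  have "w' \<notin> insert q A"
  proof
    assume "w' \<in> insert q A"
    then have "insert w' (insert q A) = insert q A" by auto
    then show False using card_H[OF w'(2)] \<open>card (insert q A) = k - 1\<close> k by simp
  qed
  then have S: "S \<subseteq> {..<s}" "card S = k - 1" "finite S" "insert q S \<in> H"
    using A w' k by (auto simp: S_def insert_commute)
  have "S \<subseteq> {..<s+b}" using S by auto
  then obtain w where w: "w < s" "insert w S \<in> H" using nb S(2) by blast
  have "card ({1..k} - {1}) = card S" using S k by simp
  then obtain \<pi>0 where \<pi>0: "bij_betw \<pi>0 ({1..k} - {1}) S"
    using S finite_same_card_bij[of "{1..k} - {1}" S] by auto
  define \<pi> where "\<pi> = \<pi>0(1 := w)"
  have \<pi>S: "\<pi> ` ({1..k} - {1}) = S" using \<pi>0 by (auto simp: \<pi>_def bij_betw_def)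
  have k1: "insert 1 ({1..k} - {1}) = {1..k}" using k by auto
  have "\<pi> ` {1..k} = insert (\<pi> 1) (\<pi> ` ({1..k} - {1}))" by (metis k1 image_insert)
  then have \<pi>w: "\<pi> ` {1..k} = insert w S" unfolding \<pi>S by (simp add: \<pi>_def)
  obtain e0 where e0: "e0 \<in> edges K" using ne by auto
  then obtain x0 where x0: "x0 \<in> e0" "c x0 = 1" using cbij[OF e0] k
    by (metis atLeastAtMost_iff bij_betw_imp_surj_on imageE le_numeral_extra(4) order.trans one_le_numeral)
  have x0K: "x0 \<in> verts K" using x0 eK[OF e0] by auto
  define \<kappa> where "\<kappa> = \<pi> \<circ> c"
  define \<kappa>' where "\<kappa>' = \<kappa>(x0 := q)"
  have \<kappa>e: "\<kappa> ` e = insert w S" if "e \<in> edges K" for e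
    unfolding \<kappa>_def image_comp[symmetric] using cbij[OF that] \<pi>w by (simp add: bij_betw_def)
  have \<kappa>R: "\<kappa> ` verts K \<subseteq> {..<s}"
  proof -
    have "\<kappa> ` verts K \<subseteq> \<pi> ` {1..k}" using c by (auto simp: \<kappa>_def)
    then show ?thesis using \<pi>w w S by auto
  qed
  have \<kappa>'e: "\<kappa>' ` e \<in> H" if e: "e \<in> edges K" for e
  proof (cases "x0 \<in> e")
    case False
    then have "\<kappa>' ` e = \<kappa> ` e" by (auto simp: \<kappa>'_def)
    then show ?thesis using \<kappa>e[OF e] w by simp
  next
    case True
    have "c ` (e - {x0}) = {1..k} - {1}"
      using cbij[OF e] True x0 inj_on_image_set_diff[of c e e "{x0}"] by (auto simp: bij_betw_def)
    then have "\<kappa> ` (e - {x0}) = S" unfolding \<kappa>_def image_comp[symmetric] using \<pi>S by simp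
    moreover have "\<kappa>' ` e = insert q (\<kappa> ` (e - {x0}))" using True by (auto simp: \<kappa>'_def)
    ultimately show ?thesis using S by simp
  qed
  show thesis
  proof (rule that)
    show "khom K {..<s} H \<kappa>" using \<kappa>R \<kappa>e w by (simp add: khom_def)
    have "\<kappa>' ` verts K \<subseteq> {..<s+b}" using \<kappa>R q by (auto simp: \<kappa>'_def)
    then show "khom K {..<s+b} H \<kappa>'" using \<kappa>'e by (simp add: khom_def)
    have "\<kappa> x0 = w" using x0 by (simp add: \<kappa>_def \<pi>_def)
    then show "int (fibre K \<kappa>' v) = int (fibre K \<kappa> v) + unit_at q v - unit_at w v" for v
      unfolding \<kappa>'_def using fibre_fun_upd[OF finK x0K, of \<kappa> q v] by simp
  qed (rule w)
qed

text \<open>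
  In a blow-up where \<open>v < s\<close> is replaced by as many vertices as \<open>ns\<close> uses, the list \<open>ns\<close> is a tiling of
  the blown-up vertices, and \<open>ps\<close> is a tiling of these together with the \<open>b\<close> special vertices. The
  special vertices are first traded for sampled vertices \<open>w q\<close> by \<open>switchable_hom\<close>; the
  \<open>b\<close> vertices so obtained are then cancelled by a lattice vector. Appending the same homomorphism to both
  lists gives all larger lengths, so that one length can serve all types.
\<close>

lemma absorber_type:
  assumes k: "k \<ge> 3" and kp: "kpartite k K" and S1: "Gcd (class_sizes k K) = 1"
    and g: "gcd_hypergraph k K > 1" and p: "p = Min (prime_factors (gcd_hypergraph k K))"
    and b: "b = card (verts K)" "b > 0" and s: "p * k \<le> s" "k \<le> s" and H: "good_type p k s b H"
  shows "\<exists>N0. \<forall>N\<ge>N0. \<exists>ps ns. length ns = N \<and> (\<forall>\<kappa>\<in>set ns. khom K {..<s} H \<kappa>) \<and>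
     (\<forall>\<kappa>\<in>set ps. khom K {..<s+b} H \<kappa>) \<and>
     (\<forall>v<s. fibre_sum K ps v = fibre_sum K ns v) \<and>
     (\<forall>v\<in>{s..<s+b}. fibre_sum K ps v = 1)"
proof -
  define HR where "HR = {e\<in>H. e \<subseteq> {..<s}}"
  have kg: "kgraph k K" and ne: "edges K \<noteq> {}" using kp by (auto simp: kpartite_def)
  obtain U where U: "realisation k K U" using kp by (auto simp: kpartite_def)
  have "\<exists>w \<kappa> \<kappa>'. w < s \<and> khom K {..<s} H \<kappa> \<and> khom K {..<s+b} H \<kappa>' \<and>
    (\<forall>v. int (fibre K \<kappa>' v) = int (fibre K \<kappa> v) + unit_at q v - unit_at w v)" if "q \<in> {s..<s+b}" for q
    using switchable_hom[OF k U kg ne H s(2) that] by metis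
  then obtain w \<kappa> \<kappa>' where w: "\<And>q. q \<in> {s..<s+b} \<Longrightarrow> w q < s"
    and \<kappa>: "\<And>q. q \<in> {s..<s+b} \<Longrightarrow> khom K {..<s} H (\<kappa> q)"
    and \<kappa>': "\<And>q. q \<in> {s..<s+b} \<Longrightarrow> khom K {..<s+b} H (\<kappa>' q)"
    and fib: "\<And>q v. q \<in> {s..<s+b} \<Longrightarrow> int (fibre K (\<kappa>' q) v) = int (fibre K (\<kappa> q) v) + unit_at q v - unit_at (w q) v"
    by metis
  have toHR: "khom K {..<s} HR \<tau>" if "khom K {..<s} H \<tau>" for \<tau>
    using that kg unfolding khom_def HR_def kgraph_def by blast
  define h where "h v = (\<Sum>q\<in>{s..<s+b}. unit_at (w q) v)" for v
  have "h \<in> hom_lattice K {..<s} HR"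
  proof (rule hom_lattice_contains_all[OF k kp S1 g p])
    show "e \<subseteq> {..<s} \<and> card e = k" if "e \<in> HR" for e using that H by (auto simp: HR_def good_type_def)
    show "card {..<s} < p * card {w \<in> {..<s}. insert w I \<in> HR}" if I: "I \<subseteq> {..<s}" "card I = k - 1" for I
    proof -
      have "I \<subseteq> {..<s+b}" using I by auto
      then have "s < p * card {w\<in>{..<s}. insert w I \<in> H}" using H I(2) unfolding good_type_def by blast
      moreover have "{w\<in>{..<s}. insert w I \<in> HR} = {w\<in>{..<s}. insert w I \<in> H}" using I by (auto simp: HR_def)
      ultimately show ?thesis by simp
    qed
    show "h v = 0" if "v \<notin> {..<s}" for v
      unfolding h_def using w that by (intro sum.neutral ballI) (auto simp: unit_at_def)
    have "(\<Sum>v\<in>{..<s}. h v) = (\<Sum>q\<in>{s..<s+b}. \<Sum>v\<in>{..<s}. unit_at (w q) v)"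
      unfolding h_def by (rule sum.swap)
    also have "\<dots> = (\<Sum>q\<in>{s..<s+b}. 1)" using w by (intro sum.cong refl) (simp add: unit_at_def)
    finally show "int (card (verts K)) dvd (\<Sum>v\<in>{..<s}. h v)" by (simp add: b)
  qed (use s in auto)
  moreover have "(\<lambda>v. \<Sum>q\<in>{s..<s+b}. int (fibre K (\<kappa> q) v)) \<in> hom_lattice K {..<s} HR"
    using \<kappa> toHR by (intro hom_lattice_sum fibre_in_lattice) auto
  ultimately have "(\<lambda>v. h v - (\<Sum>q\<in>{s..<s+b}. int (fibre K (\<kappa> q) v))) \<in> hom_lattice K {..<s} HR" by (rule hom_lattice_minus)
  then obtain ps' ns' where hom: "\<forall>\<kappa>\<in>set ps' \<union> set ns'. khom K {..<s} HR \<kappa>"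
    and eq: "\<And>v. h v - (\<Sum>q\<in>{s..<s+b}. int (fibre K (\<kappa> q) v)) = int (fibre_sum K ps' v) - int (fibre_sum K ns' v)"
    using hom_lattice_lists by blast
  have hom': "khom K {..<s} H \<tau>" if "\<tau> \<in> set ps' \<union> set ns'" for \<tau>
    using hom that by (auto simp: HR_def intro: khom_mono)
  define \<tau>0 where "\<tau>0 = \<kappa> s"
  have \<tau>0: "khom K {..<s} H \<tau>0" unfolding \<tau>0_def using \<kappa>[of s] b by simp
  have out: "fibre_sum K xs v = 0" if "\<And>\<tau>. \<tau> \<in> set xs \<Longrightarrow> khom K {..<s} H \<tau>" "v \<ge> s" for xs v
  proof -
    have "fibre K \<tau> v = 0" if "\<tau> \<in> set xs" for \<tau>
      using that \<open>\<And>\<tau>. \<tau> \<in> set xs \<Longrightarrow> _\<close> \<open>v \<ge> s\<close> by (intro fibre_outside[of K "{..<s}" H]) auto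
    then show ?thesis by simp
  qed
  show ?thesis
  proof (intro exI[of _ "length ns'"] allI impI)
    fix N assume N: "length ns' \<le> N"
    define pad where "pad = replicate (N - length ns') \<tau>0"
    define qs where "qs = map \<kappa>' [s..<s+b]"
    have pad: "khom K {..<s} H \<tau>" if "\<tau> \<in> set pad" for \<tau> using that \<tau>0 by (simp add: pad_def)
    have qsum: "fibre_sum K qs v = (\<Sum>q\<in>{s..<s+b}. fibre K (\<kappa>' q) v)" for v
      unfolding qs_def by (simp add: comp_def interv_sum_list_conv_sum_set_nat)
    have qsum': "int (fibre_sum K qs v) = (\<Sum>q\<in>{s..<s+b}. int (fibre K (\<kappa> q) v)) + (\<Sum>q\<in>{s..<s+b}. unit_at q v) - h v" for v
      unfolding qsum h_def by (simp add: fib sum.distrib sum_subtractf)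
    show "\<exists>ps ns. length ns = N \<and> (\<forall>\<kappa>\<in>set ns. khom K {..<s} H \<kappa>) \<and>
     (\<forall>\<kappa>\<in>set ps. khom K {..<s+b} H \<kappa>) \<and>
     (\<forall>v<s. fibre_sum K ps v = fibre_sum K ns v) \<and>
     (\<forall>v\<in>{s..<s+b}. fibre_sum K ps v = 1)"
    proof (rule exI[of _ "qs @ ps' @ pad"], rule exI[of _ "ns' @ pad"], intro conjI ballI allI impI)
      show "length (ns' @ pad) = N" using N by (simp add: pad_def)
      show "khom K {..<s} H \<tau>" if "\<tau> \<in> set (ns' @ pad)" for \<tau> using that hom' pad by auto
      show "khom K {..<s+b} H \<tau>" if \<tau>: "\<tau> \<in> set (qs @ ps' @ pad)" for \<tau>
      proof (cases "\<tau> \<in> set qs")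
        case True
        then show ?thesis using \<kappa>' by (auto simp: qs_def)
      next
        case False
        then have "khom K {..<s} H \<tau>" using \<tau> hom' pad by auto
        then show ?thesis by (rule khom_mono) auto
      qed
      show "fibre_sum K (qs @ ps' @ pad) v = fibre_sum K (ns' @ pad) v" if "v < s" for v
      proof -
        have "(\<Sum>q\<in>{s..<s+b}. unit_at q v) = 0" using that by (intro sum.neutral) (auto simp: unit_at_def)
        then have "int (fibre_sum K qs v) + int (fibre_sum K ps' v) = int (fibre_sum K ns' v)"
          using qsum'[of v] eq[of v] by linarith
        then show ?thesis by simp
      qed
      show "fibre_sum K (qs @ ps' @ pad) v = 1" if v: "v \<in> {s..<s+b}" for v
      proof -
        have sv: "s \<le> v" using v by simp
        have "fibre_sum K ps' v = 0" "fibre_sum K ns' v = 0" "fibre_sum K pad v = 0"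
          using hom' pad by (auto simp only: Un_iff intro: out[OF _ sv])
        moreover have "(\<Sum>q\<in>{s..<s+b}. unit_at q v) = 1" using v by (simp add: unit_at_def)
        ultimately have "int (fibre_sum K qs v) = 1" using qsum'[of v] eq[of v] by linarith
        with \<open>fibre_sum K ps' v = 0\<close> \<open>fibre_sum K pad v = 0\<close>
        show ?thesis by (simp only: map_append sum_list_append)
      qed
    qed
  qed
qed

section \<open>Random samples inherit large codegrees\<close>

text \<open>
  A lower-tail Chernoff bound in counting form, by the exponential moment with parameter \<open>t = \<epsilon>/2\<close>.
\<close>

lemma chernoff_count:
  fixes V :: "'v set" and \<theta> \<epsilon> m :: real
  assumes fin: "finite B" "finite V" and N: "N \<subseteq> V" "\<theta> * real (card V) \<le> real (card N)"
    and \<epsilon>: "0 < \<epsilon>" "\<epsilon> \<le> 2" and \<theta>: "0 \<le> \<theta>" "\<theta> \<le> 1" and m: "m \<le> (\<theta> - \<epsilon>) * real (card B)"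
  shows "real (card {w \<in> B \<rightarrow>\<^sub>E V. real (card {j\<in>B. w j \<in> N}) \<le> m})
     \<le> real (card V) ^ card B * exp (- (\<epsilon>\<^sup>2 / 4) * real (card B))"
proof -
  define t where "t = \<epsilon> / 2"
  have t: "0 < t" "t \<le> 1" using \<epsilon> by (auto simp: t_def)
  define \<phi> where "\<phi> v = (if v \<in> N then exp (- t) else 1)" for v
  let ?X = "{w \<in> B \<rightarrow>\<^sub>E V. real (card {j\<in>B. w j \<in> N}) \<le> m}"
  have finP: "finite (B \<rightarrow>\<^sub>E V)" using fin by (simp add: finite_PiE)
  have prod: "(\<Prod>j\<in>B. \<phi> (w j)) = exp (- t * real (card {j\<in>B. w j \<in> N}))" for w
  proof -
    have "(\<Prod>j\<in>B. \<phi> (w j)) = (\<Prod>j\<in>{j\<in>B. w j \<in> N}. exp (- t))"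
      unfolding \<phi>_def using fin(1) by (rule prod.inter_filter[symmetric])
    also have "\<dots> = exp (- t * real (card {j\<in>B. w j \<in> N}))" by (simp add: exp_of_nat_mult[symmetric])
    finally show ?thesis .
  qed
  have "real (card ?X) * exp (- t * m) = (\<Sum>w\<in>?X. exp (- t * m))" by simp
  also have "\<dots> \<le> (\<Sum>w\<in>?X. \<Prod>j\<in>B. \<phi> (w j))"
    unfolding prod using t by (intro sum_mono) auto
  also have "\<dots> \<le> (\<Sum>w\<in>B \<rightarrow>\<^sub>E V. \<Prod>j\<in>B. \<phi> (w j))"
    using finP by (intro sum_mono2) (auto intro!: prod_nonneg simp: \<phi>_def)
  also have "\<dots> = (\<Prod>j\<in>B. \<Sum>v\<in>V. \<phi> v)" using fin by (intro prod_sum_PiE[symmetric]) auto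
  also have "\<dots> = (\<Sum>v\<in>V. \<phi> v) ^ card B" by simp
  also have "\<dots> \<le> (real (card V) * exp (- \<theta> * (t - t\<^sup>2))) ^ card B"
  proof (rule power_mono)
    have "(\<Sum>v\<in>V. \<phi> v) = (\<Sum>v\<in>V. 1 - (1 - exp (-t)) * (if v \<in> N then 1 else 0))"
      by (intro sum.cong) (auto simp: \<phi>_def)
    also have "\<dots> = real (card V) - (1 - exp (-t)) * real (card N)"
      using fin N by (simp add: sum_subtractf sum_distrib_left[symmetric] sum.inter_restrict[symmetric] Int_absorb1)
    also have "\<dots> \<le> real (card V) - (1 - exp (-t)) * (\<theta> * real (card V))"
      using N t by (intro diff_left_mono mult_left_mono) auto
    also have "\<dots> = real (card V) * (1 - \<theta> * (1 - exp (-t)))" by (simp add: algebra_simps)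
    also have "\<dots> \<le> real (card V) * exp (- \<theta> * (t - t\<^sup>2))"
    proof (rule mult_left_mono)
      show "1 - \<theta> * (1 - exp (-t)) \<le> exp (- \<theta> * (t - t\<^sup>2))"
      proof -
        have "exp (- t) \<le> 1 - t + t\<^sup>2" using exp_le_quadratic[of "-t"] t by simp
        then have "\<theta> * (t - t\<^sup>2) \<le> \<theta> * (1 - exp (-t))" using \<theta> by (intro mult_left_mono) auto
        then show ?thesis using exp_ge_add_one_self[of "- \<theta> * (t - t\<^sup>2)"] by (simp add: algebra_simps)
      qed
    qed simp
    finally show "(\<Sum>v\<in>V. \<phi> v) \<le> real (card V) * exp (- \<theta> * (t - t\<^sup>2))" .
  qed (auto intro!: sum_nonneg simp: \<phi>_def)
  also have "\<dots> = real (card V) ^ card B * exp (- \<theta> * (t - t\<^sup>2) * real (card B))"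
    by (simp add: power_mult_distrib exp_of_nat_mult[symmetric] mult.commute)
  finally have 1: "real (card ?X) * exp (- t * m) \<le> real (card V) ^ card B * exp (- \<theta> * (t - t\<^sup>2) * real (card B))" .
  have "real (card ?X) = real (card ?X) * exp (- t * m) * exp (t * m)" by (simp add: exp_minus)
  also have "\<dots> \<le> real (card V) ^ card B * exp (- \<theta> * (t - t\<^sup>2) * real (card B)) * exp (t * m)"
    using 1 by (rule mult_right_mono) simp
  also have "\<dots> = real (card V) ^ card B * exp (- \<theta> * (t - t\<^sup>2) * real (card B) + t * m)" by (simp only: exp_add mult.assoc)
  also have "\<dots> \<le> real (card V) ^ card B * exp (- (\<epsilon>\<^sup>2 / 4) * real (card B))"
  proof (intro mult_left_mono)
    have e: "\<epsilon> = 2 * t" "\<epsilon>\<^sup>2 / 4 = t\<^sup>2" by (auto simp: t_def power2_eq_square)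
    have "t * m \<le> t * ((\<theta> - 2 * t) * real (card B))" using m t unfolding e(1) by (intro mult_left_mono) auto
    moreover have "\<theta> * t\<^sup>2 * real (card B) \<le> 1 * t\<^sup>2 * real (card B)" using \<theta> by (intro mult_right_mono) auto
    ultimately have "- \<theta> * (t - t\<^sup>2) * real (card B) + t * m \<le> - (\<epsilon>\<^sup>2 / 4) * real (card B)"
      unfolding e(2) by (simp add: algebra_simps power2_eq_square)
    then show "exp (- \<theta> * (t - t\<^sup>2) * real (card B) + t * m) \<le> exp (- (\<epsilon>\<^sup>2 / 4) * real (card B))" by simp
  qed simp
  finally show ?thesis .
qed

lemma card_PiE_fibre_bound:
  fixes V :: "'v set" and \<beta> :: real
  assumes fin: "finite A" "finite B" "finite V" and AB: "A \<inter> B = {}"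
    and bound: "\<And>u. u \<in> A \<rightarrow>\<^sub>E V \<Longrightarrow>
      real (card {w \<in> B \<rightarrow>\<^sub>E V. P (\<lambda>i. if i \<in> A then u i else w i)}) \<le> \<beta>"
  shows "real (card {z \<in> (A \<union> B) \<rightarrow>\<^sub>E V. P z}) \<le> real (card V) ^ card A * \<beta>"
proof -
  let ?G = "\<lambda>u. {w \<in> B \<rightarrow>\<^sub>E V. P (\<lambda>i. if i \<in> A then u i else w i)}"
  have finPA: "finite (A \<rightarrow>\<^sub>E V)" and finPB: "finite (B \<rightarrow>\<^sub>E V)" using fin by (auto simp: finite_PiE)
  have "real (card {z \<in> (A \<union> B) \<rightarrow>\<^sub>E V. P z}) \<le> real (card (SIGMA u:A \<rightarrow>\<^sub>E V. ?G u))"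
  proof (rule card_real_le_inj[where h="\<lambda>z. (restrict z A, restrict z B)"])
    show "inj_on (\<lambda>z. (restrict z A, restrict z B)) {z \<in> (A \<union> B) \<rightarrow>\<^sub>E V. P z}"
    proof (rule inj_onI)
      fix z z' assume z: "z \<in> {z \<in> (A \<union> B) \<rightarrow>\<^sub>E V. P z}" and z': "z' \<in> {z \<in> (A \<union> B) \<rightarrow>\<^sub>E V. P z}"
        and eq: "(restrict z A, restrict z B) = (restrict z' A, restrict z' B)"
      have "z i = z' i" if "i \<in> A \<union> B" for i
        using eq that by (metis Pair_inject Un_iff restrict_apply')
      then show "z = z'" using z z' by (intro PiE_ext[of z "A \<union> B" "\<lambda>_. V" z']) auto
    qed
    show "(\<lambda>z. (restrict z A, restrict z B)) ` {z \<in> (A \<union> B) \<rightarrow>\<^sub>E V. P z} \<subseteq> (SIGMA u:A \<rightarrow>\<^sub>E V. ?G u)"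
    proof (rule image_subsetI)
      fix z assume z: "z \<in> {z \<in> (A \<union> B) \<rightarrow>\<^sub>E V. P z}"
      have "(\<lambda>i. if i \<in> A then restrict z A i else restrict z B i) = z"
        using z by (auto simp: fun_eq_iff PiE_iff extensional_def)
      then show "(restrict z A, restrict z B) \<in> (SIGMA u:A \<rightarrow>\<^sub>E V. ?G u)" using z by auto
    qed
    show "finite (SIGMA u:A \<rightarrow>\<^sub>E V. ?G u)" using finPA finPB by auto
  qed
  also have "\<dots> = (\<Sum>u\<in>A \<rightarrow>\<^sub>E V. real (card (?G u)))" using finPA finPB by (subst card_SigmaI) auto
  also have "\<dots> \<le> (\<Sum>u\<in>A \<rightarrow>\<^sub>E V. \<beta>)" using bound by (intro sum_mono)
  also have "\<dots> = real (card V) ^ card A * \<beta>" using fin by (simp add: card_PiE)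
  finally show ?thesis .
qed

definition extend_by :: "nat \<Rightarrow> (nat \<Rightarrow> 'b) \<Rightarrow> (nat \<Rightarrow> 'b) \<Rightarrow> nat \<Rightarrow> 'b" where
  "extend_by s q z i = (if i < s then z i else q i)"

text \<open>
  The edge set induced on the indices by a sample \<open>z\<close> together with the special vertices \<open>q\<close>.
\<close>

definition type_of :: "'b set set \<Rightarrow> nat \<Rightarrow> nat \<Rightarrow> nat \<Rightarrow> (nat \<Rightarrow> 'b) \<Rightarrow> (nat \<Rightarrow> 'b) \<Rightarrow> nat set set" where
  "type_of E k s b q z = {e. e \<subseteq> {..<s+b} \<and> card e = k \<and> extend_by s q z ` e \<in> E}"

lemma bad_type_cases:
  assumes k: "k \<ge> 1" and bad: "\<not> good_type p k s b (type_of E k s b q z)"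
  shows "\<exists>I\<subseteq>{..<s+b}. card I = k - 1 \<and>
     real p * real (card {w\<in>{..<s}-I. insert (z w) (extend_by s q z ` I) \<in> E}) \<le> real s"
proof -
  let ?H = "type_of E k s b q z"
  obtain I where I: "I \<subseteq> {..<s+b}" "card I = k - 1" "\<not> s < p * card {w\<in>{..<s}. insert w I \<in> ?H}"
    using bad unfolding good_type_def type_of_def by blast
  have finI: "finite I" using I by (auto intro: finite_subset)
  have "{w\<in>{..<s}-I. insert (z w) (extend_by s q z ` I) \<in> E} \<subseteq> {w\<in>{..<s}. insert w I \<in> ?H}"
    using I finI k by (auto simp: type_of_def extend_by_def)
  then have "card {w\<in>{..<s}-I. insert (z w) (extend_by s q z ` I) \<in> E} \<le> card {w\<in>{..<s}. insert w I \<in> ?H}"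
    by (intro card_mono) auto
  then have "p * card {w\<in>{..<s}-I. insert (z w) (extend_by s q z ` I) \<in> E} \<le> s" using I(3)
    by (meson le_trans mult_le_mono2 not_le)
  then have "real (p * card {w\<in>{..<s}-I. insert (z w) (extend_by s q z ` I) \<in> E}) \<le> real s" by (simp only: of_nat_le_iff)
  then show ?thesis using I by auto
qed

text \<open>
  The sample size is taken large enough that leaving out the at most \<open>k\<close> indices of a fixed set costs less
  than half of the slack \<open>\<alpha>\<close>, and that the Chernoff bound beats the number of index sets.
\<close>

lemma sampling_constants:
  fixes \<alpha> :: real and p k b s0 :: nat
  assumes \<alpha>: "\<alpha> > 0" and p: "p \<ge> 1" and k: "k \<ge> 1"
  obtains s where "s \<ge> s0" "s \<ge> k" "s \<ge> 1"
    "\<And>B. B + k \<ge> s \<Longrightarrow> real s / real p \<le> (1 / real p + \<alpha> / 2) * real B"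
    "4 * real (s + b) ^ (k - 1) * exp (- ((\<alpha>/2)\<^sup>2 / 4) * (real s - real k)) \<le> 1"
proof -
  define c where "c = (\<alpha>/2)\<^sup>2 / 4"
  have c: "c > 0" using \<alpha> by (simp add: c_def)
  obtain n1 where n1: "\<And>n. n \<ge> n1 \<Longrightarrow> real (k - 1) * ln (real n) \<le> (c/2) * real n"
    using eventually_ln_le_linear[of "c/2" "real (k-1)"] c by auto
  define s where "s = Max {s0, k, 1, n1, nat \<lceil>(ln 4 + c * (real b + real k)) / (c/2)\<rceil>, nat \<lceil>real k * (1 / real p + \<alpha>/2) / (\<alpha>/2)\<rceil>}"
  have "s0 \<le> s" "k \<le> s" "1 \<le> s" "n1 \<le> s" "nat \<lceil>(ln 4 + c * (real b + real k)) / (c/2)\<rceil> \<le> s"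
    "nat \<lceil>real k * (1 / real p + \<alpha>/2) / (\<alpha>/2)\<rceil> \<le> s"
    unfolding s_def by (intro Max_ge finite.intros; blast)+
  then have s: "s0 \<le> s" "k \<le> s" "1 \<le> s" "n1 \<le> s" "(ln 4 + c * (real b + real k)) / (c/2) \<le> real s"
    "real k * (1 / real p + \<alpha>/2) / (\<alpha>/2) \<le> real s" by (simp_all only: nat_ceiling_le_eq)
  show thesis
  proof (rule that[of s])
    show "real s / real p \<le> (1 / real p + \<alpha> / 2) * real B" if B: "B + k \<ge> s" for B
    proof -
      have "real k * (1 / real p + \<alpha>/2) \<le> real s * (\<alpha>/2)" using s(6) \<alpha> by (simp only: pos_divide_le_eq half_gt_zero)
      then have "real s / real p \<le> (1 / real p + \<alpha>/2) * (real s - real k)" by (simp add: algebra_simps)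
      also have "\<dots> \<le> (1 / real p + \<alpha>/2) * real B" using B \<alpha> by (intro mult_left_mono) auto
      finally show ?thesis .
    qed
    have "4 * real (s + b) ^ (k - 1) = exp (ln 4) * exp (real (k-1) * ln (real (s + b)))"
      using s by (simp add: exp_of_nat_mult)
    also have "\<dots> = exp (ln 4 + real (k-1) * ln (real (s + b)))" by (simp only: exp_add)
    also have "\<dots> \<le> exp (ln 4 + (c/2) * real (s + b))" using n1[of "s+b"] s by simp
    also have "\<dots> \<le> exp (c * (real s - real k))"
    proof -
      define cs cb ck where "cs = c * real s" and "cb = c * real b" and "ck = c * real k"
      have "ln 4 + c * (real b + real k) \<le> real s * (c/2)" using s(5) c by (simp only: pos_divide_le_eq half_gt_zero)
      moreover have "c * (real b + real k) = cb + ck" "real s * (c/2) = cs / 2"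
        by (simp_all add: cs_def cb_def ck_def distrib_left)
      ultimately have "ln 4 + cb + ck \<le> cs / 2" by simp
      moreover have "cb \<ge> 0" using c by (simp add: cb_def)
      ultimately have "ln 4 + (cs / 2 + cb / 2) \<le> cs - ck" by linarith
      moreover have "(c/2) * real (s + b) = cs / 2 + cb / 2" by (simp add: cs_def cb_def field_simps)
      moreover have "c * (real s - real k) = cs - ck" unfolding cs_def ck_def by (rule right_diff_distrib)
      ultimately show ?thesis by (simp only: exp_le_cancel_iff)
    qed
    finally have "4 * real (s + b) ^ (k - 1) * exp (- c * (real s - real k)) \<le> exp (c * (real s - real k)) * exp (- c * (real s - real k))"
      by (intro mult_right_mono) auto
    also have "\<dots> = 1" by (simp add: exp_minus)
    finally show "4 * real (s + b) ^ (k - 1) * exp (- ((\<alpha>/2)\<^sup>2 / 4) * (real s - real k)) \<le> 1" by (simp add: c_def)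
  qed (use s in auto)
qed

text \<open>
  For fixed values on \<open>I\<close>, the number of the remaining sampled vertices that are neighbours is a sum of
  independent indicators with mean well above \<open>s/p\<close>. Index sets on which the sample is not injective are
  left out, as the codegree condition says nothing about them.
\<close>

lemma bad_index_set_count:
  fixes E :: "'b set set" and V :: "'b set" and \<alpha> :: real
  assumes k: "k \<ge> 1" and p: "p \<ge> 1" and V: "finite V" "V \<noteq> {}" and \<alpha>: "\<alpha> > 0"
    and deg: "\<And>S. S \<subseteq> V \<Longrightarrow> card S = k - 1 \<Longrightarrow> (1 / real p + \<alpha>) * real (card V) \<le> real (card {v\<in>V. insert v S \<in> E})"
    and q: "q ` {s..<s+b} \<subseteq> V"
    and s: "\<And>B. B + k \<ge> s \<Longrightarrow> real s / real p \<le> (1 / real p + \<alpha> / 2) * real B"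
    and I: "I \<subseteq> {..<s+b}" "card I = k - 1"
  shows "real (card {z \<in> {..<s} \<rightarrow>\<^sub>E V. inj_on (extend_by s q z) I \<and>
      real p * real (card {w\<in>{..<s}-I. insert (z w) (extend_by s q z ` I) \<in> E}) \<le> real s})
     \<le> real (card V) ^ s * exp (- ((\<alpha>/2)\<^sup>2 / 4) * (real s - real k))"
proof -
  define A where "A = {..<s} \<inter> I"
  define B where "B = {..<s} - I"
  have AB: "A \<union> B = {..<s}" "A \<inter> B = {}" "finite A" "finite B" by (auto simp: A_def B_def)
  have cAB: "card A + card B = s" using AB card_Un_disjoint[of A B] by simp
  have finI: "finite I" using I by (auto intro: finite_subset)
  have "card A \<le> k - 1" using I finI card_mono[of I A] by (auto simp: A_def)
  then have cB: "card B + k \<ge> s" using cAB k by linarith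
  let ?\<beta> = "real (card V) ^ card B * exp (- ((\<alpha>/2)\<^sup>2 / 4) * real (card B))"
  have "real (card {z \<in> (A \<union> B) \<rightarrow>\<^sub>E V. inj_on (extend_by s q z) I \<and>
      real p * real (card {w\<in>B. insert (z w) (extend_by s q z ` I) \<in> E}) \<le> real s}) \<le> real (card V) ^ card A * ?\<beta>"
  proof (rule card_PiE_fibre_bound[OF AB(3,4) V(1) AB(2)])
    fix u assume u: "u \<in> A \<rightarrow>\<^sub>E V"
    let ?z = "\<lambda>w i. if i \<in> A then u i else w i"
    define x where "x i = (if i < s then u i else q i)" for i
    have x: "extend_by s q (?z w) i = x i" if "i \<in> I" for w i using that by (auto simp: extend_by_def x_def A_def)
    have xI: "extend_by s q (?z w) ` I = x ` I" "inj_on (extend_by s q (?z w)) I = inj_on x I" for w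
      using x by (auto simp: inj_on_def image_iff)
    define N where "N = {v\<in>V. insert v (x ` I) \<in> E}"
    show "real (card {w \<in> B \<rightarrow>\<^sub>E V. inj_on (extend_by s q (?z w)) I \<and>
        real p * real (card {j\<in>B. insert (?z w j) (extend_by s q (?z w) ` I) \<in> E}) \<le> real s}) \<le> ?\<beta>"
    proof (cases "inj_on x I")
      case False
      then show ?thesis by (simp add: xI)
    next
      case True
      have xV: "x ` I \<subseteq> V"
      proof
        fix v assume "v \<in> x ` I"
        then obtain i where i: "i \<in> I" "v = x i" by auto
        show "v \<in> V"
        proof (cases "i < s")
          case True
          then have "i \<in> A" using i by (simp add: A_def)
          then show ?thesis using u i True by (auto simp: x_def)
        next
          case False
          then have "i \<in> {s..<s+b}" using i I by auto
          then show ?thesis using q i False by (auto simp: x_def)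
        qed
      qed
      have "card (x ` I) = k - 1" using True I by (simp add: card_image)
      from deg[OF xV this] have N: "(1 / real p + \<alpha>) * real (card V) \<le> real (card N)" unfolding N_def .
      also have "\<dots> \<le> real (card V)" unfolding N_def using V by (auto intro: card_mono)
      finally have \<theta>: "1 / real p + \<alpha> \<le> 1" using V by (simp add: card_gt_0_iff)
      have \<theta>0: "0 \<le> 1 / real p" by simp
      have "real (card {w \<in> B \<rightarrow>\<^sub>E V. inj_on (extend_by s q (?z w)) I \<and>
        real p * real (card {j\<in>B. insert (?z w j) (extend_by s q (?z w) ` I) \<in> E}) \<le> real s})
        \<le> real (card {w \<in> B \<rightarrow>\<^sub>E V. real (card {j\<in>B. w j \<in> N}) \<le> real s / real p})"
      proof (rule card_real_le_inj[where h="\<lambda>w. w"])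
        show "(\<lambda>w. w) ` {w \<in> B \<rightarrow>\<^sub>E V. inj_on (extend_by s q (?z w)) I \<and>
          real p * real (card {j\<in>B. insert (?z w j) (extend_by s q (?z w) ` I) \<in> E}) \<le> real s}
          \<subseteq> {w \<in> B \<rightarrow>\<^sub>E V. real (card {j\<in>B. w j \<in> N}) \<le> real s / real p}"
        proof (rule image_subsetI)
          fix w assume w: "w \<in> {w \<in> B \<rightarrow>\<^sub>E V. inj_on (extend_by s q (?z w)) I \<and>
            real p * real (card {j\<in>B. insert (?z w j) (extend_by s q (?z w) ` I) \<in> E}) \<le> real s}"
          then have wB: "w \<in> B \<rightarrow>\<^sub>E V" by blast
          have "{j\<in>B. insert (?z w j) (extend_by s q (?z w) ` I) \<in> E} = {j\<in>B. w j \<in> N}"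
            unfolding xI N_def using wB AB(2) by auto
          then have "real p * real (card {j\<in>B. w j \<in> N}) \<le> real s" using w by simp
          then have "real (card {j\<in>B. w j \<in> N}) \<le> real s / real p" using p by (simp add: field_simps)
          then show "w \<in> {w \<in> B \<rightarrow>\<^sub>E V. real (card {j\<in>B. w j \<in> N}) \<le> real s / real p}" using wB by simp
        qed
        show "finite {w \<in> B \<rightarrow>\<^sub>E V. real (card {j\<in>B. w j \<in> N}) \<le> real s / real p}"
          using AB V by (auto intro!: finite_subset[OF _ finite_PiE[of B "\<lambda>_. V"]])
      qed simp
      also have "\<dots> \<le> ?\<beta>"
      proof (rule chernoff_count[OF AB(4) V(1), where \<theta>="1 / real p + \<alpha>"])
        show "N \<subseteq> V" by (auto simp: N_def)
        have "real s / real p \<le> (1 / real p + \<alpha> / 2) * real (card B)" using s[OF cB] .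
        then show "real s / real p \<le> (1 / real p + \<alpha> - \<alpha> / 2) * real (card B)" by (simp add: algebra_simps)
        show "\<alpha> / 2 \<le> 2" using \<theta> \<theta>0 by linarith
        show "0 \<le> 1 / real p + \<alpha>" using \<alpha> \<theta>0 by linarith
      qed (use N \<theta> \<alpha> in auto)
      finally show ?thesis .
    qed
  qed
  also have "real (card V) ^ card A * ?\<beta> = real (card V) ^ s * exp (- ((\<alpha>/2)\<^sup>2 / 4) * real (card B))"
    unfolding cAB[symmetric] by (simp add: power_add)
  also have "\<dots> \<le> real (card V) ^ s * exp (- ((\<alpha>/2)\<^sup>2 / 4) * (real s - real k))"
  proof (rule mult_left_mono)
    have "real s - real k \<le> real (card B)" using cB by linarith
    then have "((\<alpha>/2)\<^sup>2 / 4) * (real s - real k) \<le> ((\<alpha>/2)\<^sup>2 / 4) * real (card B)" by (intro mult_left_mono) auto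
    then show "exp (- ((\<alpha>/2)\<^sup>2 / 4) * real (card B)) \<le> exp (- ((\<alpha>/2)\<^sup>2 / 4) * (real s - real k))" by simp
  qed simp
  finally show ?thesis unfolding AB(1) unfolding B_def .
qed

text \<open>
  A union bound over the index sets \<open>I\<close>, after discarding the samples that are not injective or meet the
  special vertices.
\<close>

lemma most_samples_good:
  fixes \<alpha> :: real
  assumes \<alpha>: "\<alpha> > 0" and p: "p \<ge> 1" and k: "k \<ge> 1"
  shows "\<exists>s\<ge>s0. s \<ge> k \<and> (\<exists>n0. \<forall>(E :: 'b set set) V q. finite V \<and> card V \<ge> n0 \<and>
      codegrees_ge k E V (1 / real p + \<alpha>) \<and>
      inj_on q {s..<s+b} \<and> q ` {s..<s+b} \<subseteq> V \<longrightarrow>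
      real (card V) ^ s \<le> 2 * real (card {z \<in> {..<s} \<rightarrow>\<^sub>E V. good_type p k s b (type_of E k s b q z)}))"
proof -
  obtain s where s: "s \<ge> s0" "s \<ge> k" "s \<ge> 1"
    and sB: "\<And>B. B + k \<ge> s \<Longrightarrow> real s / real p \<le> (1 / real p + \<alpha> / 2) * real B"
    and sexp: "4 * real (s + b) ^ (k - 1) * exp (- ((\<alpha>/2)\<^sup>2 / 4) * (real s - real k)) \<le> 1"
    using sampling_constants[OF \<alpha> p k] by metis
  show ?thesis
  proof (rule exI[of _ s], intro conjI s(1,2), rule exI[of _ "4 * (s^2 + s * b) + 1"], intro allI impI, elim conjE)
    fix E :: "'b set set" and V :: "'b set" and q :: "nat \<Rightarrow> 'b"
    assume V: "finite V" and nV: "4 * (s\<^sup>2 + s * b) + 1 \<le> card V"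
      and deg: "codegrees_ge k E V (1 / real p + \<alpha>)"
      and q: "inj_on q {s..<s+b}" "q ` {s..<s+b} \<subseteq> V"
    define n where "n = real (card V)"
    have V0: "V \<noteq> {}" using nV by auto
    let ?P = "{..<s} \<rightarrow>\<^sub>E V"
    let ?Q = "q ` {s..<s+b}"
    define Is where "Is = {I. I \<subseteq> {..<s+b} \<and> card I = k - 1}"
    define X where "X I = {z \<in> ?P. inj_on (extend_by s q z) I \<and>
      real p * real (card {w\<in>{..<s}-I. insert (z w) (extend_by s q z ` I) \<in> E}) \<le> real s}" for I
    let ?G = "{z \<in> ?P. good_type p k s b (type_of E k s b q z)}"
    have finP: "finite ?P" using V by (simp add: finite_PiE)
    have finIs: "finite Is" by (simp add: Is_def)
    have cover: "?P \<subseteq> ?G \<union> {z\<in>?P. \<not> inj_on z {..<s}} \<union> {z\<in>?P. z ` {..<s} \<inter> ?Q \<noteq> {}} \<union> (\<Union>I\<in>Is. X I)"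
    proof
      fix z assume z: "z \<in> ?P"
      show "z \<in> ?G \<union> {z\<in>?P. \<not> inj_on z {..<s}} \<union> {z\<in>?P. z ` {..<s} \<inter> ?Q \<noteq> {}} \<union> (\<Union>I\<in>Is. X I)"
      proof (cases "good_type p k s b (type_of E k s b q z) \<or> \<not> inj_on z {..<s} \<or> z ` {..<s} \<inter> ?Q \<noteq> {}")
        case True
        then show ?thesis using z by blast
      next
        case False
        then have inj: "inj_on z {..<s}" "z ` {..<s} \<inter> ?Q = {}" and bad: "\<not> good_type p k s b (type_of E k s b q z)" by auto
        have "inj_on (extend_by s q z) ({..<s} \<union> {s..<s+b})"
          unfolding inj_on_Un
        proof (intro conjI)
          show "inj_on (extend_by s q z) {..<s}" using inj(1) by (auto simp: inj_on_def extend_by_def)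
          show "inj_on (extend_by s q z) {s..<s+b}" using q(1) by (auto simp: inj_on_def extend_by_def)
          show "extend_by s q z ` ({..<s} - {s..<s+b}) \<inter> extend_by s q z ` ({s..<s+b} - {..<s}) = {}"
            using inj(2) by (auto simp: extend_by_def)
        qed
        moreover have "{..<s} \<union> {s..<s+b} = {..<s+b}" by auto
        ultimately have injx: "inj_on (extend_by s q z) {..<s+b}" by simp
        obtain I where I: "I \<subseteq> {..<s+b}" "card I = k - 1"
          "real p * real (card {w\<in>{..<s}-I. insert (z w) (extend_by s q z ` I) \<in> E}) \<le> real s"
          using bad_type_cases[OF k bad] by blast
        then have "z \<in> X I" "I \<in> Is" using z injx unfolding X_def Is_def by (auto intro: inj_on_subset)
        then show ?thesis by blast
      qed
    qed
    have "card ?P \<le> card (?G \<union> {z\<in>?P. \<not> inj_on z {..<s}} \<union> {z\<in>?P. z ` {..<s} \<inter> ?Q \<noteq> {}} \<union> (\<Union>I\<in>Is. X I))"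
      using finP finIs by (intro card_mono[OF _ cover]) (auto simp: X_def)
    also have "\<dots> \<le> card ?G + card {z\<in>?P. \<not> inj_on z {..<s}} + card {z\<in>?P. z ` {..<s} \<inter> ?Q \<noteq> {}} + card (\<Union>I\<in>Is. X I)"
      by (meson add_mono card_Un_le le_trans order_refl)
    finally have "real (card ?P) \<le> real (card ?G) + real (card {z\<in>?P. \<not> inj_on z {..<s}}) +
       real (card {z\<in>?P. z ` {..<s} \<inter> ?Q \<noteq> {}}) + real (card (\<Union>I\<in>Is. X I))" by linarith
    moreover have "real (card ?P) = n ^ s" by (simp add: card_PiE n_def)
    moreover have "real (card {z\<in>?P. \<not> inj_on z {..<s}}) + real (card {z\<in>?P. z ` {..<s} \<inter> ?Q \<noteq> {}}) \<le> n ^ s / 4"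
    proof -
      have cQ: "card ?Q = b" using q by (simp add: card_image)
      have "card {z\<in>?P. \<not> inj_on z {..<s}} + card {z\<in>?P. z ` {..<s} \<inter> ?Q \<noteq> {}}
         \<le> s\<^sup>2 * card V ^ (s - 1) + s * b * card V ^ (s - 1)"
        using card_PiE_not_inj[of "{..<s}" V] card_PiE_meets[of "{..<s}" V ?Q] V q cQ by (intro add_mono) auto
      also have "\<dots> = (s\<^sup>2 + s * b) * card V ^ (s - 1)" by (simp add: algebra_simps)
      finally have "4 * (card {z\<in>?P. \<not> inj_on z {..<s}} + card {z\<in>?P. z ` {..<s} \<inter> ?Q \<noteq> {}})
         \<le> (4 * (s\<^sup>2 + s * b)) * card V ^ (s - 1)" unfolding mult.assoc by (rule mult_le_mono2)
      also have "\<dots> \<le> card V * card V ^ (s - 1)" using nV by (intro mult_right_mono) auto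
      also have "\<dots> = card V ^ s" using s(3) by (metis Suc_diff_1 le_eq_less_or_eq less_le_trans power_Suc zero_less_one)
      finally have "real (4 * (card {z\<in>?P. \<not> inj_on z {..<s}} + card {z\<in>?P. z ` {..<s} \<inter> ?Q \<noteq> {}})) \<le> real (card V ^ s)"
        by (simp only: of_nat_le_iff)
      then show ?thesis by (simp add: n_def)
    qed
    moreover have "real (card (\<Union>I\<in>Is. X I)) \<le> n ^ s / 4"
    proof -
      let ?\<gamma> = "exp (- ((\<alpha>/2)\<^sup>2 / 4) * (real s - real k))"
      have "real (card (\<Union>I\<in>Is. X I)) \<le> (\<Sum>I\<in>Is. real (card (X I)))"
        using card_UN_le[OF finIs, of X] by (metis of_nat_le_iff of_nat_sum)
      also have "\<dots> \<le> (\<Sum>I\<in>Is. n ^ s * ?\<gamma>)"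
      proof (rule sum_mono)
        fix I assume "I \<in> Is"
        then show "real (card (X I)) \<le> n ^ s * ?\<gamma>" unfolding X_def n_def Is_def
          using bad_index_set_count[OF k p V V0 \<alpha> _ q(2) sB, of E I] deg by auto
      qed
      also have "\<dots> = real (card Is) * (n ^ s * ?\<gamma>)" by simp
      also have "\<dots> \<le> real (s + b) ^ (k - 1) * (n ^ s * ?\<gamma>)"
      proof (rule mult_right_mono)
        have "card Is \<le> (s + b) ^ (k - 1)" using card_subsets_le_power[of "{..<s+b}" "k-1"] by (simp add: Is_def)
        then show "real (card Is) \<le> real (s + b) ^ (k - 1)" by (metis of_nat_le_iff of_nat_power)
      qed (simp add: n_def)
      also have "\<dots> = n ^ s / 4 * (4 * real (s + b) ^ (k - 1) * ?\<gamma>)" by simp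
      also have "\<dots> \<le> n ^ s / 4 * 1" using sexp by (intro mult_left_mono) (auto simp: n_def)
      finally show ?thesis by simp
    qed
    ultimately show "real (card V) ^ s \<le> 2 * real (card ?G)" unfolding n_def by linarith
  qed
qed

section \<open>Many absorbers\<close>

text \<open>
  This serves to rearrange the vertices of a blow-up into the copies listed in \<open>ps\<close>; the fibres of \<open>c\<close> are
  then the parts of the blow-up.
\<close>

lemma bij_with_equal_fibres:
  assumes fin: "finite P" "finite J" and R: "cp ` P \<subseteq> R" "c ` J \<subseteq> R"
    and eq: "\<And>v. v \<in> R \<Longrightarrow> card {a\<in>P. cp a = v} = card {j\<in>J. c j = v}"
  obtains \<Psi> where "bij_betw \<Psi> P J" "\<And>a. a \<in> P \<Longrightarrow> c (\<Psi> a) = cp a"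
proof -
  have "\<exists>\<psi>. bij_betw \<psi> {a\<in>P. cp a = v} {j\<in>J. c j = v}" if "v \<in> R" for v
    using eq[OF that] fin by (intro finite_same_card_bij) auto
  then obtain \<psi> where \<psi>: "\<And>v. v \<in> R \<Longrightarrow> bij_betw (\<psi> v) {a\<in>P. cp a = v} {j\<in>J. c j = v}" by metis
  define \<Psi> where "\<Psi> a = \<psi> (cp a) a" for a
  have mem: "\<Psi> a \<in> J \<and> c (\<Psi> a) = cp a" if "a \<in> P" for a
    using bij_betwE[OF \<psi>[of "cp a"]] that R unfolding \<Psi>_def by auto
  have "inj_on \<Psi> P"
  proof (rule inj_onI)
    fix a a' assume a: "a \<in> P" "a' \<in> P" "\<Psi> a = \<Psi> a'"
    then have cc: "cp a = cp a'" using mem by metis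
    have "cp a \<in> R" using a R by auto
    from \<psi>[OF this] show "a = a'" using a cc unfolding bij_betw_def inj_on_def \<Psi>_def by auto
  qed
  moreover have "\<Psi> ` P = J"
  proof
    show "J \<subseteq> \<Psi> ` P"
    proof
      fix j assume j: "j \<in> J"
      then have "c j \<in> R" using R by auto
      from \<psi>[OF this] have "j \<in> \<psi> (c j) ` {a\<in>P. cp a = c j}" using j by (simp add: bij_betw_def)
      then obtain a where "a \<in> P" "cp a = c j" "j = \<psi> (c j) a" by blast
      then have "j = \<Psi> a" "a \<in> P" by (simp_all add: \<Psi>_def)
      then show "j \<in> \<Psi> ` P" by blast
    qed
  qed (use mem in auto)
  ultimately show thesis using that[of \<Psi>] mem by (auto simp: bij_betw_def)
qed

lemma tileable_from_embeddings:
  fixes N :: nat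
  assumes "finite (verts K)" and inj: "inj_on Y ({..<N} \<times> verts K)"
    and e: "\<And>i e. i < N \<Longrightarrow> e \<in> edges K \<Longrightarrow> (\<lambda>x. Y (i,x)) ` e \<in> E"
  shows "tileable K E (Y ` ({..<N} \<times> verts K))"
proof -
  have "tileable K E (\<Union>i\<in>{..<N}. (\<lambda>x. Y (i,x)) ` verts K)"
  proof (rule tileable_UN)
    fix i assume "i \<in> {..<N}"
    then have "embeds K E (\<lambda>x. Y (i,x))" unfolding embeds_def using inj e by (auto simp: inj_on_def)
    then show "tileable K E ((\<lambda>x. Y (i,x)) ` verts K)" by (rule tileable_embeds)
  next
    fix i j assume "i \<in> {..<N}" "j \<in> {..<N}" "i \<noteq> j"
    then show "(\<lambda>x. Y (i,x)) ` verts K \<inter> (\<lambda>x. Y (j,x)) ` verts K = {}" using inj by (auto simp: inj_on_def)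
  qed simp
  moreover have "(\<Union>i\<in>{..<N}. (\<lambda>x. Y (i,x)) ` verts K) = Y ` ({..<N} \<times> verts K)" by auto
  ultimately show ?thesis by simp
qed

text \<open>
  Absorbers are tuples rather than sets, so that they can be counted as a proportion of all tuples.
\<close>

definition absorbs :: "'a hypergraph \<Rightarrow> 'b set set \<Rightarrow> 'j set \<Rightarrow> ('j \<Rightarrow> 'b) \<Rightarrow> 'b set \<Rightarrow> bool" where
  "absorbs K E J A Q \<longleftrightarrow> inj_on A J \<and> A ` J \<inter> Q = {} \<and> tileable K E (A ` J) \<and> tileable K E (A ` J \<union> Q)"

lemma card_fibres_list:
  assumes "finite (verts K)"
  shows "card {a\<in>{..<length ps} \<times> verts K. (ps ! fst a) (snd a) = v} = fibre_sum K ps v"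
proof -
  have "{a\<in>{..<length ps} \<times> verts K. (ps ! fst a) (snd a) = v} = (SIGMA i:{..<length ps}. {x\<in>verts K. (ps ! i) x = v})" by auto
  then have "card {a\<in>{..<length ps} \<times> verts K. (ps ! fst a) (snd a) = v} = (\<Sum>i<length ps. fibre K (ps ! i) v)"
    using assms by (simp add: fibre_def)
  also have "\<dots> = fibre_sum K ps v" by (simp add: sum_list_sum_nth atLeast0LessThan)
  finally show ?thesis .
qed

text \<open>
  The tuple \<open>Y\<close> is indexed by pairs of a position in \<open>ns\<close> and a vertex of \<open>K\<close>, so the tiling of its own
  vertices can be read off. For the second tiling, the indices of \<open>Y\<close> and the special indices, coloured by
  the vertex of the type they represent, are rearranged according to \<open>ps\<close>.
  Edges of \<open>K\<close> go to edges because their vertices have distinct colours and so form part of a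
  transversal of the blow-up.
\<close>

lemma blown_up_type_absorbs:
  fixes K :: "'a hypergraph" and q :: "nat \<Rightarrow> 'b" and Y :: "nat \<times> 'a \<Rightarrow> 'b"
  assumes kg: "kgraph k K"
    and ns: "length ns = N" "\<forall>\<kappa>\<in>set ns. khom K {..<s} H \<kappa>"
    and ps: "\<forall>\<kappa>\<in>set ps. khom K {..<s+b} H \<kappa>"
    and bal: "\<forall>v<s. fibre_sum K ps v = fibre_sum K ns v"
    and one: "\<forall>v\<in>{s..<s+b}. fibre_sum K ps v = 1"
    and q: "bij_betw q {s..<s+b} Q"
    and Hk: "\<And>e. e \<in> H \<Longrightarrow> card e = k"
    and Y: "inj_on Y ({..<N} \<times> verts K)" "Y ` ({..<N} \<times> verts K) \<inter> Q = {}"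
    and blow: "\<And>X. X \<subseteq> {..<N} \<times> verts K \<Longrightarrow> inj_on (\<lambda>a. (ns ! fst a) (snd a)) X \<Longrightarrow>
      \<exists>z. type_of E k s b q z = H \<and> (\<forall>a\<in>X. z ((ns ! fst a) (snd a)) = Y a)"
  shows "absorbs K E ({..<N} \<times> verts K) Y Q"
proof -
  define c where "c a = (ns ! fst a) (snd a)" for a :: "nat \<times> 'a"
  define J where "J = {..<N} \<times> verts K"
  have finK: "finite (verts K)" and eK: "\<And>e. e \<in> edges K \<Longrightarrow> e \<subseteq> verts K \<and> card e = k \<and> finite e"
    using kg by (auto simp: kgraph_def intro: finite_subset)
  have finJ: "finite J" using finK by (simp add: J_def)
  have injhom: "inj_on \<kappa> e" if "khom K R H \<kappa>" "e \<in> edges K" for \<kappa> :: "'a \<Rightarrow> nat" and e R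
  proof -
    have "card (\<kappa> ` e) = k" using that Hk by (auto simp: khom_def)
    then show ?thesis using eK[OF that(2)] by (intro eq_card_imp_inj_on) auto
  qed
  have cJ: "c a < s" if "a \<in> J" for a
  proof -
    have "ns ! fst a \<in> set ns" using that ns(1) by (auto simp: J_def)
    then have "khom K {..<s} H (ns ! fst a)" using ns(2) by blast
    moreover have "snd a \<in> verts K" using that by (auto simp: J_def)
    ultimately show ?thesis unfolding khom_def c_def by blast
  qed
  have edgeE: "extend_by s q z ` e \<in> E" if "type_of E k s b q z = H" "e \<in> H" for z e
    using that by (auto simp: type_of_def)
  have t1: "tileable K E (Y ` J)" unfolding J_def
  proof (rule tileable_from_embeddings[OF finK Y(1)])
    fix i e assume i: "i < N" and e: "e \<in> edges K"
    have hom: "khom K {..<s} H (ns ! i)" using ns i by auto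
    have "inj_on c ({i} \<times> e)" using injhom[OF hom e] by (auto simp: inj_on_def c_def)
    moreover have "{i} \<times> e \<subseteq> {..<N} \<times> verts K" using i eK[OF e] by auto
    ultimately obtain z where z: "type_of E k s b q z = H" "\<forall>a\<in>{i} \<times> e. z (c a) = Y a"
      using blow[of "{i} \<times> e"] unfolding c_def by blast
    have "Y (i,x) = extend_by s q z ((ns ! i) x)" if "x \<in> e" for x
    proof -
      have "(i,x) \<in> J" using i eK[OF e] that by (auto simp: J_def)
      from cJ[OF this] show ?thesis using z(2) that by (auto simp: extend_by_def c_def)
    qed
    then have "(\<lambda>x. Y (i,x)) ` e = extend_by s q z ` ((ns ! i) ` e)" unfolding image_image by (rule image_cong[OF refl])
    also have "\<dots> \<in> E" using edgeE[OF z(1)] hom e by (auto simp: khom_def)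
    finally show "(\<lambda>x. Y (i,x)) ` e \<in> E" .
  qed
  define J2 where "J2 = Inl ` J \<union> Inr ` {s..<s+b}"
  define c2 where "c2 = case_sum c id"
  define Y2 where "Y2 = case_sum Y q"
  have finJ2: "finite J2" using finJ by (simp add: J2_def)
  have injY2: "inj_on Y2 J2"
  proof -
    have "inj_on q {s..<s+b}" "q ` {s..<s+b} = Q" using q by (auto simp: bij_betw_def)
    moreover have "inj_on Y J" "Y ` J \<inter> Q = {}" using Y by (simp_all add: J_def)
    ultimately have "inj_on Y2 (Inl ` J)" "inj_on Y2 (Inr ` {s..<s+b})"
      and "Y2 ` Inl ` J = Y ` J" "Y2 ` Inr ` {s..<s+b} = Q"
      by (auto simp: inj_on_def Y2_def image_image)
    moreover from this have "Y2 ` (Inl ` J - Inr ` {s..<s+b}) \<inter> Y2 ` (Inr ` {s..<s+b} - Inl ` J) = {}"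
      using \<open>Y ` J \<inter> Q = {}\<close> by blast
    ultimately show ?thesis unfolding J2_def inj_on_Un by blast
  qed
  have Y2J2: "Y2 ` J2 = Y ` J \<union> Q"
    using q unfolding J2_def Y2_def by (auto simp: image_Un image_image bij_betw_def)
  have "card {a\<in>{..<length ps} \<times> verts K. (ps ! fst a) (snd a) = v} = card {j\<in>J2. c2 j = v}" if v: "v < s + b" for v
  proof (cases "v < s")
    case True
    then have "{j\<in>J2. c2 j = v} = Inl ` {j\<in>J. c j = v}" by (auto simp: J2_def c2_def)
    then have "card {j\<in>J2. c2 j = v} = card {j\<in>J. c j = v}" by (simp add: card_image)
    also have "\<dots> = fibre_sum K ns v"
      using card_fibres_list[OF finK, of ns v] ns(1) by (simp add: J_def c_def)
    finally show ?thesis using card_fibres_list[OF finK, of ps v] bal True by simp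
  next
    case False
    then have "{j\<in>J2. c2 j = v} = {Inr v}" using v cJ by (auto simp: J2_def c2_def)
    then show ?thesis using card_fibres_list[OF finK, of ps v] one v False by simp
  qed
  moreover have "(\<lambda>a. (ps ! fst a) (snd a)) ` ({..<length ps} \<times> verts K) \<subseteq> {..<s+b}"
  proof
    fix v assume "v \<in> (\<lambda>a. (ps ! fst a) (snd a)) ` ({..<length ps} \<times> verts K)"
    then obtain i x where ix: "i < length ps" "x \<in> verts K" "v = (ps ! i) x" by auto
    then have "khom K {..<s+b} H (ps ! i)" using ps by auto
    then show "v \<in> {..<s+b}" using ix by (auto simp: khom_def)
  qed
  moreover have "c2 ` J2 \<subseteq> {..<s+b}" using cJ by (fastforce simp: J2_def c2_def)
  ultimately obtain \<Psi> where \<Psi>: "bij_betw \<Psi> ({..<length ps} \<times> verts K) J2"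
    and c\<Psi>: "\<And>a. a \<in> {..<length ps} \<times> verts K \<Longrightarrow> c2 (\<Psi> a) = (ps ! fst a) (snd a)"
    using bij_with_equal_fibres[of "{..<length ps} \<times> verts K" J2 "\<lambda>a. (ps ! fst a) (snd a)" "{..<s+b}" c2] finK finJ2
    by (metis (no_types, lifting) finite_SigmaI finite_lessThan lessThan_iff)
  have "tileable K E ((Y2 \<circ> \<Psi>) ` ({..<length ps} \<times> verts K))"
  proof (rule tileable_from_embeddings[OF finK])
    show "inj_on (Y2 \<circ> \<Psi>) ({..<length ps} \<times> verts K)" using \<Psi> injY2 by (simp add: bij_betw_def comp_inj_on)
  next
    fix i e assume i: "i < length ps" and e: "e \<in> edges K"
    have hom: "khom K {..<s+b} H (ps ! i)" using ps i by auto
    define X where "X = \<Psi> ` ({i} \<times> e)"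
    have ie: "{i} \<times> e \<subseteq> {..<length ps} \<times> verts K" using i eK[OF e] by auto
    have XJ: "X \<subseteq> J2" using ie \<Psi> unfolding X_def bij_betw_def by blast
    have cX: "c2 (\<Psi> (i,x)) = (ps ! i) x" if "x \<in> e" for x using c\<Psi>[of "(i,x)"] ie that by auto
    have injX: "inj_on c2 X"
      using injhom[OF hom e] cX by (auto simp: inj_on_def X_def)
    define X1 where "X1 = {j. Inl j \<in> X}"
    have "X1 \<subseteq> {..<N} \<times> verts K" using XJ by (auto simp: X1_def J2_def J_def)
    moreover have "inj_on (\<lambda>a. (ns ! fst a) (snd a)) X1"
    proof (rule inj_onI)
      fix a a' assume "a \<in> X1" "a' \<in> X1" "(ns ! fst a) (snd a) = (ns ! fst a') (snd a')"
      then have "Inl a \<in> X" "Inl a' \<in> X" "c2 (Inl a) = c2 (Inl a')" by (auto simp: X1_def c2_def c_def)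
      then have "Inl a = (Inl a' :: _ + nat)" using injX by (auto dest: inj_onD)
      then show "a = a'" by simp
    qed
    ultimately obtain z where z: "type_of E k s b q z = H" "\<forall>a\<in>X1. z ((ns ! fst a) (snd a)) = Y a"
      using blow by blast
    have ext: "Y2 t = extend_by s q z (c2 t)" if t: "t \<in> X" for t
    proof (cases t)
      case (Inl a)
      then have "a \<in> X1" "a \<in> J" using t XJ by (auto simp: X1_def J2_def)
      then show ?thesis using z(2) cJ Inl by (auto simp: Y2_def c2_def extend_by_def c_def)
    next
      case (Inr j)
      then have "j \<in> {s..<s+b}" using t XJ by (auto simp: J2_def)
      then show ?thesis using Inr by (simp add: Y2_def c2_def extend_by_def)
    qed
    have "(\<lambda>x. (Y2 \<circ> \<Psi>) (i,x)) ` e = extend_by s q z ` ((ps ! i) ` e)" unfolding image_image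
    proof (rule image_cong[OF refl])
      fix x assume x: "x \<in> e"
      then have "\<Psi> (i,x) \<in> X" by (auto simp: X_def)
      from ext[OF this] show "(Y2 \<circ> \<Psi>) (i,x) = extend_by s q z ((ps ! i) x)" using cX[OF x] by simp
    qed
    also have "\<dots> \<in> E" using edgeE[OF z(1)] hom e by (auto simp: khom_def)
    finally show "(\<lambda>x. (Y2 \<circ> \<Psi>) (i,x)) ` e \<in> E" .
  qed
  moreover have "(Y2 \<circ> \<Psi>) ` ({..<length ps} \<times> verts K) = Y ` J \<union> Q"
    using \<Psi> Y2J2 unfolding image_comp[symmetric] bij_betw_def by simp
  ultimately have "tileable K E (Y ` J \<union> Q)" by simp
  then show ?thesis using t1 Y unfolding absorbs_def J_def by auto
qed

lemma popular_value:
  fixes a :: real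
  assumes "finite X" "finite T" "f ` X \<subseteq> T" "a * real (card T) \<le> real (card X)" "T \<noteq> {}"
  obtains t where "t \<in> T" "a \<le> real (card {x\<in>X. f x = t})"
proof -
  have "\<exists>t\<in>T. a \<le> real (card {x\<in>X. f x = t})"
  proof (rule ccontr)
    assume "\<not> ?thesis"
    then have lt: "real (card {x\<in>X. f x = t}) < a" if "t \<in> T" for t using that by auto
    have "real (card X) = real (card (\<Union>t\<in>T. {x\<in>X. f x = t}))" using assms(3) by (intro arg_cong[where f="\<lambda>A. real (card A)"]) auto
    also have "\<dots> \<le> (\<Sum>t\<in>T. real (card {x\<in>X. f x = t}))"
      unfolding of_nat_sum[symmetric] of_nat_le_iff by (rule card_UN_le[OF assms(2)])
    also have "\<dots> < (\<Sum>t\<in>T. a)" using lt assms by (intro sum_strict_mono) auto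
    finally show False using assms by (simp add: mult.commute)
  qed
  then show thesis using that by blast
qed

text \<open>
  Among the good samples one type occurs with constant density, as there are boundedly many types.
  Supersaturation turns this into a constant density of blow-ups of that type, and all but a vanishing
  proportion of these are injective and avoid \<open>Q\<close>.
\<close>

lemma many_absorbers:
  fixes K :: "'a hypergraph" and \<alpha> :: real
  assumes k: "k \<ge> 3" and kp: "kpartite k K" and S1: "Gcd (class_sizes k K) = 1"
    and g: "gcd_hypergraph k K > 1" and p: "p = Min (prime_factors (gcd_hypergraph k K))" "p \<ge> 1"
    and b: "b = card (verts K)" "b > 0" and \<alpha>: "\<alpha> > 0"
  shows "\<exists>N\<ge>1. \<exists>c>0. \<exists>n0. \<forall>(E :: 'b set set) V. finite V \<and> card V \<ge> n0 \<and>
      codegrees_ge k E V (1 / real p + \<alpha>) \<longrightarrow>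
      (\<forall>Q\<subseteq>V. card Q = b \<longrightarrow> c * real (card V) ^ (N * b) \<le>
         real (card {A \<in> ({..<N} \<times> verts K) \<rightarrow>\<^sub>E V. absorbs K E ({..<N} \<times> verts K) A Q}))"
proof -
  have kg: "kgraph k K" using kp by (simp add: kpartite_def)
  have finK: "finite (verts K)" using kg by (simp add: kgraph_def)
  have k1: "k \<ge> 1" using k by simp
  obtain s n1 where s: "s \<ge> p * k" "s \<ge> k" and good: "\<And>(E :: 'b set set) V q. finite V \<and> card V \<ge> n1 \<and>
      codegrees_ge k E V (1 / real p + \<alpha>) \<and>
      inj_on q {s..<s+b} \<and> q ` {s..<s+b} \<subseteq> V \<Longrightarrow>
      real (card V) ^ s \<le> 2 * real (card {z \<in> {..<s} \<rightarrow>\<^sub>E V. good_type p k s b (type_of E k s b q z)})"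
    using most_samples_good[OF \<alpha> p(2) k1, of "p * k" b, where 'b='b] by blast
  define Ty where "Ty = {H. good_type p k s b H}"
  have TyP: "Ty \<subseteq> Pow (Pow {..<s+b})" by (auto simp: Ty_def good_type_def)
  have finTy: "finite Ty" using TyP by (rule finite_subset) simp
  define Abs where "Abs H N ps ns \<longleftrightarrow> length ns = N \<and> (\<forall>\<kappa>\<in>set ns. khom K {..<s} H \<kappa>) \<and>
     (\<forall>\<kappa>\<in>set ps. khom K {..<s+b} H \<kappa>) \<and>
     (\<forall>v<s. fibre_sum K ps v = fibre_sum K ns v) \<and>
     (\<forall>v\<in>{s..<s+b}. fibre_sum K ps v = 1)" for H N ps ns
  have "\<exists>N0. \<forall>N\<ge>N0. \<exists>ps ns. Abs H N ps ns" if "H \<in> Ty" for H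
    using absorber_type[OF k kp S1 g p(1) b s] that unfolding Abs_def Ty_def by blast
  then obtain N0 where N0: "\<And>H N. H \<in> Ty \<Longrightarrow> N \<ge> N0 H \<Longrightarrow> \<exists>ps ns. Abs H N ps ns" by metis
  define N where "N = Max (insert 1 (N0 ` Ty))"
  have N: "N \<ge> 1" "\<And>H. H \<in> Ty \<Longrightarrow> N \<ge> N0 H" unfolding N_def using finTy by auto
  define m where "m = N * b"
  have m: "m \<ge> 1" using N b by (simp add: m_def Suc_le_eq)
  define J where "J = {..<N} \<times> verts K"
  have J: "finite J" "card J = m" using finK b by (auto simp: J_def m_def card_cartesian_product)
  define d where "d = 1 / (2 * real (card (Pow (Pow {..<s+b}))))"
  have d: "d > 0" by (simp add: d_def card_Pow)
  define D where "D = d ^ (m ^ s)"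
  have D: "D > 0" using d by (simp add: D_def)
  define n0 where "n0 = max (max 1 n1) (nat \<lceil>2 * real (m\<^sup>2 + m * b) / D\<rceil>)"
  show ?thesis
  proof (rule exI[of _ N], intro conjI N(1), rule exI[of _ "D / 2"], intro conjI, use D in simp,
      rule exI[of _ n0], intro allI impI, elim conjE)
    fix E :: "'b set set" and V :: "'b set" and Q
    assume V: "finite V" and nV: "n0 \<le> card V"
      and deg: "codegrees_ge k E V (1 / real p + \<alpha>)"
      and Q: "Q \<subseteq> V" "card Q = b"
    define n where "n = real (card V)"
    have n1: "1 \<le> card V" "n1 \<le> card V" "nat \<lceil>2 * real (m\<^sup>2 + m * b) / D\<rceil> \<le> card V"
      using nV by (auto simp: n0_def)
    then have "2 * real (m\<^sup>2 + m * b) / D \<le> n" unfolding n_def by (simp only: nat_ceiling_le_eq)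
    then have nD: "2 * real (m\<^sup>2 + m * b) \<le> D * n" using D by (simp only: pos_divide_le_eq mult.commute)
    have n: "n \<ge> 1" using n1 by (simp add: n_def)
    have V0: "V \<noteq> {}" using n1 by auto
    have finQ: "finite Q" using Q V by (auto intro: finite_subset)
    obtain q where q: "bij_betw q {s..<s+b} Q" using finite_same_card_bij[of "{s..<s+b}" Q] finQ Q by auto
    define G where "G = {z \<in> {..<s} \<rightarrow>\<^sub>E V. good_type p k s b (type_of E k s b q z)}"
    have G: "n ^ s \<le> 2 * real (card G)" unfolding n_def G_def
      using q Q V n1 deg by (intro good) (auto simp: bij_betw_def)
    have finG: "finite G" unfolding G_def using V by (auto intro!: finite_subset[OF _ finite_PiE[of "{..<s}" "\<lambda>_. V"]])
    have "d * n ^ s * real (card (Pow (Pow {..<s+b}))) \<le> real (card G)" using G by (simp add: d_def card_Pow)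
    moreover have "real (card Ty) \<le> real (card (Pow (Pow {..<s+b})))" using TyP by (simp add: card_mono del: card_Pow)
    then have "d * n ^ s * real (card Ty) \<le> d * n ^ s * real (card (Pow (Pow {..<s+b})))"
      using d n by (intro mult_left_mono) auto
    ultimately have "d * n ^ s * real (card Ty) \<le> real (card G)" by linarith
    moreover have "type_of E k s b q ` G \<subseteq> Ty" by (auto simp: G_def Ty_def)
    moreover have "Ty \<noteq> {}"
    proof -
      have "n ^ s \<ge> 1" using n by simp
      then have "card G \<noteq> 0" using G by linarith
      then have "G \<noteq> {}" by auto
      then show ?thesis by (auto simp: G_def Ty_def)
    qed
    ultimately obtain H where H: "H \<in> Ty" "d * n ^ s \<le> real (card {z\<in>G. type_of E k s b q z = H})"
      using popular_value[OF finG finTy, of "type_of E k s b q" "d * n ^ s"] by blast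
    define F where "F = {z\<in>G. type_of E k s b q z = H}"
    obtain ps ns where "Abs H N ps ns" using N0[OF H(1) N(2)[OF H(1)]] by blast
    then have ns: "length ns = N" "\<forall>\<kappa>\<in>set ns. khom K {..<s} H \<kappa>"
      and ps: "\<forall>\<kappa>\<in>set ps. khom K {..<s+b} H \<kappa>"
      and bal: "\<forall>v<s. fibre_sum K ps v = fibre_sum K ns v"
      and one: "\<forall>v\<in>{s..<s+b}. fibre_sum K ps v = 1" unfolding Abs_def by auto
    define c where "c a = (ns ! fst a) (snd a)" for a :: "nat \<times> 'a"
    let ?T = "{Y \<in> J \<rightarrow>\<^sub>E V. \<forall>X\<subseteq>J. inj_on c X \<longrightarrow> (\<exists>z\<in>F. \<forall>j\<in>X. z (c j) = Y j)}"
    let ?A = "{A \<in> J \<rightarrow>\<^sub>E V. absorbs K E J A Q}"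
    have "d ^ (m ^ card {..<s}) * real (card V) ^ card J \<le> real (card ?T)"
    proof (rule blowup_count)
      have "c a < s" if "a \<in> J" for a
      proof -
        have "ns ! fst a \<in> set ns" using that ns(1) by (auto simp: J_def)
        then have "khom K {..<s} H (ns ! fst a)" using ns(2) by blast
        moreover have "snd a \<in> verts K" using that by (auto simp: J_def)
        ultimately show ?thesis unfolding khom_def c_def by blast
      qed
      then show "c ` J \<subseteq> {..<s}" by auto
      show "F \<subseteq> {..<s} \<rightarrow>\<^sub>E V" by (auto simp: F_def G_def)
      show "d * real (card V) ^ card {..<s} \<le> real (card F)" using H by (simp add: F_def n_def)
    qed (use J V V0 m d in auto)
    then have count: "D * n ^ m \<le> real (card ?T)" by (simp add: D_def n_def J)
    have sub: "?T \<subseteq> ?A \<union> {Y \<in> J \<rightarrow>\<^sub>E V. \<not> inj_on Y J} \<union> {Y \<in> J \<rightarrow>\<^sub>E V. Y ` J \<inter> Q \<noteq> {}}"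
    proof
      fix Y assume Y: "Y \<in> ?T"
      show "Y \<in> ?A \<union> {Y \<in> J \<rightarrow>\<^sub>E V. \<not> inj_on Y J} \<union> {Y \<in> J \<rightarrow>\<^sub>E V. Y ` J \<inter> Q \<noteq> {}}"
      proof (cases "inj_on Y J \<and> Y ` J \<inter> Q = {}")
        case False
        then show ?thesis using Y by blast
      next
        case True
        have "absorbs K E ({..<N} \<times> verts K) Y Q"
        proof (rule blown_up_type_absorbs[OF kg ns ps bal one q])
          show "card e = k" if "e \<in> H" for e using that H(1) by (auto simp: Ty_def good_type_def)
          show "inj_on Y ({..<N} \<times> verts K)" "Y ` ({..<N} \<times> verts K) \<inter> Q = {}" using True by (auto simp: J_def)
          fix X assume "X \<subseteq> {..<N} \<times> verts K" "inj_on (\<lambda>a. (ns ! fst a) (snd a)) X"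
          then have "\<exists>z\<in>F. \<forall>j\<in>X. z (c j) = Y j" using Y unfolding J_def c_def[abs_def] by blast
          then show "\<exists>z. type_of E k s b q z = H \<and> (\<forall>a\<in>X. z ((ns ! fst a) (snd a)) = Y a)"
            unfolding F_def c_def by blast
        qed
        then show ?thesis using Y by (auto simp: J_def)
      qed
    qed
    have fin: "finite {Y \<in> J \<rightarrow>\<^sub>E V. P Y}" for P using J V by (auto intro!: finite_subset[OF _ finite_PiE[of J "\<lambda>_. V"]])
    have "card ?T \<le> card (?A \<union> {Y \<in> J \<rightarrow>\<^sub>E V. \<not> inj_on Y J} \<union> {Y \<in> J \<rightarrow>\<^sub>E V. Y ` J \<inter> Q \<noteq> {}})"
      by (rule card_mono[OF _ sub]) (use fin in \<open>intro finite_UnI\<close>)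
    also have "\<dots> \<le> card ?A + card {Y \<in> J \<rightarrow>\<^sub>E V. \<not> inj_on Y J} + card {Y \<in> J \<rightarrow>\<^sub>E V. Y ` J \<inter> Q \<noteq> {}}"
      by (meson add_mono card_Un_le le_trans order_refl)
    also have "\<dots> \<le> card ?A + m\<^sup>2 * card V ^ (m - 1) + m * b * card V ^ (m - 1)"
      using card_PiE_not_inj[OF J(1) V] card_PiE_meets[OF J(1) V Q(1)] J Q by (intro add_mono) auto
    also have "\<dots> = card ?A + (m\<^sup>2 + m * b) * card V ^ (m - 1)" by (simp add: algebra_simps)
    finally have "real (card ?T) \<le> real (card ?A + (m\<^sup>2 + m * b) * card V ^ (m - 1))" by (simp only: of_nat_le_iff)
    then have 1: "real (card ?T) \<le> real (card ?A) + real (m\<^sup>2 + m * b) * n ^ (m - 1)" by (simp add: n_def)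
    have "2 * (real (m\<^sup>2 + m * b) * n ^ (m - 1)) \<le> D * n * n ^ (m - 1)"
      using mult_right_mono[OF nD, of "n ^ (m - 1)"] n by (simp add: mult.assoc)
    also have "\<dots> = D * n ^ m" using m by (metis Suc_diff_1 Suc_le_eq One_nat_def mult.assoc power_Suc)
    finally have "D / 2 * n ^ m \<le> real (card ?A)" using 1 count by linarith
    then show "D / 2 * real (card V) ^ (N * b) \<le>
         real (card {A \<in> ({..<N} \<times> verts K) \<rightarrow>\<^sub>E V. absorbs K E ({..<N} \<times> verts K) A Q})"
      by (simp add: n_def m_def J_def)
  qed
qed

section \<open>Absorbing family and perfect packing\<close>

text \<open>
  The family is chosen one member at a time, keeping \<open>\<Sum>\<^sub>Q (1/2) ^ (number of chosen absorbers of Q)\<close>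
  small. The vertices used so far meet at most half of the absorbers of each \<open>Q\<close>, so by averaging some free
  tuple absorbs a set of \<open>Q\<close> carrying a proportion \<open>c/2\<close> of this sum, and halving those terms
  multiplies the sum by at most \<open>1 - c/4\<close>.
\<close>

lemma absorbing_family:
  fixes V :: "'v set" and Abs :: "'q \<Rightarrow> ('j \<Rightarrow> 'v) set" and c :: real
  assumes fin: "finite V" "finite J" "finite \<Q>" and ne: "V \<noteq> {}" "J \<noteq> {}" "\<Q> \<noteq> {}"
    and Abs: "\<And>Q. Q \<in> \<Q> \<Longrightarrow> Abs Q \<subseteq> (J \<rightarrow>\<^sub>E V)"
    and dense: "\<And>Q. Q \<in> \<Q> \<Longrightarrow> c * real (card V) ^ card J \<le> real (card (Abs Q))"
    and c: "c > 0" and t: "2 * real (card J) ^ 2 * real t \<le> c * real (card V)"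
  shows "\<exists>As. (\<forall>i<t. As i \<in> (\<Union>Q\<in>\<Q>. Abs Q)) \<and>
      (\<forall>i<t. \<forall>j<t. i \<noteq> j \<longrightarrow> As i ` J \<inter> As j ` J = {}) \<and>
      (\<Sum>Q\<in>\<Q>. (1/2) ^ card {i. i < t \<and> As i \<in> Abs Q}) \<le> real (card \<Q>) * (1 - c/4) ^ t"
  using t
proof (induction t)
  case 0
  show ?case by simp
next
  case (Suc t)
  define m where "m = card J"
  define n where "n = real (card V)"
  have m: "m > 0" using fin ne by (simp add: m_def card_gt_0_iff)
  have n: "n > 0" using fin ne by (simp add: n_def card_gt_0_iff)
  have tn: "2 * real m ^ 2 * real t \<le> c * n"
  proof -
    have "2 * real m ^ 2 * real t \<le> 2 * real m ^ 2 * real (Suc t)" by (intro mult_left_mono) auto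
    then show ?thesis using Suc.prems by (simp add: m_def n_def)
  qed
  then obtain As where As: "\<forall>i<t. As i \<in> (\<Union>Q\<in>\<Q>. Abs Q)"
      "\<forall>i<t. \<forall>j<t. i \<noteq> j \<longrightarrow> As i ` J \<inter> As j ` J = {}"
      "(\<Sum>Q\<in>\<Q>. (1/2) ^ card {i. i < t \<and> As i \<in> Abs Q}) \<le> real (card \<Q>) * (1 - c/4) ^ t"
    using Suc.IH unfolding m_def n_def by blast
  have finP: "finite (J \<rightarrow>\<^sub>E V)" and cP: "real (card (J \<rightarrow>\<^sub>E V)) = n ^ m"
    using fin by (auto simp: finite_PiE card_PiE n_def m_def)
  obtain Q0 where Q0: "Q0 \<in> \<Q>" using ne by auto
  have c1: "c \<le> 1"
  proof -
    have "c * n ^ m \<le> real (card (Abs Q0))" using dense[OF Q0] by (simp add: n_def m_def)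
    also have "card (Abs Q0) \<le> card (J \<rightarrow>\<^sub>E V)" by (rule card_mono[OF finP Abs[OF Q0]])
    then have "real (card (Abs Q0)) \<le> n ^ m" using cP by linarith
    finally show ?thesis using n by simp
  qed
  define W where "W = (\<Union>i<t. As i ` J)"
  have WV: "W \<subseteq> V"
  proof -
    have "As i \<in> J \<rightarrow>\<^sub>E V" if "i < t" for i using As(1) that Abs by blast
    then show ?thesis unfolding W_def by (fastforce simp: PiE_iff)
  qed
  have cW: "card W \<le> m * t"
  proof -
    have "card W \<le> (\<Sum>i<t. card (As i ` J))" unfolding W_def by (rule card_UN_le) simp
    also have "\<dots> \<le> (\<Sum>i<t. m)" unfolding m_def by (intro sum_mono card_image_le fin)
    finally show ?thesis by (simp add: mult.commute)
  qed
  define Free where "Free = {A \<in> J \<rightarrow>\<^sub>E V. A ` J \<inter> W = {}}"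
  define w where "w Q = (1/2 :: real) ^ card {i. i < t \<and> As i \<in> Abs Q}" for Q
  have w: "w Q > 0" for Q by (simp add: w_def)
  have avail: "c / 2 * n ^ m \<le> real (card {A\<in>Free. A \<in> Abs Q})" if Q: "Q \<in> \<Q>" for Q
  proof -
    have "Abs Q \<subseteq> {A\<in>Free. A \<in> Abs Q} \<union> {A \<in> J \<rightarrow>\<^sub>E V. A ` J \<inter> W \<noteq> {}}" using Abs[OF Q] by (auto simp: Free_def)
    then have "card (Abs Q) \<le> card ({A\<in>Free. A \<in> Abs Q} \<union> {A \<in> J \<rightarrow>\<^sub>E V. A ` J \<inter> W \<noteq> {}})"
      using finP by (intro card_mono) (auto simp: Free_def)
    also have "\<dots> \<le> card {A\<in>Free. A \<in> Abs Q} + card {A \<in> J \<rightarrow>\<^sub>E V. A ` J \<inter> W \<noteq> {}}" by (rule card_Un_le)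
    also have "card {A \<in> J \<rightarrow>\<^sub>E V. A ` J \<inter> W \<noteq> {}} \<le> m * card W * card V ^ (m - 1)"
      unfolding m_def by (rule card_PiE_meets[OF fin(2,1) WV])
    also have "\<dots> \<le> m * (m * t) * card V ^ (m - 1)" using cW by (intro mult_le_mono) auto
    finally have "real (card (Abs Q)) \<le> real (card {A\<in>Free. A \<in> Abs Q} + m * (m * t) * card V ^ (m - 1))" by (simp only: of_nat_le_iff)
    then have 1: "real (card (Abs Q)) \<le> real (card {A\<in>Free. A \<in> Abs Q}) + real m ^ 2 * real t * n ^ (m - 1)"
      by (simp add: n_def power2_eq_square)
    have "2 * (real m ^ 2 * real t * n ^ (m - 1)) \<le> c * n * n ^ (m - 1)"
      using mult_right_mono[OF tn, of "n ^ (m - 1)"] n by (simp add: mult.assoc)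
    also have "\<dots> = c * n ^ m" using m by (metis Suc_diff_1 mult.assoc power_Suc)
    finally show ?thesis using 1 dense[OF Q] by (simp add: n_def m_def)
  qed
  define X where "X = {A\<in>Free. \<exists>Q\<in>\<Q>. A \<in> Abs Q}"
  have finX: "finite X" unfolding X_def Free_def using finP by auto
  define T where "T = (\<Sum>Q\<in>\<Q>. w Q)"
  have T0: "T > 0" unfolding T_def using w fin ne by (intro sum_pos) auto
  have "\<exists>A\<in>X. c / 2 * T \<le> (\<Sum>Q\<in>{Q\<in>\<Q>. A \<in> Abs Q}. w Q)"
  proof (rule ccontr)
    assume "\<not> ?thesis"
    then have lt: "(\<Sum>Q\<in>{Q\<in>\<Q>. A \<in> Abs Q}. w Q) < c / 2 * T" if "A \<in> X" for A using that by auto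
    have "c / 2 * n ^ m * T = (\<Sum>Q\<in>\<Q>. w Q * (c / 2 * n ^ m))" unfolding T_def sum_distrib_right[symmetric] by (rule mult.commute)
    also have "\<dots> \<le> (\<Sum>Q\<in>\<Q>. w Q * real (card {A\<in>X. A \<in> Abs Q}))"
    proof (intro sum_mono mult_left_mono)
      fix Q assume Q: "Q \<in> \<Q>"
      then have "{A\<in>Free. A \<in> Abs Q} = {A\<in>X. A \<in> Abs Q}" by (auto simp: X_def)
      then show "c / 2 * n ^ m \<le> real (card {A\<in>X. A \<in> Abs Q})" using avail[OF Q] by simp
    qed (use w in \<open>auto intro: less_imp_le\<close>)
    also have "\<dots> = (\<Sum>Q\<in>\<Q>. \<Sum>A\<in>{A\<in>X. A \<in> Abs Q}. w Q)" by (simp add: mult.commute)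
    also have "\<dots> = (\<Sum>A\<in>X. \<Sum>Q\<in>{Q\<in>\<Q>. A \<in> Abs Q}. w Q)" by (rule sum.swap_restrict[OF fin(3) finX])
    finally have le: "c / 2 * n ^ m * T \<le> (\<Sum>A\<in>X. \<Sum>Q\<in>{Q\<in>\<Q>. A \<in> Abs Q}. w Q)" .
    have pos: "c / 2 * n ^ m * T > 0" using c n T0 by simp
    have X0: "X \<noteq> {}" using le pos by auto
    have "(\<Sum>A\<in>X. \<Sum>Q\<in>{Q\<in>\<Q>. A \<in> Abs Q}. w Q) < (\<Sum>A\<in>X. c / 2 * T)"
      using lt finX X0 by (intro sum_strict_mono) auto
    also have "\<dots> = real (card X) * (c / 2 * T)" by simp
    also have "\<dots> \<le> n ^ m * (c / 2 * T)"
    proof (rule mult_right_mono)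
      have "card X \<le> card (J \<rightarrow>\<^sub>E V)" using finP by (intro card_mono) (auto simp: X_def Free_def)
      then show "real (card X) \<le> n ^ m" using cP by linarith
    qed (use c T0 in simp)
    finally show False using le by (simp add: mult_ac)
  qed
  then obtain A where A: "A \<in> X" "c / 2 * T \<le> (\<Sum>Q\<in>{Q\<in>\<Q>. A \<in> Abs Q}. w Q)" by blast
  have AW: "A ` J \<inter> W = {}" using A by (auto simp: X_def Free_def)
  define As' where "As' = As(t := A)"
  have 1: "\<forall>i<Suc t. As' i \<in> (\<Union>Q\<in>\<Q>. Abs Q)" using As(1) A by (auto simp: As'_def X_def less_Suc_eq)
  have At: "A ` J \<inter> As i ` J = {}" if "i < t" for i using AW that by (auto simp: W_def)
  have 2: "\<forall>i<Suc t. \<forall>j<Suc t. i \<noteq> j \<longrightarrow> As' i ` J \<inter> As' j ` J = {}"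
  proof (intro allI impI)
    fix i j assume "i < Suc t" "j < Suc t" "i \<noteq> j"
    then consider "i < t" "j < t" | "i = t" "j < t" | "i < t" "j = t" by linarith
    then show "As' i ` J \<inter> As' j ` J = {}"
    proof cases
      case 1
      then show ?thesis using As(2) \<open>i \<noteq> j\<close> by (simp add: As'_def)
    next
      case 2
      then show ?thesis using At by (simp add: As'_def)
    next
      case 3
      then show ?thesis using At[of i] by (simp add: As'_def Int_commute)
    qed
  qed
  have new: "(1/2 :: real) ^ card {i. i < Suc t \<and> As' i \<in> Abs Q} = w Q - (if A \<in> Abs Q then w Q / 2 else 0)" for Q
  proof (cases "A \<in> Abs Q")
    case True
    then have "{i. i < Suc t \<and> As' i \<in> Abs Q} = insert t {i. i < t \<and> As i \<in> Abs Q}" by (auto simp: As'_def)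
    then show ?thesis using True by (simp add: w_def)
  next
    case False
    then have "{i. i < Suc t \<and> As' i \<in> Abs Q} = {i. i < t \<and> As i \<in> Abs Q}" by (auto simp: As'_def less_Suc_eq)
    then show ?thesis using False by (simp add: w_def)
  qed
  have "(\<Sum>Q\<in>\<Q>. (1/2 :: real) ^ card {i. i < Suc t \<and> As' i \<in> Abs Q}) = T - (\<Sum>Q\<in>\<Q>. if A \<in> Abs Q then w Q / 2 else 0)"
    unfolding new T_def by (rule sum_subtractf)
  also have "(\<Sum>Q\<in>\<Q>. if A \<in> Abs Q then w Q / 2 else 0) = (\<Sum>Q\<in>{Q\<in>\<Q>. A \<in> Abs Q}. w Q / 2)"
    by (rule sum.inter_filter[OF fin(3), symmetric])
  also have "\<dots> = (\<Sum>Q\<in>{Q\<in>\<Q>. A \<in> Abs Q}. w Q) / 2" by (rule sum_divide_distrib[symmetric])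
  also have "T - \<dots> \<le> T * (1 - c / 4)" using A(2) by (simp add: algebra_simps)
  also have "\<dots> \<le> real (card \<Q>) * (1 - c/4) ^ t * (1 - c / 4)"
    using As(3) c1 unfolding T_def w_def by (intro mult_right_mono) auto
  finally have 3: "(\<Sum>Q\<in>\<Q>. (1/2 :: real) ^ card {i. i < Suc t \<and> As' i \<in> Abs Q}) \<le> real (card \<Q>) * (1 - c/4) ^ Suc t"
    by (simp add: mult_ac)
  from 1 2 3 show ?case by blast
qed

text \<open>
  The sets \<open>Q\<close> are assigned distinct absorbers one after another: each choice uses up one absorber, and
  the requirement on the number of available absorbers drops by one as well.
\<close>

lemma absorb_leftover:
  assumes "finite I" "finite L" "b > 0" "b dvd card L"
    and "\<And>i. i \<in> I \<Longrightarrow> tileable K E (X i)"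
    and "\<And>i j. i \<in> I \<Longrightarrow> j \<in> I \<Longrightarrow> i \<noteq> j \<Longrightarrow> X i \<inter> X j = {}"
    and "\<And>i. i \<in> I \<Longrightarrow> X i \<inter> L = {}"
    and "\<And>Q. Q \<subseteq> L \<Longrightarrow> card Q = b \<Longrightarrow> card L \<le> b * card {i\<in>I. tileable K E (X i \<union> Q)}"
  shows "tileable K E ((\<Union>i\<in>I. X i) \<union> L)"
  using assms
proof (induction "card L" arbitrary: I L rule: less_induct)
  case less
  show ?case
  proof (cases "L = {}")
    case True
    then show ?thesis using tileable_UN[of I K E X] less.prems by simp
  next
    case False
    then have "card L > 0" using less.prems by (simp add: card_gt_0_iff)
    then have bL: "b \<le> card L" using less.prems by (simp add: dvd_imp_le)
    then obtain Q where Q: "Q \<subseteq> L" "card Q = b" by (metis obtain_subset_with_card_n)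
    have finQ: "finite Q" using Q less.prems by (auto intro: finite_subset)
    have "card L \<le> b * card {i\<in>I. tileable K E (X i \<union> Q)}" using less.prems(8)[OF Q] .
    then have "card {i\<in>I. tileable K E (X i \<union> Q)} \<noteq> 0" using \<open>card L > 0\<close> by (metis mult_0_right not_le)
    then obtain i where i: "i \<in> I" "tileable K E (X i \<union> Q)" by (metis (mono_tags, lifting) card.empty empty_Collect_eq)
    have cL: "card (L - Q) = card L - b" using Q finQ by (simp add: card_Diff_subset)
    have "tileable K E ((\<Union>j\<in>I - {i}. X j) \<union> (L - Q))"
    proof (rule less.hyps)
      show "card (L - Q) < card L" using cL bL less.prems by simp
      show "b dvd card (L - Q)" using cL less.prems by simp
      fix R assume R: "R \<subseteq> L - Q" "card R = b"
      then have le: "card L \<le> b * card {j\<in>I. tileable K E (X j \<union> R)}" using less.prems(8)[of R] by auto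
      have "card {j\<in>I. tileable K E (X j \<union> R)} \<le> card (insert i {j\<in>I - {i}. tileable K E (X j \<union> R)})"
        using less.prems by (intro card_mono) auto
      also have "\<dots> \<le> Suc (card {j\<in>I - {i}. tileable K E (X j \<union> R)})" by (rule card_insert_le_m1) auto
      finally have "b * card {j\<in>I. tileable K E (X j \<union> R)} \<le> b * Suc (card {j\<in>I - {i}. tileable K E (X j \<union> R)})"
        by (rule mult_le_mono2)
      then show "card (L - Q) \<le> b * card {j\<in>I - {i}. tileable K E (X j \<union> R)}" using le cL by simp
    next
      show "X j \<inter> X j' = {}" if "j \<in> I - {i}" "j' \<in> I - {i}" "j \<noteq> j'" for j j' using less.prems(6) that by auto
      show "X j \<inter> (L - Q) = {}" if "j \<in> I - {i}" for j using less.prems(7)[of j] that by auto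
    qed (use less.prems in auto)
    moreover have "(X i \<union> Q) \<inter> ((\<Union>j\<in>I - {i}. X j) \<union> (L - Q)) = {}"
      using less.prems(6)[of i] less.prems(7) i(1) Q by blast
    ultimately have "tileable K E ((X i \<union> Q) \<union> ((\<Union>j\<in>I - {i}. X j) \<union> (L - Q)))" by (rule tileable_Un[OF i(2)])
    moreover have "(X i \<union> Q) \<union> ((\<Union>j\<in>I - {i}. X j) \<union> (L - Q)) = (\<Union>i\<in>I. X i) \<union> L" using i Q by auto
    ultimately show ?thesis by simp
  qed
qed

text \<open>
  The edges containing \<open>S\<close> are exactly the sets \<open>insert v S\<close> that are edges.
\<close>

lemma min_codegree_le:
  assumes G: "kgraph k G" and k: "k \<ge> 1" and S: "S \<subseteq> verts G" "card S = k - 1"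
  shows "min_codegree k G \<le> card {v\<in>verts G. insert v S \<in> edges G}"
proof -
  have fin: "finite (verts G)" using G by (simp add: kgraph_def)
  have finS: "finite S" using S fin by (auto intro: finite_subset)
  have "min_codegree k G \<le> card {e\<in>edges G. S \<subseteq> e}"
    unfolding min_codegree_def using fin S by (intro Min_le) auto
  also have "{e\<in>edges G. S \<subseteq> e} \<subseteq> (\<lambda>v. insert v S) ` {v\<in>verts G. insert v S \<in> edges G}"
  proof
    fix e assume e: "e \<in> {e\<in>edges G. S \<subseteq> e}"
    then have e': "e \<subseteq> verts G" "card e = k" "finite e" using G fin by (auto simp: kgraph_def intro: finite_subset)
    then have "card (e - S) = 1" using e S finS k by (simp add: card_Diff_subset)
    then obtain v where "e - S = {v}" by (rule card_1_singletonE)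
    then have "e = insert v S" "v \<in> verts G" using e e' by auto
    then show "e \<in> (\<lambda>v. insert v S) ` {v\<in>verts G. insert v S \<in> edges G}" using e by blast
  qed
  then have "card {e\<in>edges G. S \<subseteq> e} \<le> card ((\<lambda>v. insert v S) ` {v\<in>verts G. insert v S \<in> edges G})"
    using fin by (intro card_mono) auto
  also have "\<dots> \<le> card {v\<in>verts G. insert v S \<in> edges G}" using fin by (intro card_image_le) auto
  finally show ?thesis .
qed

text \<open>
  Reading off from the potential of \<open>absorbing_family\<close> that a single \<open>Q\<close> has many absorbers; the estimate
  \<open>1/2 \<ge> exp (- 1)\<close> suffices.
\<close>

lemma absorbers_counted:
  fixes c :: real and n b t cnt Qs :: nat
  assumes "(1/2) ^ cnt \<le> real Qs * (1 - c/4) ^ t" "Qs \<le> n ^ b" "n \<ge> 1" "0 < c" "c \<le> 1"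
  shows "c * real t / 4 - real b * ln (real n) \<le> real cnt"
proof -
  have "exp (- real cnt) = exp (- 1) ^ cnt" by (simp add: exp_of_nat_mult[symmetric])
  also have "\<dots> \<le> (1/2) ^ cnt"
  proof (rule power_mono)
    have "2 \<le> exp (1::real)" using exp_ge_add_one_self[of 1] by simp
    then show "exp (- 1) \<le> (1/2 :: real)" by (simp add: exp_minus field_simps)
  qed simp
  also note assms(1)
  also have "real Qs * (1 - c/4) ^ t \<le> real n ^ b * exp (- (c / 4)) ^ t"
  proof (intro mult_mono power_mono)
    show "real Qs \<le> real n ^ b" using assms(2) by (metis of_nat_le_iff of_nat_power)
    show "1 - c/4 \<le> exp (- (c/4))" using exp_ge_add_one_self[of "- (c/4)"] by simp
  qed (use assms in auto)
  also have "\<dots> = exp (real b * ln (real n)) * exp (real t * (- (c/4)))"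
    unfolding exp_of_nat_mult using assms by simp
  also have "\<dots> = exp (real b * ln (real n) + real t * (- (c/4)))" by (simp only: exp_add)
  finally have "- real cnt \<le> real b * ln (real n) + real t * (- (c/4))" by (simp only: exp_le_cancel_iff)
  then show ?thesis by (simp add: algebra_simps)
qed

lemma class_attaining_sigma:
  assumes kg: "kgraph k K" and U0: "realisation k K U0" and k: "k \<ge> 1"
  obtains U j where "realisation k K U" "j \<in> {1..k}" "sigma k K = real (card (U j)) / real (card (verts K))"
proof -
  have "class_sizes k K \<noteq> {}" using U0 k by (force simp: class_sizes_def)
  then have "Min (class_sizes k K) \<in> class_sizes k K" using finite_class_sizes[OF kg] by (rule Min_in[rotated])
  then obtain U j where "realisation k K U" "j \<in> {1..k}" "Min (class_sizes k K) = card (U j)"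
    by (auto simp: class_sizes_def)
  then show thesis using that by (simp add: sigma_def)
qed

theorem theorem1p3:
  fixes K :: "'a hypergraph" and k b p :: nat and \<alpha> :: real
  assumes "k \<ge> 3"
    and "kpartite k K"
    and "card (verts K) = b"
    and "Gcd (class_sizes k K) = 1"
    and "gcd_hypergraph k K > 1"
    and "p = Min (prime_factors (gcd_hypergraph k K))"
    and "\<alpha> > 0"
  shows "\<exists>n0::nat. \<forall>n\<ge>n0. \<forall>G :: 'b hypergraph.
           kgraph k G \<and> card (verts G) = n \<and> b dvd n \<and>
           real (min_codegree k G) \<ge> max (sigma k K * real n + \<alpha> * real n)
                                       (real n / real p + \<alpha> * real n)
           \<longrightarrow> (\<exists>P. perfect_packing K G P)"
proof -
  note k = \<open>k \<ge> 3\<close> and kp = \<open>kpartite k K\<close> and \<alpha> = \<open>\<alpha> > 0\<close>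
  have kg: "kgraph k K" and eK: "edges K \<noteq> {}" using kp by (auto simp: kpartite_def)
  have finK: "finite (verts K)" using kg by (simp add: kgraph_def)
  have b: "b = card (verts K)" "b > 0"
  proof -
    obtain e where "e \<in> edges K" using eK by auto
    then have "e \<subseteq> verts K" "card e = k" using kg by (auto simp: kgraph_def)
    then have "k \<le> card (verts K)" using card_mono[OF finK] by metis
    then show "b = card (verts K)" "b > 0" using k \<open>card (verts K) = b\<close> by auto
  qed
  obtain U0 where U0: "realisation k K U0" using kp by (auto simp: kpartite_def)
  have k1: "k \<ge> 1" and k2: "k \<ge> 2" using k by auto
  obtain U j0 where U: "realisation k K U" "j0 \<in> {1..k}" and \<sigma>: "sigma k K = real (card (U j0)) / real b"
    using class_attaining_sigma[OF kg U0 k1] b by metis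
  have p1: "p \<ge> 1"
  proof -
    have "finite (prime_factors (gcd_hypergraph k K))" "prime_factors (gcd_hypergraph k K) \<noteq> {}"
      using assms(5) prime_factor_nat[of "gcd_hypergraph k K"] by (auto simp: prime_factors_dvd)
    then have "p \<in> prime_factors (gcd_hypergraph k K)" using assms(6) by (simp add: Min_in)
    then show ?thesis by (auto simp: in_prime_factors_iff dest: prime_ge_1_nat)
  qed
  obtain N c n1 where N: "N \<ge> 1" and c: "c > 0" and abs: "\<forall>(E :: 'b set set) V. finite V \<and> card V \<ge> n1 \<and>
      codegrees_ge k E V (1 / real p + \<alpha>) \<longrightarrow>
      (\<forall>Q\<subseteq>V. card Q = b \<longrightarrow> c * real (card V) ^ (N * b) \<le>
         real (card {A \<in> ({..<N} \<times> verts K) \<rightarrow>\<^sub>E V. absorbs K E ({..<N} \<times> verts K) A Q}))"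
    using many_absorbers[OF k kp assms(4,5,6) p1 b \<alpha>, where 'b='b] by (elim exE conjE) (rule that)
  note absorbers = abs[rule_format]
  define J where "J = {..<N} \<times> verts K"
  define m where "m = N * b"
  have m: "m \<ge> 1" using N b by (simp add: m_def Suc_le_eq)
  have J: "finite J" "card J = m" "J \<noteq> {}"
    using finK b N by (auto simp: J_def m_def card_cartesian_product card_gt_0_iff Suc_le_eq)
  \<comment> \<open>The three bounds keep the family small enough for the greedy selection, for the codegrees outside it, and for at least half of the vertices to remain.\<close>
  define \<rho> where "\<rho> = min (c / (2 * real m ^ 2)) (min (\<alpha> / (2 * real m)) (1 / (2 * real m)))"
  have \<rho>: "\<rho> > 0" "\<rho> * (2 * real m ^ 2) \<le> c" "\<rho> * (2 * real m) \<le> \<alpha>" "\<rho> * (2 * real m) \<le> 1"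
  proof -
    have "\<rho> \<le> c / (2 * real m ^ 2)" "\<rho> \<le> \<alpha> / (2 * real m)" "\<rho> \<le> 1 / (2 * real m)" by (auto simp: \<rho>_def)
    then show "\<rho> * (2 * real m ^ 2) \<le> c" "\<rho> * (2 * real m) \<le> \<alpha>" "\<rho> * (2 * real m) \<le> 1"
      using m by (simp_all add: pos_le_divide_eq)
    show "\<rho> > 0" using c \<alpha> m by (simp add: \<rho>_def)
  qed
  \<comment> \<open>A leftover of \<open>\<eta> n\<close> vertices splits into \<open>c \<rho> n / 8\<close> sets of size \<open>b\<close>, which is how many absorbers each such set has at least in a family of about \<open>\<rho> n\<close> members.\<close>
  define \<eta> where "\<eta> = real b * c * \<rho> / 8"
  have \<eta>: "\<eta> > 0" using b c \<rho> by (simp add: \<eta>_def)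
  obtain n2 where tiling: "\<And>(E :: 'b set set) V. finite V \<and> card V \<ge> n2 \<and>
      codegrees_ge k E V (sigma k K + \<alpha>/2) \<Longrightarrow>
      (\<exists>L\<subseteq>V. real (card L) \<le> \<eta> * real (card V) \<and> tileable K E (V - L))"
    using almost_tiling[OF U(1) kg U(2) k2 b \<sigma> _ \<eta>, of "\<alpha>/2", where 'b='b] \<alpha> by auto
  obtain n3 where n3: "\<And>n. n \<ge> n3 \<Longrightarrow> real b * ln (real n) \<le> c * \<rho> / 16 * real n"
    using eventually_ln_le_linear[of "c * \<rho> / 16" "real b"] c \<rho> by auto
  define n0 where "n0 = Max {b, n1, 2 * n2, n3, nat \<lceil>4 / \<rho>\<rceil>}"
  show ?thesis
  proof (intro exI[of _ n0] allI impI, elim conjE)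
    fix n :: nat and G :: "'b hypergraph"
    assume n0: "n0 \<le> n" and G: "kgraph k G" and cG: "card (verts G) = n" and bn: "b dvd n"
      and deg: "max (sigma k K * real n + \<alpha> * real n) (real n / real p + \<alpha> * real n) \<le> real (min_codegree k G)"
    define V where "V = verts G"
    define E where "E = edges G"
    have V: "finite V" "card V = n" using G cG by (auto simp: kgraph_def V_def)
    have "b \<le> n0" "n1 \<le> n0" "2 * n2 \<le> n0" "n3 \<le> n0" "nat \<lceil>4 / \<rho>\<rceil> \<le> n0"
      unfolding n0_def by (intro Max_ge finite.intros; blast)+
    then have "b \<le> n" "n1 \<le> n" "2 * n2 \<le> n" "n3 \<le> n" "nat \<lceil>4 / \<rho>\<rceil> \<le> n"
      using n0 by (blast intro: order.trans)+
    then have n: "b \<le> n" "n1 \<le> n" "2 * n2 \<le> n" "n3 \<le> n" "4 / \<rho> \<le> real n"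
      by (simp_all only: nat_ceiling_le_eq)
    have n4: "4 \<le> \<rho> * real n" using n(5) \<rho> by (simp only: pos_divide_le_eq mult.commute)
    have n1': "n \<ge> 1" using n b by linarith
    have codeg: "(sigma k K + \<alpha>) * real n \<le> real (card {v\<in>V. insert v S \<in> E})"
      "(1 / real p + \<alpha>) * real n \<le> real (card {v\<in>V. insert v S \<in> E})" if S: "S \<subseteq> V" "card S = k - 1" for S
      using min_codegree_le[OF G k1, of S] S deg unfolding V_def E_def by (simp_all add: algebra_simps)
    define \<Q> where "\<Q> = {Q. Q \<subseteq> V \<and> card Q = b}"
    define Abs where "Abs Q = {A \<in> J \<rightarrow>\<^sub>E V. absorbs K E J A Q}" for Q
    have \<Q>: "finite \<Q>" "card \<Q> \<le> n ^ b" "\<Q> \<noteq> {}"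
    proof -
      show "finite \<Q>" using V by (simp add: \<Q>_def)
      show "card \<Q> \<le> n ^ b" using card_subsets_le_power[OF V(1), of b] V by (simp add: \<Q>_def)
      show "\<Q> \<noteq> {}" using n(1) V obtain_subset_with_card_n[of b V] by (auto simp: \<Q>_def)
    qed
    have dense: "c * real (card V) ^ card J \<le> real (card (Abs Q))" if "Q \<in> \<Q>" for Q
      using absorbers[of V E Q] V n(2) codeg(2) that by (simp add: \<Q>_def Abs_def J_def[symmetric] J(2) m_def[symmetric])
    define t where "t = nat \<lfloor>\<rho> * real n\<rfloor>"
    have t: "real t \<le> \<rho> * real n" "\<rho> * real n - 1 \<le> real t" unfolding t_def using n4 by linarith+
    have tc: "2 * real (card J) ^ 2 * real t \<le> c * real (card V)"
    proof -
      have "2 * real m ^ 2 * real t \<le> 2 * real m ^ 2 * (\<rho> * real n)" using t by (intro mult_left_mono) auto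
      also have "\<dots> = (\<rho> * (2 * real m ^ 2)) * real n" by simp
      also have "\<dots> \<le> c * real n" using \<rho> by (intro mult_right_mono) auto
      finally show ?thesis using J V by simp
    qed
    have V0: "V \<noteq> {}" using V n1' by auto
    have AbsJ: "Abs Q \<subseteq> (J \<rightarrow>\<^sub>E V)" for Q by (auto simp: Abs_def)
    have "\<exists>As. (\<forall>i<t. As i \<in> (\<Union>Q\<in>\<Q>. Abs Q)) \<and>
      (\<forall>i<t. \<forall>j<t. i \<noteq> j \<longrightarrow> As i ` J \<inter> As j ` J = {}) \<and>
      (\<Sum>Q\<in>\<Q>. (1/2) ^ card {i. i < t \<and> As i \<in> Abs Q}) \<le> real (card \<Q>) * (1 - c/4) ^ t"
      by (rule absorbing_family[OF V(1) J(1) \<Q>(1) V0 J(3) \<Q>(3) AbsJ dense c tc])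
    then obtain As where As: "\<forall>i<t. As i \<in> (\<Union>Q\<in>\<Q>. Abs Q)"
      "\<forall>i<t. \<forall>j<t. i \<noteq> j \<longrightarrow> As i ` J \<inter> As j ` J = {}"
      "(\<Sum>Q\<in>\<Q>. (1/2) ^ card {i. i < t \<and> As i \<in> Abs Q}) \<le> real (card \<Q>) * (1 - c/4) ^ t"
      by (elim exE conjE) (rule that)
    define cnt where "cnt Q = card {i. i < t \<and> As i \<in> Abs Q}" for Q
    have cntQ: "\<eta> * real n \<le> real b * real (cnt Q)" if Q: "Q \<in> \<Q>" for Q
    proof -
      have "c * real n ^ m \<le> real (card (Abs Q))" using dense[OF Q] V J by simp
      also have "card (Abs Q) \<le> card (J \<rightarrow>\<^sub>E V)" unfolding Abs_def using V J by (intro card_mono) (auto simp: finite_PiE)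
      then have "real (card (Abs Q)) \<le> real n ^ m" using V J by (simp add: card_PiE)
      finally have c1: "c \<le> 1" using n1' by simp
      have "(1/2) ^ cnt Q \<le> (\<Sum>Q\<in>\<Q>. (1/2 :: real) ^ cnt Q)" using Q \<Q> by (intro member_le_sum) auto
      then have "(1/2) ^ cnt Q \<le> real (card \<Q>) * (1 - c/4) ^ t" using As(3) unfolding cnt_def by linarith
      from absorbers_counted[OF this \<Q>(2) n1' c c1]
      have "c * real t / 4 - real b * ln (real n) \<le> real (cnt Q)" .
      moreover have "real b * ln (real n) \<le> c * \<rho> / 16 * real n" using n3 n(4) by blast
      moreover have "c * (\<rho> * real n * (3/4)) \<le> c * real t" using t n4 c by (intro mult_left_mono) auto
      moreover have "c * \<rho> * real n \<ge> 0" using c \<rho> by simp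
      ultimately have "c * \<rho> / 8 * real n \<le> real (cnt Q)" by (simp add: algebra_simps)
      then have "real b * (c * \<rho> / 8 * real n) \<le> real b * real (cnt Q)" by (intro mult_left_mono) auto
      then show ?thesis by (simp add: \<eta>_def)
    qed
    define X where "X i = As i ` J" for i
    define M where "M = (\<Union>i<t. X i)"
    have AsA: "\<exists>Q. absorbs K E J (As i) Q" "As i \<in> J \<rightarrow>\<^sub>E V" if "i < t" for i
      using As(1) that by (auto simp: Abs_def)
    have XV: "X i \<subseteq> V" "card (X i) = m" "finite (X i)" "tileable K E (X i)" if "i < t" for i
      using AsA[OF that] J by (auto simp: X_def absorbs_def card_image)
    have Xdisj: "X i \<inter> X j = {}" if "i < t" "j < t" "i \<noteq> j" for i j using As(2) that by (simp add: X_def)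
    have M: "M \<subseteq> V" "card M = m * t"
    proof -
      show "M \<subseteq> V" using XV by (auto simp: M_def)
      have "card M = (\<Sum>i<t. card (X i))" unfolding M_def using XV Xdisj by (intro card_UN_disjoint) auto
      then show "card M = m * t" using XV by (simp add: mult.commute)
    qed
    have finM: "finite M" using M V by (auto intro: finite_subset)
    have mt: "2 * real (m * t) \<le> \<alpha> * real n" "2 * real (m * t) \<le> real n"
    proof -
      have "2 * real (m * t) \<le> 2 * real m * (\<rho> * real n)" using t by (simp add: mult_left_mono)
      also have "\<dots> = \<rho> * (2 * real m) * real n" by simp
      finally have le: "2 * real (m * t) \<le> \<rho> * (2 * real m) * real n" .
      have "\<rho> * (2 * real m) * real n \<le> \<alpha> * real n" "\<rho> * (2 * real m) * real n \<le> 1 * real n"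
        using \<rho> by (intro mult_right_mono; simp)+
      with le show "2 * real (m * t) \<le> \<alpha> * real n" "2 * real (m * t) \<le> real n" by linarith+
    qed
    define V' where "V' = V - M"
    have V': "finite V'" "card V' = n - m * t" using V M finM by (auto simp: V'_def card_Diff_subset)
    have mtn: "m * t \<le> n" using mt(2) by linarith
    have cV': "real (card V') = real n - real (m * t)" using V' mtn by (simp add: of_nat_diff)
    have "n2 \<le> card V'" using n(3) mt(2) cV' by linarith
    moreover have "(sigma k K + \<alpha>/2) * real (card V') \<le> real (card {v\<in>V'. insert v S \<in> E})"
      if S: "S \<subseteq> V'" "card S = k - 1" for S
    proof -
      have "card {v\<in>V. insert v S \<in> E} \<le> card ({v\<in>V'. insert v S \<in> E} \<union> M)"
        using V' finM by (intro card_mono) (auto simp: V'_def)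
      also have "\<dots> \<le> card {v\<in>V'. insert v S \<in> E} + card M" by (rule card_Un_le)
      finally have "real (card {v\<in>V. insert v S \<in> E}) \<le> real (card {v\<in>V'. insert v S \<in> E}) + real (m * t)" using M by linarith
      moreover have "S \<subseteq> V" using S by (auto simp: V'_def)
      ultimately have 1: "(sigma k K + \<alpha>) * real n - real (m * t) \<le> real (card {v\<in>V'. insert v S \<in> E})"
        using codeg(1)[of S] S by linarith
      have "(sigma k K + \<alpha>/2) * real (card V') \<le> (sigma k K + \<alpha>/2) * real n"
        using cV' \<alpha> by (intro mult_left_mono) (auto simp: sigma_def)
      also have "\<dots> \<le> (sigma k K + \<alpha>) * real n - real (m * t)" using mt(1) by (simp add: algebra_simps)
      finally show ?thesis using 1 by linarith
    qed
    ultimately obtain L where L: "L \<subseteq> V'" "real (card L) \<le> \<eta> * real (card V')" "tileable K E (V' - L)"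
      using tiling[of V' E] V' by blast
    have finL: "finite L" using L V' by (auto intro: finite_subset)
    have "b dvd card L"
    proof -
      have "b dvd card (V' - L)" using tileable_card_dvd[OF L(3)] V' b by simp
      moreover have "card (V' - L) = card V' - card L" using L finL by (simp add: card_Diff_subset)
      moreover have "card L \<le> card V'" using L(1) V'(1) by (rule card_mono[rotated])
      moreover have "b dvd card V'" using V' bn by (simp add: m_def)
      ultimately show ?thesis by (metis dvd_diffD1)
    qed
    have "tileable K E ((\<Union>i\<in>{..<t}. X i) \<union> L)"
    proof (rule absorb_leftover[OF _ finL b(2) \<open>b dvd card L\<close>])
      fix Q assume Q: "Q \<subseteq> L" "card Q = b"
      then have QQ: "Q \<in> \<Q>" using L by (auto simp: \<Q>_def V'_def)
      have "real (card L) \<le> \<eta> * real n"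
        using L(2) cV' \<eta> by (intro order.trans[OF L(2)] mult_left_mono) auto
      also have "\<dots> \<le> real (b * cnt Q)" using cntQ[OF QQ] by simp
      finally have "card L \<le> b * cnt Q" by (simp only: of_nat_le_iff)
      also have "cnt Q \<le> card {i\<in>{..<t}. tileable K E (X i \<union> Q)}"
        unfolding cnt_def by (intro card_mono) (auto simp: Abs_def absorbs_def X_def)
      then have "b * cnt Q \<le> b * card {i\<in>{..<t}. tileable K E (X i \<union> Q)}" by (rule mult_le_mono2)
      finally show "card L \<le> b * card {i\<in>{..<t}. tileable K E (X i \<union> Q)}" .
    next
      show "X i \<inter> L = {}" if "i \<in> {..<t}" for i using that L by (auto simp: V'_def M_def)
    qed (use XV Xdisj in auto)
    then have "tileable K E (M \<union> L)" unfolding M_def[symmetric] .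
    moreover have "(M \<union> L) \<inter> (V' - L) = {}" by (auto simp: V'_def)
    ultimately have "tileable K E ((M \<union> L) \<union> (V' - L))" using tileable_Un[OF _ L(3)] by blast
    moreover have "(M \<union> L) \<union> (V' - L) = V" using L M by (auto simp: V'_def)
    ultimately show "\<exists>P. perfect_packing K G P"
      using tileable_imp_perfect_packing[of K G] unfolding V_def E_def by simp
  qed
qed

end
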